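(* Let $G=(\mathbb Z^n,<_{\mathrm{lex}})$, let $k$ be a field and $K\subseteq k((G))$ a Hahn field with the first lifting property and the canonical second lifting property. Then \begin{align*} v\text{-}\mathrm{Aut}_{(k)}^{+}K&\simeq\big(((1+I_K)^{n+},\times)\rtimes(k^\times)^n\big)\rtimes(\mathrm{Aut}\,k\times\mathrm{UUT}_n(\mathbb Z)),\\ v\text{-}\mathrm{Aut}_{k}^{+}K&\simeq\big(((1+I_K)^{n+},\times)\rtimes(k^\times)^n\big)\rtimes\mathrm{UUT}_n(\mathbb Z). \end{align*}
   Context: $k$ is a field and $(G,+,<)$ a totally ordered abelian group. $\mathbb K=k((G))$ is the field of all formal series $a=\sum_{g\in G}a_gt^g$ ($a_g\in k$) whose support $\operatorname{supp}a=\{g:a_g\neq 0\}$ is well ordered, with termwise addition and convolution product. $k(G)\subseteq\mathbb K$ is the fraction field of the group ring $k[G]$. A Hahn field is a field $K$ with $k(G)\subseteq K\subseteq \mathbb K$. It carries the valuation $v(a)=\min\operatorname{supp}a$ for $a\neq0$, $v(0)=\infty$, with value group $G$, and $I_K=\{a\in K:v(a)>0\}$. The lexicographic order on $\mathbb Z^n$: $g>_{\mathrm{lex}}0$ iff $g\neq0$ and the first non-zero coordinate of $g$ is positive. $\mathrm{UUT}_n(\mathbb Z)$ is the multiplicative group of upper uni-triangular $n\times n$ integer matrices; for $G=(\mathbb Z^n,<_{\mathrm{lex}})$ it is isomorphic to $o\text{-}\mathrm{Aut}\,G$, the group of order preserving automorphisms of $G$. $\mathrm{Aut}\,k$ is the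 group of field automorphisms of $k$. $v\text{-}\mathrm{Aut}\,K$ is the group of field automorphisms $\sigma$ of $K$ for which there is $\sigma_G\in o\text{-}\mathrm{Aut}\,G$ with $\sigma_G(v(a))=v(\sigma(a))$ for all $a\in K^\times$. For any group of automorphisms of $K$, the subscript $(k)$ denotes the subgroup of those $\sigma$ with $\sigma(k)=k$, the subscript $k$ the subgroup of those with $\sigma|_k=\mathrm{id}_k$. For $\sigma\in v\text{-}\mathrm{Aut}\,K$ let $\sigma_k\in\mathrm{Aut}\,k$, $\sigma_k(c)=\sigma(c)_0$ (constant term) for $c\in k$, and let $\Phi\colon v\text{-}\mathrm{Aut}\,K\to\mathrm{Aut}\,k\times o\text{-}\mathrm{Aut}\,G$, $\sigma\mapsto(\sigma_k,\sigma_G)$ (a group homomorphism). Put $\mathrm{IntAut}\,K:=\ker\Phi$. $K$ has the first lifting property if there is an injective group homomorphism $\Psi\colon \mathrm{Aut}\,k\times o\text{-}\mathrm{Aut}\,G\to v\text{-}\mathrm{Aut}\,K$ with $\Phi\Psi=\mathrm{id}$; such a $\Psi$ is fixed and $\mathrm{ExtAut}\,K:=\operatorname{im}\Psi$. Convention: if the maps $\sum a_gt^g\mapsto\sum\rho(a_g)t^{\tau(g)}$ send $K$ onto $K$ for all $(\rho,\tau)$, then $\Psi$ is chosen to assign to $(\rho,\tau)$ this map restricted to $K$. $\mathrm{Hom}(G,k^\times)$ is the group, under pointwise multiplication, of homomorphisms $x\colon(G,+)\to(k^\times,\cdot)$, $x^g:=x(g)$; for $G=\mathbb Z^n$ it is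 isomorphic to $(k^\times)^n$. $K$ has the canonical second lifting property if $x\mapsto\rho_x$, $\rho_x(\sum a_gt^g)=\sum a_gx^gt^g$, is a well defined group homomorphism $\mathrm{Hom}(G,k^\times)\to\mathrm{IntAut}\,K$. A family $\{a_{(i)}\}_{i\in I}\subseteq\mathbb K$ is summable if $\bigcup_i\operatorname{supp}a_{(i)}$ is well ordered and each $g$ lies in $\operatorname{supp}a_{(i)}$ for only finitely many $i$; its sum is then $\sum_g\big(\sum_i(a_{(i)})_g\big)t^g\in\mathbb K$. It is $K$-summable if it is a summable family of elements of $K$ whose sum lies in $K$. A map $\sigma\colon K\to K$ is $K$-summable if for every $a=\sum a_gt^g\in K$ the family $\{\sigma(a_gt^g):g\in\operatorname{supp}a\}$ is $K$-summable with sum $\sigma(a)$. $\sigma\in v\text{-}\mathrm{Aut}\,K$ is strongly additive if both $\sigma$ and $\sigma^{-1}$ are $K$-summable. The superscript $+$ on a group of automorphisms denotes its subset of strongly additive elements. $\mathrm{Hom}^+(G,1+I_K)$ is the set of group homomorphisms $u\colon(G,+)\to(1+I_K,\cdot)$ such that for every $a\in K$ the family $\{a_gu(g)t^g:g\in\operatorname{supp}a\}$ is $K$-summable, with the operation $(u\times w)(g)=\tau_u(w(g))\,u(g)$, where $\tau_u(\sum a_gt^g)=\sum a_gu(g)t^g$ on $K$. Fix generators $g_1,\dots,g_n$ of $G=\mathbb Z^n$ and let $\xi\colon\mathrm{Hom}(G,1+I_K)\to(1+I_K)^n$, $u\mapsto(u(g_1),\dots,u(g_n))$. Put $(1+I_K)^{n+}:=\xi(\mathrm{Hom}^+(G,1+I_K))$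 with the operation $\mathbf u_1\times\mathbf u_2:=\xi(\xi^{-1}(\mathbf u_1)\times\xi^{-1}(\mathbf u_2))$. Semi-direct products are written with the normal factor on the left; the actions are induced by conjugation of automorphisms via the identifications $u\mapsto\tau_u$, $x\mapsto\rho_x$ and $\mathrm{ExtAut}\,K\simeq\mathrm{Aut}\,k\times o\text{-}\mathrm{Aut}\,G$ (respectively $\mathrm{ExtAut}_kK\simeq o\text{-}\mathrm{Aut}\,G$).
   Formalization: (1+I_K)^{n+} is replaced by its group of units, since under × it is in general only a monoid (e.g. K=Q(t)); and if K is not stable under the canonical maps, the fixed lifting is additionally required to satisfy ExtAut K ⊆ v-Aut_(k)^+ K, without which the claim can fail. *)

theory Defs
  imports
    "HOL-Analysis.Cartesian_Space"
    "HOL-Algebra.Bij"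
    "HOL-Algebra.QuotRing"
    "HOL-Algebra.Subrings"
    "HOL-Algebra.Generated_Groups"
    "HOL-Algebra.Product_Groups"
begin

section \<open>Hahn series\<close>

text \<open>
  The ordered group \<open>G\<close> is a type \<open>'g\<close> of class \<^class>\<open>linordered_ab_group_add\<close>, the coefficient
  field \<open>k\<close> a type \<open>'k\<close> of class \<^class>\<open>field\<close>; a formal series is its coefficient function.
\<close>

definition supp :: "('g \<Rightarrow> 'k::zero) \<Rightarrow> 'g set" where
  "supp a = {g. a g \<noteq> 0}"

definition well_ordered :: "'g::linorder set \<Rightarrow> bool" where
  "well_ordered S \<longleftrightarrow> (\<forall>A. A \<subseteq> S \<and> A \<noteq> {} \<longrightarrow> (\<exists>m\<in>A. \<forall>x\<in>A. m \<le> x))"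

definition monom :: "'k::zero \<Rightarrow> 'g \<Rightarrow> 'g \<Rightarrow> 'k" where
  "monom c g = (\<lambda>h. if h = g then c else 0)"

text \<open>The index set of the sum in the product is finite because both supports are well ordered.\<close>

definition hahn_series :: "('g::linordered_ab_group_add \<Rightarrow> 'k::field) ring" where
  "hahn_series =
    \<lparr>carrier = {a. well_ordered (supp a)},
     mult = (\<lambda>a b g. \<Sum>h\<in>{h. a h \<noteq> 0 \<and> b (g - h) \<noteq> 0}. a h * b (g - h)),
     one = monom 1 0,
     zero = (\<lambda>g. 0),
     add = (\<lambda>a b g. a g + b g)\<rparr>"

definition group_ring :: "('g::linordered_ab_group_add \<Rightarrow> 'k::field) set" where
  "group_ring = {a. finite (supp a)}"

definition group_ring_fractions :: "('g::linordered_ab_group_add \<Rightarrow> 'k::field) set" where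
  "group_ring_fractions =
    {p \<otimes>\<^bsub>hahn_series\<^esub> inv\<^bsub>hahn_series\<^esub> q | p q.
       p \<in> group_ring \<and> q \<in> group_ring \<and> q \<noteq> \<zero>\<^bsub>hahn_series\<^esub>}"

definition hahn_field :: "('g::linordered_ab_group_add \<Rightarrow> 'k::field) set \<Rightarrow> bool" where
  "hahn_field K \<longleftrightarrow> subfield K hahn_series \<and> group_ring_fractions \<subseteq> K"

text \<open>Only meaningful for nonzero series.\<close>

definition val :: "('g::linorder \<Rightarrow> 'k::zero) \<Rightarrow> 'g" where
  "val a = (LEAST g. g \<in> supp a)"

text \<open>The zero series has valuation \<open>\<infinity>\<close> and so belongs to the ideal.\<close>

definition val_ideal :: "('g::linordered_ab_group_add \<Rightarrow> 'k::field) set \<Rightarrow> ('g \<Rightarrow> 'k) set" where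
  "val_ideal K = {a \<in> K. a = \<zero>\<^bsub>hahn_series\<^esub> \<or> val a > 0}"

section \<open>Summability\<close>

definition family_sum :: "('i \<Rightarrow> 'g \<Rightarrow> 'k::comm_monoid_add) \<Rightarrow> 'i set \<Rightarrow> 'g \<Rightarrow> 'k" where
  "family_sum F I = (\<lambda>g. \<Sum>i\<in>{i \<in> I. F i g \<noteq> 0}. F i g)"

definition summable_family ::
    "('i \<Rightarrow> 'g::linordered_ab_group_add \<Rightarrow> 'k::field) \<Rightarrow> 'i set \<Rightarrow> bool" where
  "summable_family F I \<longleftrightarrow>
     well_ordered (\<Union>i\<in>I. supp (F i)) \<and> (\<forall>g. finite {i \<in> I. g \<in> supp (F i)})"

definition K_summable_family ::
    "('g::linordered_ab_group_add \<Rightarrow> 'k::field) set \<Rightarrow> ('i \<Rightarrow> 'g \<Rightarrow> 'k) \<Rightarrow> 'i set \<Rightarrow> bool" where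
  "K_summable_family K F I \<longleftrightarrow>
     summable_family F I \<and> (\<forall>i\<in>I. F i \<in> K) \<and> family_sum F I \<in> K"

definition K_summable_map ::
    "('g::linordered_ab_group_add \<Rightarrow> 'k::field) set \<Rightarrow> (('g \<Rightarrow> 'k) \<Rightarrow> ('g \<Rightarrow> 'k)) \<Rightarrow> bool" where
  "K_summable_map K \<sigma> \<longleftrightarrow>
     (\<forall>a\<in>K. K_summable_family K (\<lambda>g. \<sigma> (monom (a g) g)) (supp a) \<and>
            family_sum (\<lambda>g. \<sigma> (monom (a g) g)) (supp a) = \<sigma> a)"

definition strongly_additive ::
    "('g::linordered_ab_group_add \<Rightarrow> 'k::field) set \<Rightarrow> (('g \<Rightarrow> 'k) \<Rightarrow> ('g \<Rightarrow> 'k)) \<Rightarrow> bool" where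
  "strongly_additive K \<sigma> \<longleftrightarrow> K_summable_map K \<sigma> \<and> K_summable_map K (inv_into K \<sigma>)"

section \<open>Automorphism groups\<close>

definition Aut_field :: "('k::field \<Rightarrow> 'k) monoid" where
  "Aut_field =
    \<lparr>carrier = {\<rho>. bij \<rho> \<and> (\<forall>a b. \<rho> (a + b) = \<rho> a + \<rho> b) \<and> (\<forall>a b. \<rho> (a * b) = \<rho> a * \<rho> b)},
     mult = (\<circ>), one = id\<rparr>"

definition o_Aut :: "('g::linordered_ab_group_add \<Rightarrow> 'g) monoid" where
  "o_Aut =
    \<lparr>carrier = {\<tau>. bij \<tau> \<and> (\<forall>g h. \<tau> (g + h) = \<tau> g + \<tau> h) \<and> strict_mono \<tau>},
     mult = (\<circ>), one = id\<rparr>"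

text \<open>Automorphisms of \<open>K\<close> are extensional functions on \<open>K\<close>, as in \<^const>\<open>BijGroup\<close>.\<close>

definition v_Aut ::
    "('g::linordered_ab_group_add \<Rightarrow> 'k::field) set \<Rightarrow> (('g \<Rightarrow> 'k) \<Rightarrow> ('g \<Rightarrow> 'k)) monoid" where
  "v_Aut K = BijGroup K \<lparr>carrier :=
     {\<sigma> \<in> Bij K. \<sigma> \<in> ring_iso (hahn_series\<lparr>carrier := K\<rparr>) (hahn_series\<lparr>carrier := K\<rparr>) \<and>
       (\<exists>\<tau>\<in>carrier o_Aut. \<forall>a \<in> K - {\<zero>\<^bsub>hahn_series\<^esub>}. \<tau> (val a) = val (\<sigma> a))}\<rparr>"

definition constants :: "('g::linordered_ab_group_add \<Rightarrow> 'k::field) set" where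
  "constants = range (\<lambda>c. monom c 0)"

definition v_Aut_stab_plus ::
    "('g::linordered_ab_group_add \<Rightarrow> 'k::field) set \<Rightarrow> (('g \<Rightarrow> 'k) \<Rightarrow> ('g \<Rightarrow> 'k)) monoid" where
  "v_Aut_stab_plus K = (v_Aut K) \<lparr>carrier :=
     {\<sigma> \<in> carrier (v_Aut K). \<sigma> ` constants = constants \<and> strongly_additive K \<sigma>}\<rparr>"

definition v_Aut_fix_plus ::
    "('g::linordered_ab_group_add \<Rightarrow> 'k::field) set \<Rightarrow> (('g \<Rightarrow> 'k) \<Rightarrow> ('g \<Rightarrow> 'k)) monoid" where
  "v_Aut_fix_plus K = (v_Aut K) \<lparr>carrier :=
     {\<sigma> \<in> carrier (v_Aut K). (\<forall>c\<in>constants. \<sigma> c = c) \<and> strongly_additive K \<sigma>}\<rparr>"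

text \<open>
  The second component is unique, since every element of \<open>G\<close> is the valuation of a monomial.
\<close>

definition Phi ::
    "('g::linordered_ab_group_add \<Rightarrow> 'k::field) set \<Rightarrow> (('g \<Rightarrow> 'k) \<Rightarrow> ('g \<Rightarrow> 'k))
      \<Rightarrow> ('k \<Rightarrow> 'k) \<times> ('g \<Rightarrow> 'g)" where
  "Phi K \<sigma> =
     (\<lambda>c. \<sigma> (monom c 0) 0,
      THE \<tau>. \<tau> \<in> carrier o_Aut \<and> (\<forall>a \<in> K - {\<zero>\<^bsub>hahn_series\<^esub>}. \<tau> (val a) = val (\<sigma> a)))"

definition IntAut ::
    "('g::linordered_ab_group_add \<Rightarrow> 'k::field) set \<Rightarrow> (('g \<Rightarrow> 'k) \<Rightarrow> ('g \<Rightarrow> 'k)) monoid" where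
  "IntAut K = (v_Aut K) \<lparr>carrier := kernel (v_Aut K) (Aut_field \<times>\<times> o_Aut) (Phi K)\<rparr>"

section \<open>Lifting properties\<close>

definition first_lifting ::
    "('g::linordered_ab_group_add \<Rightarrow> 'k::field) set
      \<Rightarrow> (('k \<Rightarrow> 'k) \<times> ('g \<Rightarrow> 'g) \<Rightarrow> ('g \<Rightarrow> 'k) \<Rightarrow> ('g \<Rightarrow> 'k)) \<Rightarrow> bool" where
  "first_lifting K \<Psi> \<longleftrightarrow>
     \<Psi> \<in> hom (Aut_field \<times>\<times> o_Aut) (v_Aut K) \<and>
     inj_on \<Psi> (carrier (Aut_field \<times>\<times> o_Aut)) \<and>
     (\<forall>p\<in>carrier (Aut_field \<times>\<times> o_Aut). Phi K (\<Psi> p) = p)"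

definition ExtAut ::
    "(('k::field \<Rightarrow> 'k) \<times> ('g::linordered_ab_group_add \<Rightarrow> 'g) \<Rightarrow> ('g \<Rightarrow> 'k) \<Rightarrow> ('g \<Rightarrow> 'k))
      \<Rightarrow> (('g \<Rightarrow> 'k) \<Rightarrow> ('g \<Rightarrow> 'k)) set" where
  "ExtAut \<Psi> = \<Psi> ` carrier (Aut_field \<times>\<times> o_Aut)"

text \<open>
  A lifting other than the canonical one need not consist of strongly additive maps preserving
  the constants, so for such a lifting this has to be required.
\<close>

text \<open>The map sending the series with coefficients \<open>a g\<close> at \<open>g\<close> to that with \<open>\<rho> (a g)\<close> at \<open>\<tau> g\<close>.\<close>

definition canonical_lift ::
    "('k \<Rightarrow> 'k) \<times> ('g \<Rightarrow> 'g) \<Rightarrow> ('g \<Rightarrow> 'k) \<Rightarrow> ('g \<Rightarrow> 'k)" where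
  "canonical_lift = (\<lambda>(\<rho>, \<tau>) a h. \<rho> (a (inv_into UNIV \<tau> h)))"

definition canonical_first_lifting_property ::
    "('g::linordered_ab_group_add \<Rightarrow> 'k::field) set \<Rightarrow> bool" where
  "canonical_first_lifting_property K \<longleftrightarrow>
     (\<forall>p\<in>carrier (Aut_field \<times>\<times> o_Aut). canonical_lift p ` K = K)"

definition add_group :: "'g::ab_group_add monoid" where
  "add_group = \<lparr>carrier = UNIV, mult = (+), one = 0\<rparr>"

definition field_units :: "'k::field monoid" where
  "field_units = \<lparr>carrier = UNIV - {0}, mult = (*), one = 1\<rparr>"

text \<open>
  Since the carrier of \<^const>\<open>add_group\<close> is \<^const>\<open>UNIV\<close>, the functions in
  \<open>hom add_group H\<close> are determined by their values on it.
\<close>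

definition Hom_units :: "('g::ab_group_add \<Rightarrow> 'k::field) monoid" where
  "Hom_units = \<lparr>carrier = hom add_group field_units, mult = (\<lambda>x y g. x g * y g), one = (\<lambda>g. 1)\<rparr>"

definition rho ::
    "('g::linordered_ab_group_add \<Rightarrow> 'k::field) set \<Rightarrow> ('g \<Rightarrow> 'k) \<Rightarrow> ('g \<Rightarrow> 'k) \<Rightarrow> ('g \<Rightarrow> 'k)" where
  "rho K x = (\<lambda>a\<in>K. \<lambda>g. a g * x g)"

definition canonical_second_lifting_property ::
    "('g::linordered_ab_group_add \<Rightarrow> 'k::field) set \<Rightarrow> bool" where
  "canonical_second_lifting_property K \<longleftrightarrow> rho K \<in> hom Hom_units (IntAut K)"

section \<open>One-units\<close>

definition one_units ::
    "('g::linordered_ab_group_add \<Rightarrow> 'k::field) set \<Rightarrow> ('g \<Rightarrow> 'k) monoid" where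
  "one_units K =
    \<lparr>carrier = {\<one>\<^bsub>hahn_series\<^esub> \<oplus>\<^bsub>hahn_series\<^esub> a | a. a \<in> val_ideal K},
     mult = mult hahn_series, one = \<one>\<^bsub>hahn_series\<^esub>\<rparr>"

definition tau_family ::
    "('g::linordered_ab_group_add \<Rightarrow> 'g \<Rightarrow> 'k::field) \<Rightarrow> ('g \<Rightarrow> 'k) \<Rightarrow> 'g \<Rightarrow> 'g \<Rightarrow> 'k" where
  "tau_family u a = (\<lambda>g. monom (a g) g \<otimes>\<^bsub>hahn_series\<^esub> u g)"

definition tau ::
    "('g::linordered_ab_group_add \<Rightarrow> 'k::field) set \<Rightarrow> ('g \<Rightarrow> 'g \<Rightarrow> 'k)
      \<Rightarrow> ('g \<Rightarrow> 'k) \<Rightarrow> ('g \<Rightarrow> 'k)" where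
  "tau K u = (\<lambda>a\<in>K. family_sum (tau_family u a) (supp a))"

definition Hom_plus ::
    "('g::linordered_ab_group_add \<Rightarrow> 'k::field) set \<Rightarrow> ('g \<Rightarrow> 'g \<Rightarrow> 'k) monoid" where
  "Hom_plus K =
    \<lparr>carrier = {u \<in> hom add_group (one_units K).
                  \<forall>a\<in>K. K_summable_family K (tau_family u a) (supp a)},
     mult = (\<lambda>u w g. tau K u (w g) \<otimes>\<^bsub>hahn_series\<^esub> u g),
     one = (\<lambda>g. \<one>\<^bsub>hahn_series\<^esub>)\<rparr>"

text \<open>Evaluation of a homomorphism at a family of generators \<open>e\<close>, and its inverse.\<close>

definition at_gens :: "('n \<Rightarrow> 'g) \<Rightarrow> ('g \<Rightarrow> 'a) \<Rightarrow> 'n \<Rightarrow> 'a" where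
  "at_gens e f = (\<lambda>i. f (e i))"

definition from_gens ::
    "('a, 'm) monoid_scheme \<Rightarrow> ('n \<Rightarrow> 'g::ab_group_add) \<Rightarrow> ('n \<Rightarrow> 'a) \<Rightarrow> 'g \<Rightarrow> 'a" where
  "from_gens H e = inv_into (hom add_group H) (at_gens e)"

definition one_units_plus ::
    "('g::linordered_ab_group_add \<Rightarrow> 'k::field) set \<Rightarrow> ('n \<Rightarrow> 'g) \<Rightarrow> ('n \<Rightarrow> 'g \<Rightarrow> 'k) monoid" where
  "one_units_plus K e =
    \<lparr>carrier = at_gens e ` carrier (Hom_plus K),
     mult = (\<lambda>u w. at_gens e
       (from_gens (one_units K) e u \<otimes>\<^bsub>Hom_plus K\<^esub> from_gens (one_units K) e w)),
     one = at_gens e \<one>\<^bsub>Hom_plus K\<^esub>\<rparr>"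

text \<open>
  For arbitrary \<open>K\<close> the structure \<^const>\<open>one_units_plus\<close> is only a monoid. For \<open>K = k(t)\<close> and
  \<open>G = \<int>\<close>, the element \<open>1 + t\<close> belongs to it, but \<open>a \<mapsto> a(t + t\<^sup>2)\<close> is not onto \<open>k(t)\<close>, so
  \<open>1 + t\<close> has no inverse. Its units are the tuples whose map \<^const>\<open>tau\<close> is strongly additive,
  i.e. bijective with both directions \<open>K\<close>-summable. If it is a group, nothing changes:
\<close>

lemma units_of_group_eq:
  fixes M :: "'a monoid"
  assumes "group M"
  shows "units_of M = M"
  using group.Units_eq[OF assms] by (simp add: units_of_def)

definition field_units_power :: "('n \<Rightarrow> 'k::field) monoid" where
  "field_units_power = product_group UNIV (\<lambda>_. field_units)"

section \<open>Semi-direct products\<close>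

definition semidirect ::
    "('a, 'm) monoid_scheme \<Rightarrow> ('b, 'l) monoid_scheme \<Rightarrow> ('b \<Rightarrow> 'a \<Rightarrow> 'a) \<Rightarrow> ('a \<times> 'b) monoid" where
  "semidirect N H \<theta> =
    \<lparr>carrier = carrier N \<times> carrier H,
     mult = (\<lambda>(n1, h1) (n2, h2). (n1 \<otimes>\<^bsub>N\<^esub> \<theta> h1 n2, h1 \<otimes>\<^bsub>H\<^esub> h2)),
     one = (\<one>\<^bsub>N\<^esub>, \<one>\<^bsub>H\<^esub>)\<rparr>"

text \<open>
  The action of \<open>H\<close> on \<open>N\<close> induced by conjugation in an ambient group \<open>A\<close>, when \<open>N\<close> and \<open>H\<close> are
  identified with subgroups of \<open>A\<close> along \<open>j\<close> and \<open>l\<close>.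
\<close>

definition conj_action ::
    "('c, 'p) monoid_scheme \<Rightarrow> ('a, 'm) monoid_scheme \<Rightarrow> ('a \<Rightarrow> 'c) \<Rightarrow> ('b \<Rightarrow> 'c) \<Rightarrow> 'b \<Rightarrow> 'a \<Rightarrow> 'a" where
  "conj_action A N j l h =
     (\<lambda>n\<in>carrier N. inv_into (carrier N) j (l h \<otimes>\<^bsub>A\<^esub> j n \<otimes>\<^bsub>A\<^esub> inv\<^bsub>A\<^esub> (l h)))"

section \<open>The lexicographically ordered group of integer vectors\<close>

text \<open>A copy of \<open>int ^ 'n\<close>, which already carries the componentwise order.\<close>

typedef 'n zlex = "UNIV :: (int ^ 'n::finite) set"
  morphisms coords of_coords ..

instantiation zlex :: (finite) ab_group_add
begin

definition "0 = of_coords 0"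
definition "x + y = of_coords (coords x + coords y)"
definition "x - y = of_coords (coords x - coords y)"
definition "- x = of_coords (- coords x)"

instance
  by standard
    (simp_all add: zero_zlex_def plus_zlex_def minus_zlex_def uminus_zlex_def
      of_coords_inverse coords_inverse add_ac)

end

definition lex_pos :: "int ^ 'n::{finite,linorder} \<Rightarrow> bool" where
  "lex_pos x \<longleftrightarrow> (\<exists>i. x $ i > 0 \<and> (\<forall>j<i. x $ j = 0))"

lemma lex_pos_add:
  assumes "lex_pos x" "lex_pos y"
  shows "lex_pos (x + y)"
proof -
  obtain i where i: "x $ i > 0" "\<And>j. j < i \<Longrightarrow> x $ j = 0"
    using assms(1) by (auto simp: lex_pos_def)
  obtain i' where i': "y $ i' > 0" "\<And>j. j < i' \<Longrightarrow> y $ j = 0"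
    using assms(2) by (auto simp: lex_pos_def)
  have "(x + y) $ min i i' > 0"
    using i i' by (cases i i' rule: linorder_cases) (auto simp: min_def)
  moreover have "\<forall>j<min i i'. (x + y) $ j = 0"
    using i i' by auto
  ultimately show ?thesis
    unfolding lex_pos_def by blast
qed

lemma not_lex_pos_zero: "\<not> lex_pos 0"
  by (simp add: lex_pos_def)

lemma lex_pos_cases:
  assumes "x \<noteq> 0"
  shows "lex_pos x \<or> lex_pos (- x)"
proof -
  define m where "m = Min {i. x $ i \<noteq> 0}"
  have "{i. x $ i \<noteq> 0} \<noteq> {}"
    using assms by (auto simp: vec_eq_iff)
  then have "m \<in> {i. x $ i \<noteq> 0}"
    unfolding m_def by (intro Min_in) simp_all
  then have m: "x $ m \<noteq> 0"
    by simp
  have zero: "x $ j = 0" if "j < m" for j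
  proof (rule ccontr)
    assume "x $ j \<noteq> 0"
    then have "m \<le> j"
      unfolding m_def by (intro Min_le) simp_all
    with that show False by simp
  qed
  show ?thesis
  proof (cases "x $ m > 0")
    case True
    then show ?thesis using zero by (auto simp: lex_pos_def)
  next
    case False
    then have "(- x) $ m > 0" "\<forall>j<m. (- x) $ j = 0" using m zero by auto
    then show ?thesis unfolding lex_pos_def by blast
  qed
qed

instantiation zlex :: ("{finite,linorder}") linordered_ab_group_add
begin

definition "x < y \<longleftrightarrow> lex_pos (coords (y - x))" for x y :: "'a zlex"
definition "x \<le> y \<longleftrightarrow> x = y \<or> x < y" for x y :: "'a zlex"

instance
proof
  fix x y z :: "'a zlex"
  have minus: "coords (a - b) = coords a - coords b" for a b :: "'a zlex"
    by (simp add: minus_zlex_def of_coords_inverse)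
  have trans: "a < c" if "a < b" "b < c" for a b c :: "'a zlex"
    using lex_pos_add[of "coords b - coords a" "coords c - coords b"] that
    by (simp add: less_zlex_def minus)
  have irrefl: "\<not> a < a" for a :: "'a zlex"
    unfolding less_zlex_def minus by (simp add: not_lex_pos_zero)
  show "x < y \<longleftrightarrow> x \<le> y \<and> \<not> y \<le> x"
    unfolding less_eq_zlex_def using trans irrefl by metis
  show "x \<le> x"
    by (simp add: less_eq_zlex_def)
  show "x \<le> z" if "x \<le> y" "y \<le> z"
    using that trans unfolding less_eq_zlex_def by metis
  show "x = y" if "x \<le> y" "y \<le> x"
    using that trans irrefl unfolding less_eq_zlex_def by metis
  show "x \<le> y \<or> y \<le> x"
    using lex_pos_cases[of "coords y - coords x"]
    by (auto simp: less_eq_zlex_def less_zlex_def minus coords_inject)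
  show "z + x \<le> z + y" if "x \<le> y"
    using that by (auto simp: less_eq_zlex_def less_zlex_def)
qed

end

type_synonym 'n int_matrix = "int ^ 'n ^ 'n"

definition UUT :: "('n::{finite,linorder}) int_matrix monoid" where
  "UUT = \<lparr>carrier = {A. (\<forall>i. A $ i $ i = 1) \<and> (\<forall>i j. j < i \<longrightarrow> A $ i $ j = 0)},
          mult = (**), one = mat 1\<rparr>"

text \<open>
  With respect to the lexicographic order, order automorphisms are given by upper uni-triangular
  matrices acting on row vectors from the right. The inverse turns this right action into a group
  isomorphism from \<^const>\<open>UUT\<close> to \<^const>\<open>o_Aut\<close>.
\<close>

definition UUT_act :: "('n::{finite,linorder}) int_matrix \<Rightarrow> 'n zlex \<Rightarrow> 'n zlex" where
  "UUT_act A x = of_coords (coords x v* matrix_inv A)"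

section \<open>The semi-direct factors\<close>

text \<open>The identifications of one-unit tuples and of tuples in \<open>k\<^sup>\<times>\<close> with automorphisms of \<open>K\<close>.\<close>

definition tau_tuple ::
    "('g::linordered_ab_group_add \<Rightarrow> 'k::field) set \<Rightarrow> ('n \<Rightarrow> 'g) \<Rightarrow> ('n \<Rightarrow> 'g \<Rightarrow> 'k)
      \<Rightarrow> ('g \<Rightarrow> 'k) \<Rightarrow> ('g \<Rightarrow> 'k)" where
  "tau_tuple K e u = tau K (from_gens (one_units K) e u)"

definition rho_tuple ::
    "('g::linordered_ab_group_add \<Rightarrow> 'k::field) set \<Rightarrow> ('n \<Rightarrow> 'g) \<Rightarrow> ('n \<Rightarrow> 'k)
      \<Rightarrow> ('g \<Rightarrow> 'k) \<Rightarrow> ('g \<Rightarrow> 'k)" where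
  "rho_tuple K e x = rho K (from_gens field_units e x)"

definition units_action ::
    "('g::linordered_ab_group_add \<Rightarrow> 'k::field) set \<Rightarrow> ('n \<Rightarrow> 'g)
      \<Rightarrow> ('n \<Rightarrow> 'k) \<Rightarrow> ('n \<Rightarrow> 'g \<Rightarrow> 'k) \<Rightarrow> ('n \<Rightarrow> 'g \<Rightarrow> 'k)" where
  "units_action K e =
     conj_action (v_Aut K) (units_of (one_units_plus K e)) (tau_tuple K e) (rho_tuple K e)"

definition int_factor ::
    "('g::linordered_ab_group_add \<Rightarrow> 'k::field) set \<Rightarrow> ('n \<Rightarrow> 'g)
      \<Rightarrow> (('n \<Rightarrow> 'g \<Rightarrow> 'k) \<times> ('n \<Rightarrow> 'k)) monoid" where
  "int_factor K e =
     semidirect (units_of (one_units_plus K e)) field_units_power (units_action K e)"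

definition int_factor_aut ::
    "('g::linordered_ab_group_add \<Rightarrow> 'k::field) set \<Rightarrow> ('n \<Rightarrow> 'g)
      \<Rightarrow> ('n \<Rightarrow> 'g \<Rightarrow> 'k) \<times> ('n \<Rightarrow> 'k) \<Rightarrow> ('g \<Rightarrow> 'k) \<Rightarrow> ('g \<Rightarrow> 'k)" where
  "int_factor_aut K e = (\<lambda>(u, x). tau_tuple K e u \<otimes>\<^bsub>v_Aut K\<^esub> rho_tuple K e x)"

definition ext_action ::
    "('n::{finite,linorder} zlex \<Rightarrow> 'k::field) set \<Rightarrow> ('n \<Rightarrow> 'n zlex)
      \<Rightarrow> (('k \<Rightarrow> 'k) \<times> ('n zlex \<Rightarrow> 'n zlex) \<Rightarrow> ('n zlex \<Rightarrow> 'k) \<Rightarrow> ('n zlex \<Rightarrow> 'k))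
      \<Rightarrow> ('k \<Rightarrow> 'k) \<times> 'n int_matrix
      \<Rightarrow> ('n \<Rightarrow> 'n zlex \<Rightarrow> 'k) \<times> ('n \<Rightarrow> 'k) \<Rightarrow> ('n \<Rightarrow> 'n zlex \<Rightarrow> 'k) \<times> ('n \<Rightarrow> 'k)" where
  "ext_action K e \<Psi> =
     conj_action (v_Aut K) (int_factor K e) (int_factor_aut K e) (\<lambda>(\<rho>, A). \<Psi> (\<rho>, UUT_act A))"

definition ext_fix_action ::
    "('n::{finite,linorder} zlex \<Rightarrow> 'k::field) set \<Rightarrow> ('n \<Rightarrow> 'n zlex)
      \<Rightarrow> (('k \<Rightarrow> 'k) \<times> ('n zlex \<Rightarrow> 'n zlex) \<Rightarrow> ('n zlex \<Rightarrow> 'k) \<Rightarrow> ('n zlex \<Rightarrow> 'k))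
      \<Rightarrow> 'n int_matrix
      \<Rightarrow> ('n \<Rightarrow> 'n zlex \<Rightarrow> 'k) \<times> ('n \<Rightarrow> 'k) \<Rightarrow> ('n \<Rightarrow> 'n zlex \<Rightarrow> 'k) \<times> ('n \<Rightarrow> 'k)" where
  "ext_fix_action K e \<Psi> =
     conj_action (v_Aut K) (int_factor K e) (int_factor_aut K e) (\<lambda>A. \<Psi> (id, UUT_act A))"

end

theory Submission
  imports Defs "HOL-Library.Groups_Big_Fun" "HOL-Library.Set_Algebras"
begin

text \<open>
  An automorphism \<open>\<sigma>\<close> that maps the constants onto themselves is governed by its values
  \<open>\<sigma>(t\<^sup>g) = x(g) u(g) t\<^bsup>\<tau>(g)\<^esup>\<close>, with leading exponent \<open>\<tau>(g)\<close>, leading coefficient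
  \<open>x(g)\<close> and a one-unit \<open>u(g)\<close>. Dividing by the lift \<open>\<Psi>(\<rho>, \<tau>)\<close> of its action \<open>\<rho>\<close> on
  \<open>k\<close> and \<open>\<tau>\<close> on \<open>G\<close> leaves an automorphism that fixes \<open>k\<close> and all valuations. For that one
  \<open>x\<close> is a homomorphism, because leading terms multiply, and dividing by \<open>\<rho>\<^sub>x\<close> leaves an
  automorphism with \<open>\<sigma>(t\<^sup>g) = u(g) t\<^sup>g\<close>. Now \<open>u\<close> is a homomorphism into the one-units, and
  \<open>K\<close>-summability says exactly that the automorphism is \<open>\<tau>\<^sub>u\<close>. The three factors are read off
  from leading data one after the other, which makes the factorization unique, and the conditions
  that cut out the partial products are stable under conjugation by the next factor. The abstract
  locale \<open>internal_semidirect\<close> turns this into the two nested semi-direct products; it is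
  instantiated with \<open>tau_tuple_image\<close>, \<open>int_factor_aut_image\<close> and \<open>stab_plus_decompose\<close>.

  What has to be proved about infinite sums is that the strongly additive automorphisms form a group
  and that composing the maps \<open>\<tau>\<^sub>u\<close> gives the product of homomorphisms. Both mean exchanging two
  infinite sums although \<open>K\<close> is not complete. Here it matters that \<open>G\<close> is finitely generated:
  every \<open>u(g)\<close> is a product of powers of finitely many one-units, so by Neumann's lemma
  (\<open>well_ordered_additive_closure\<close>) all supports of the \<open>u(g)\<close> lie in one well-ordered monoid
  \<open>T\<close> of nonnegative elements (\<open>hom_one_units_support\<close>). Hence \<open>\<sigma>(t\<^sup>g)\<close> is supported in
  \<open>\<tau>(g) + T\<close>; such maps are called controlled. Images of monomials under a controlled map are
  summable in the field of all Hahn series, only finitely many terms reach a given exponent, and the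
  exchange of sums reduces to finite sums (\<open>controlled_compose\<close>, \<open>tau_mult\<close>).

  Finally, an order automorphism of the lexicographic lattice preserves the relation of being
  infinitely smaller, hence the flag of convex subgroups, hence is a uni-triangular matrix
  (\<open>o_Aut_eq_row_act\<close>).
\<close>

section \<open>Well-ordered subsets of an ordered abelian group\<close>

lemma well_ordered_subset: "well_ordered S \<Longrightarrow> T \<subseteq> S \<Longrightarrow> well_ordered T"
  unfolding well_ordered_def by blast

lemma well_ordered_singleton: "well_ordered {g}"
  unfolding well_ordered_def by (auto simp: subset_singleton_iff)

lemma well_ordered_empty: "well_ordered {}"
  unfolding well_ordered_def by auto

lemma well_ordered_image:
  assumes "well_ordered S" "mono f"
  shows "well_ordered (f ` S)"
  unfolding well_ordered_def
proof (intro allI impI, elim conjE)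
  fix A assume A: "A \<subseteq> f ` S" "A \<noteq> {}"
  define B where "B = {s \<in> S. f s \<in> A}"
  have "B \<subseteq> S" "B \<noteq> {}"
    using A unfolding B_def by auto
  then obtain m where m: "m \<in> B" "\<forall>x\<in>B. m \<le> x"
    using assms(1) unfolding well_ordered_def by meson
  have "f m \<in> A"
    using m B_def by auto
  moreover have "f m \<le> x" if "x \<in> A" for x
    using A that m monoD[OF assms(2)] unfolding B_def by blast
  ultimately show "\<exists>m\<in>A. \<forall>x\<in>A. m \<le> x"
    by blast
qed

lemma well_ordered_Un:
  fixes S T :: "'g::linorder set"
  assumes "well_ordered S" "well_ordered T"
  shows "well_ordered (S \<union> T)"
  unfolding well_ordered_def
proof (intro allI impI, elim conjE)
  fix A assume A: "A \<subseteq> S \<union> T" "A \<noteq> {}"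
  have *: "A \<inter> U = {} \<or> (\<exists>m\<in>A \<inter> U. \<forall>x\<in>A \<inter> U. m \<le> x)" if U: "well_ordered U" for U :: "'g set"
  proof (cases "A \<inter> U = {}")
    case False
    moreover have "A \<inter> U \<subseteq> U"
      by simp
    ultimately show ?thesis
      using U unfolding well_ordered_def by blast
  qed simp
  show "\<exists>m\<in>A. \<forall>x\<in>A. m \<le> x"
  proof (cases "A \<inter> S = {} \<or> A \<inter> T = {}")
    case True
    then have "A \<inter> S = A \<or> A \<inter> T = A"
      using A by blast
    then show ?thesis
      using *[OF assms(1)] *[OF assms(2)] A(2) by metis
  next
    case False
    then obtain m n where mn: "m \<in> A" "\<forall>x\<in>A \<inter> S. m \<le> x" "n \<in> A" "\<forall>x\<in>A \<inter> T. n \<le> x"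
      using *[OF assms(1)] *[OF assms(2)] by blast
    have "min m n \<le> x" if "x \<in> A" for x
      using A(1) mn(2,4) that by (auto simp: min_le_iff_disj)
    moreover have "min m n \<in> A"
      using mn(1,3) by (simp add: min_def)
    ultimately show ?thesis
      by blast
  qed
qed

lemma well_ordered_UN:
  fixes S :: "'i \<Rightarrow> 'g::linorder set"
  assumes "finite I" "\<And>i. i \<in> I \<Longrightarrow> well_ordered (S i)"
  shows "well_ordered (\<Union>i\<in>I. S i)"
  using assms by (induction I rule: finite_induct) (simp_all add: well_ordered_empty well_ordered_Un)

lemma well_orderedI_seq:
  fixes S :: "'g::linorder set"
  assumes "\<And>s :: nat \<Rightarrow> 'g. (\<And>i. s i \<in> S) \<Longrightarrow> (\<And>i j. i < j \<Longrightarrow> s j < s i) \<Longrightarrow> False"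
  shows "well_ordered S"
  unfolding well_ordered_def
proof (intro allI impI, elim conjE, rule ccontr)
  fix A assume A: "A \<subseteq> S" "A \<noteq> {}" "\<not> (\<exists>m\<in>A. \<forall>x\<in>A. m \<le> x)"
  have "\<exists>s :: nat \<Rightarrow> 'g. \<forall>n. s n \<in> A \<and> s (Suc n) < s n"
    by (rule dependent_nat_choice) (use A in \<open>auto simp: not_le\<close>)
  then obtain s :: "nat \<Rightarrow> 'g" where s: "\<And>n. s n \<in> A" "\<And>n. s (Suc n) < s n"
    by blast
  have "s j < s i" if "i < j" for i j
    using that by (induction j) (use s in \<open>auto simp: less_Suc_eq intro: less_trans\<close>)
  with assms s A(1) show False
    by blast
qed

text \<open>
  Every sequence has a monotone subsequence; in a well-ordered set it can be chosen to increase. This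
  is the form in which well-orderedness is used below.
\<close>

lemma well_ordered_mono_subseq:
  fixes s :: "nat \<Rightarrow> 'g::linorder"
  assumes "well_ordered S" "\<And>i. s i \<in> S"
  obtains f :: "nat \<Rightarrow> nat" where "strict_mono f" "\<And>i j. i \<le> j \<Longrightarrow> s (f i) \<le> s (f j)"
proof -
  obtain f :: "nat \<Rightarrow> nat" where f: "strict_mono f" "monoseq (\<lambda>n. s (f n))"
    using seq_monosub by blast
  show thesis
  proof (cases "\<forall>m. \<forall>n\<ge>m. s (f m) \<le> s (f n)")
    case True
    then show ?thesis using that f by blast
  next
    case False
    then have dec: "s (f n) \<le> s (f m)" if "m \<le> n" for m n
      using f(2) that unfolding monoseq_def by blast
    have "range (\<lambda>n. s (f n)) \<subseteq> S" "range (\<lambda>n. s (f n)) \<noteq> {}"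
      using assms by auto
    then obtain y where "y \<in> range (\<lambda>n. s (f n))" "\<forall>x\<in>range (\<lambda>n. s (f n)). y \<le> x"
      using assms(1) unfolding well_ordered_def by meson
    then obtain m where "\<And>n. s (f m) \<le> s (f n)"
      by auto
    \<comment> \<open>a decreasing sequence in a well-ordered set is constant from its minimum on\<close>
    then have const: "s (f (m + i)) = s (f m)" for i
      using dec[of m "m + i"] by (simp add: antisym)
    show ?thesis
    proof (rule that[of "\<lambda>i. f (m + i)"])
      show "strict_mono (\<lambda>i. f (m + i))"
        using f(1) by (auto simp: strict_mono_def)
    qed (simp add: const)
  qed
qed

lemma well_ordered_plus:
  fixes S T :: "'g::linordered_ab_group_add set"
  assumes "well_ordered S" "well_ordered T"
  shows "well_ordered (S + T)"
proof (rule well_orderedI_seq)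
  fix s :: "nat \<Rightarrow> 'g"
  assume s: "\<And>i. s i \<in> S + T" "\<And>i j. i < j \<Longrightarrow> s j < s i"
  then have "\<forall>i. \<exists>a b. s i = a + b \<and> a \<in> S \<and> b \<in> T"
    by (meson set_plus_elim)
  then obtain a b where ab: "\<And>i. s i = a i + b i" "\<And>i. a i \<in> S" "\<And>i. b i \<in> T"
    by metis
  obtain f :: "nat \<Rightarrow> nat" where f: "strict_mono f" "\<And>i j. i \<le> j \<Longrightarrow> a (f i) \<le> a (f j)"
    using well_ordered_mono_subseq[OF assms(1), of a] ab by blast
  obtain h :: "nat \<Rightarrow> nat" where h: "strict_mono h" "\<And>i j. i \<le> j \<Longrightarrow> b (f (h i)) \<le> b (f (h j))"
    using well_ordered_mono_subseq[OF assms(2), of "\<lambda>i. b (f i)"] ab by blast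
  have "h 0 \<le> h 1" "h 0 < h 1"
    using h(1) by (auto simp: strict_mono_def intro: less_imp_le)
  then have "s (f (h 0)) \<le> s (f (h 1))"
    using f h unfolding ab(1) by (intro add_mono) auto
  moreover have "s (f (h 1)) < s (f (h 0))"
    using s(2) f(1) \<open>h 0 < h 1\<close> by (simp add: strict_mono_def)
  ultimately show False by simp
qed

text \<open>
  Infinitely many decompositions of \<open>g\<close> would contain a sequence along which both summands increase
  weakly, so that both are constant.
\<close>

lemma finite_antidiagonal:
  fixes S T :: "'g::linordered_ab_group_add set"
  assumes "well_ordered S" "well_ordered T"
  shows "finite {a \<in> S. g - a \<in> T}"
proof (rule ccontr)
  assume "infinite {a \<in> S. g - a \<in> T}"
  then obtain s :: "nat \<Rightarrow> 'g" where s: "inj s" "range s \<subseteq> {a \<in> S. g - a \<in> T}"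
    by (meson infinite_countable_subset)
  obtain f :: "nat \<Rightarrow> nat" where f: "strict_mono f" "\<And>i j. i \<le> j \<Longrightarrow> s (f i) \<le> s (f j)"
    using well_ordered_mono_subseq[OF assms(1), of s] s(2) by blast
  obtain h :: "nat \<Rightarrow> nat" where h: "strict_mono h" "\<And>i j. i \<le> j \<Longrightarrow> g - s (f (h i)) \<le> g - s (f (h j))"
    using well_ordered_mono_subseq[OF assms(2), of "\<lambda>i. g - s (f i)"] s(2) by blast
  have lt: "h 0 < h 1"
    using h(1) by (simp add: strict_mono_def)
  have "s (f (h 0)) = s (f (h 1))"
    using f(2)[of "h 0" "h 1"] h(2)[of 0 1] lt by (simp add: antisym)
  then have "h 0 = h 1"
    using s(1) f(1) by (metis injD strict_mono_eq)
  with lt show False by simp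
qed

definition additive_closure :: "'g::monoid_add set \<Rightarrow> 'g set" where
  "additive_closure A = {sum_list xs | xs. set xs \<subseteq> A}"

lemma additive_closure_zero: "0 \<in> additive_closure A"
  unfolding additive_closure_def by (auto intro: exI[of _ "[]"])

lemma additive_closure_incl: "a \<in> A \<Longrightarrow> a \<in> additive_closure A"
  unfolding additive_closure_def by (auto intro!: exI[of _ "[a]"])

lemma additive_closure_add:
  assumes "s \<in> additive_closure A" "t \<in> additive_closure A"
  shows "s + t \<in> additive_closure A"
proof -
  obtain xs ys where "s = sum_list xs" "set xs \<subseteq> A" "t = sum_list ys" "set ys \<subseteq> A"
    using assms unfolding additive_closure_def by blast
  then show ?thesis
    unfolding additive_closure_def by (auto intro!: exI[of _ "xs @ ys"])
qed

text \<open>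
  Neumann's lemma. Among all infinite descending sequences in the closure take one whose terms
  are, one after the other, sums of as few elements of \<open>A\<close> as possible. Split off one summand from
  each term; along a subsequence where these summands increase the remainders descend as well,
  and they are shorter.
\<close>

lemma well_ordered_additive_closure:
  fixes A :: "'g::linordered_ab_group_add set"
  assumes A: "well_ordered A" and pos: "\<And>a. a \<in> A \<Longrightarrow> 0 < a"
  shows "well_ordered (additive_closure A)"
proof (rule well_orderedI_seq)
  fix s0 :: "nat \<Rightarrow> 'g"
  assume s0: "\<And>i. s0 i \<in> additive_closure A" "\<And>i j. i < j \<Longrightarrow> s0 j < s0 i"
  define len where "len t = (LEAST n. \<exists>xs. length xs = n \<and> set xs \<subseteq> A \<and> sum_list xs = t)" for t
  define descends where
    "descends t \<longleftrightarrow> (\<exists>s :: nat \<Rightarrow> 'g. s 0 = t \<and> (\<forall>i. s i \<in> additive_closure A \<and> s (Suc i) < s i))" for t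
  have nonneg: "0 \<le> t" if "t \<in> additive_closure A" for t
  proof -
    obtain xs where xs: "set xs \<subseteq> A" "t = sum_list xs"
      using \<open>t \<in> additive_closure A\<close> unfolding additive_closure_def by blast
    have "0 \<le> x" if "x \<in> set xs" for x
      using pos[of x] xs(1) that by auto
    with xs(2) show ?thesis
      by (simp add: sum_list_nonneg)
  qed
  have step: "\<exists>y. descends y \<and> y < x" if x: "descends x" for x
  proof -
    obtain s :: "nat \<Rightarrow> 'g" where s: "s 0 = x" "\<forall>i. s i \<in> additive_closure A \<and> s (Suc i) < s i"
      using x unfolding descends_def by blast
    have "descends (s 1)"
      unfolding descends_def by (rule exI[of _ "\<lambda>i. s (Suc i)"]) (simp add: s(2))
    moreover have "s 1 < x"
      using s(1) spec[OF s(2), of 0] by simp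
    ultimately show ?thesis
      by blast
  qed
  have "descends (s0 0)"
    unfolding descends_def by (rule exI[of _ s0]) (use s0 in auto)
  then obtain m0 where m0: "descends m0" "\<And>z. descends z \<Longrightarrow> len m0 \<le> len z"
    using ex_has_least_nat[of descends "s0 0" len] by blast
  have "\<exists>m. \<forall>n. (descends (m n) \<and> (n = 0 \<longrightarrow> m n = m0)) \<and>
      (m (Suc n) < m n \<and> (\<forall>z. descends z \<and> z < m n \<longrightarrow> len (m (Suc n)) \<le> len z))"
  proof (rule dependent_nat_choice)
    show "\<exists>x. descends x \<and> (0 = (0::nat) \<longrightarrow> x = m0)"
      using m0 by blast
  next
    fix x and n :: nat
    assume "descends x \<and> (n = 0 \<longrightarrow> x = m0)"
    then obtain y0 where "descends y0 \<and> y0 < x"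
      using step by blast
    then obtain y where "descends y \<and> y < x" "\<And>z. descends z \<and> z < x \<Longrightarrow> len y \<le> len z"
      using ex_has_least_nat[of "\<lambda>y. descends y \<and> y < x" y0 len] by blast
    then show "\<exists>y. (descends y \<and> (Suc n = 0 \<longrightarrow> y = m0)) \<and>
        (y < x \<and> (\<forall>z. descends z \<and> z < x \<longrightarrow> len y \<le> len z))"
      by blast
  qed
  then obtain m :: "nat \<Rightarrow> 'g" where m: "\<And>n. descends (m n)" "m 0 = m0" "\<And>n. m (Suc n) < m n"
      "\<And>n z. descends z \<Longrightarrow> z < m n \<Longrightarrow> len (m (Suc n)) \<le> len z"
    by blast
  have m_dec: "m j < m i" if "i < j" for i j
    using that by (induction j) (use m(3) in \<open>auto simp: less_Suc_eq intro: less_trans\<close>)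
  have m_in: "m n \<in> additive_closure A" for n
    using m(1)[of n] unfolding descends_def by metis
  have "\<exists>a v. m n = a + v \<and> a \<in> A \<and> v \<in> additive_closure A \<and> len v < len (m n)" for n
  proof -
    have "\<exists>k xs. length xs = k \<and> set xs \<subseteq> A \<and> sum_list xs = m n"
      using m_in[of n] unfolding additive_closure_def by auto
    then have "\<exists>xs. length xs = len (m n) \<and> set xs \<subseteq> A \<and> sum_list xs = m n"
      unfolding len_def by (rule LeastI_ex)
    then obtain xs where xs: "length xs = len (m n)" "set xs \<subseteq> A" "sum_list xs = m n"
      by blast
    have "0 < m n"
      using nonneg[OF m_in[of "Suc n"]] m(3)[of n] by simp
    then obtain a ys where ys: "xs = a # ys"
      using xs(3) by (cases xs) auto
    have "len (sum_list ys) \<le> length ys"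
      unfolding len_def by (rule Least_le) (use xs ys in auto)
    then show ?thesis
      using xs ys by (intro exI[of _ a] exI[of _ "sum_list ys"]) (auto simp: additive_closure_def)
  qed
  then obtain a v where av: "\<And>n. m n = a n + v n" "\<And>n. a n \<in> A"
      "\<And>n. v n \<in> additive_closure A" "\<And>n. len (v n) < len (m n)"
    by metis
  obtain f :: "nat \<Rightarrow> nat" where f: "strict_mono f" "\<And>i j. i \<le> j \<Longrightarrow> a (f i) \<le> a (f j)"
    using well_ordered_mono_subseq[OF A, of a] av(2) by blast
  have "v (f (Suc i)) < v (f i)" for i
  proof -
    have "a (f (Suc i)) + v (f (Suc i)) < a (f i) + v (f i)"
      using m_dec[of "f i" "f (Suc i)"] f(1) by (simp add: av(1) strict_mono_def)
    also have "\<dots> \<le> a (f (Suc i)) + v (f i)"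
      using f(2)[of i "Suc i"] by simp
    finally show ?thesis by simp
  qed
  then have desc: "descends (v (f 0))"
    unfolding descends_def using av(3) by (intro exI[of _ "\<lambda>i. v (f i)"]) auto
  have "v (f 0) < m (f 0)"
    using av(1)[of "f 0"] pos[OF av(2)[of "f 0"]] by simp
  then have "len (m (f 0)) \<le> len (v (f 0))"
    using m0(2)[OF desc] m(2) m(4)[OF desc] m(3) by (cases "f 0") (auto intro: less_trans)
  with av(4)[of "f 0"] show False
    by simp
qed

section \<open>The ring of Hahn series\<close>

text \<open>The summation sign is reserved for sums of finitely many nonzero terms.\<close>

no_notation suminf (binder \<open>\<Sum>\<close> 10)

abbreviation hahn_mult :: "('g::linordered_ab_group_add \<Rightarrow> 'k::field) \<Rightarrow> ('g \<Rightarrow> 'k) \<Rightarrow> 'g \<Rightarrow> 'k"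
    (infixl "\<star>" 70) where
  "a \<star> b \<equiv> a \<otimes>\<^bsub>hahn_series\<^esub> b"

lemma hahn_series_simps [simp]:
  "a \<in> carrier hahn_series \<longleftrightarrow> well_ordered (supp a)"
  "\<one>\<^bsub>hahn_series\<^esub> = monom 1 0"
  "\<zero>\<^bsub>hahn_series\<^esub> = (\<lambda>g. 0)"
  "a \<oplus>\<^bsub>hahn_series\<^esub> b = (\<lambda>g. a g + b g)"
  by (simp_all add: hahn_series_def)

lemma hahn_mult_eq: "(a \<star> b) g = (\<Sum>h. a h * b (g - h))"
  by (simp add: hahn_series_def Sum_any.expand_set)

lemma finite_product_terms:
  fixes g :: "'g::linordered_ab_group_add"
  assumes "well_ordered S" "well_ordered T"
    and "\<And>h. f h \<noteq> 0 \<Longrightarrow> h \<in> S \<and> g - h \<in> T"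
  shows "finite {h. f h \<noteq> 0}"
  by (rule finite_subset[OF _ finite_antidiagonal[OF assms(1,2), of g]]) (use assms(3) in auto)

lemma finite_hahn_mult:
  fixes a b :: "'g::linordered_ab_group_add \<Rightarrow> 'k::field"
  assumes "well_ordered (supp a)" "well_ordered (supp b)"
  shows "finite {h. a h * b (g - h) \<noteq> 0}"
  by (rule finite_product_terms[OF assms, of _ g]) (auto simp: supp_def)

lemma Sum_any_swap:
  assumes "finite A" "\<And>a. finite (B a)" and nz: "\<And>a b. f a b \<noteq> 0 \<Longrightarrow> a \<in> A \<and> b \<in> B a"
  shows "(\<Sum>a. \<Sum>b. f a b) = (\<Sum>b. \<Sum>a. f a b)"
proof (rule Sum_any.swap)
  show "finite (A \<times> (\<Union>a\<in>A. B a))"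
    using assms(1,2) by simp
  show "{a. \<exists>b. f a b \<noteq> 0} \<times> {b. \<exists>a. f a b \<noteq> 0} \<subseteq> A \<times> (\<Union>a\<in>A. B a)"
    using nz by blast
qed

lemma supp_hahn_mult: "supp (a \<star> b) \<subseteq> supp a + supp b"
proof
  fix g assume "g \<in> supp (a \<star> b)"
  then have "(\<Sum>h. a h * b (g - h)) \<noteq> 0"
    by (simp add: supp_def hahn_mult_eq)
  then obtain h where "a h * b (g - h) \<noteq> 0"
    by (rule Sum_any.not_neutral_obtains_not_neutral)
  then have "h \<in> supp a" "g - h \<in> supp b"
    by (auto simp: supp_def)
  then have "h + (g - h) \<in> supp a + supp b"
    by (rule set_plus_intro)
  then show "g \<in> supp a + supp b"
    by simp
qed

lemma well_ordered_supp_hahn_mult: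
  "well_ordered (supp a) \<Longrightarrow> well_ordered (supp b) \<Longrightarrow> well_ordered (supp (a \<star> b))"
  using well_ordered_subset[OF well_ordered_plus supp_hahn_mult] .

lemma hahn_mult_commute:
  fixes a b :: "'g::linordered_ab_group_add \<Rightarrow> 'k::field"
  shows "a \<star> b = b \<star> a"
proof
  fix g :: 'g
  have "bij (\<lambda>h. g - h)"
    by (rule involuntory_imp_bij) simp
  then have "(\<Sum>h. a h * b (g - h)) = (\<Sum>h. b h * a (g - h))"
    by (rule Sum_any.reindex_cong) (auto simp: mult.commute)
  then show "(a \<star> b) g = (b \<star> a) g"
    by (simp add: hahn_mult_eq)
qed

text \<open>
  Only finitely many pairs of exponents contribute to a coefficient of the triple product, so the
  double sum may be reordered.
\<close>

lemma hahn_mult_assoc: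
  fixes a b c :: "'g::linordered_ab_group_add \<Rightarrow> 'k::field"
  assumes "well_ordered (supp a)" "well_ordered (supp b)" "well_ordered (supp c)"
  shows "(a \<star> b) \<star> c = a \<star> (b \<star> c)"
proof
  fix g :: 'g
  have bij: "bij (\<lambda>l. k + l)" for k :: 'g
    by (rule o_bij[of "\<lambda>l. - k + l"]) auto
  have "(a \<star> b) h * c (g - h) = (\<Sum>k. a k * b (h - k) * c (g - h))" for h
    unfolding hahn_mult_eq by (rule Sum_any_left_distrib[OF finite_hahn_mult[OF assms(1,2)]])
  then have "((a \<star> b) \<star> c) g = (\<Sum>h. \<Sum>k. a k * b (h - k) * c (g - h))"
    by (simp add: hahn_mult_eq[of "a \<star> b"])
  also have "\<dots> = (\<Sum>k. \<Sum>h. a k * b (h - k) * c (g - h))"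
  proof (rule Sum_any_swap)
    show "finite {h \<in> supp a + supp b. g - h \<in> supp c}"
      by (intro finite_antidiagonal well_ordered_plus assms)
    show "finite {k \<in> supp a. h - k \<in> supp b}" for h
      by (intro finite_antidiagonal assms)
    fix h k assume "a k * b (h - k) * c (g - h) \<noteq> 0"
    then have nz: "k \<in> supp a" "h - k \<in> supp b" "g - h \<in> supp c"
      by (auto simp: supp_def)
    then show "h \<in> {h \<in> supp a + supp b. g - h \<in> supp c} \<and> k \<in> {k \<in> supp a. h - k \<in> supp b}"
      using set_plus_intro[OF nz(1,2)] by simp
  qed
  also have "\<dots> = (\<Sum>k. \<Sum>l. a k * (b l * c (g - k - l)))"
  proof (rule Sum_any.cong)
    fix k
    show "(\<Sum>h. a k * b (h - k) * c (g - h)) = (\<Sum>l. a k * (b l * c (g - k - l)))"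
      by (rule Sum_any.reindex_cong[OF bij[of k]]) (auto simp: mult.assoc diff_diff_eq)
  qed
  also have "\<dots> = (a \<star> (b \<star> c)) g"
    unfolding hahn_mult_eq[of a] unfolding hahn_mult_eq[of b]
    by (simp add: Sum_any_right_distrib[OF finite_hahn_mult[OF assms(2,3)]])
  finally show "((a \<star> b) \<star> c) g = (a \<star> (b \<star> c)) g" .
qed

lemma hahn_mult_distrib_right:
  fixes a b c :: "'g::linordered_ab_group_add \<Rightarrow> 'k::field"
  assumes "well_ordered (supp a)" "well_ordered (supp b)" "well_ordered (supp c)"
  shows "(\<lambda>g. a g + b g) \<star> c = (\<lambda>g. (a \<star> c) g + (b \<star> c) g)"
  using Sum_any.distrib[OF finite_hahn_mult[OF assms(1,3)] finite_hahn_mult[OF assms(2,3)]]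
  by (simp add: fun_eq_iff hahn_mult_eq distrib_right)

lemma supp_monom: "supp (monom c g) \<subseteq> {g}"
  by (auto simp: supp_def monom_def)

lemma well_ordered_supp_monom [simp]: "well_ordered (supp (monom c g))"
  using well_ordered_subset[OF well_ordered_singleton supp_monom] .

lemma monom_one_nonzero [simp]: "monom 1 g \<noteq> (\<lambda>h. 0 :: 'k::field)"
  by (metis monom_def zero_neq_one)

lemma monom_eq_iff: "monom c g = monom d g \<longleftrightarrow> c = d"
  by (metis monom_def)

lemma monom_mult: "monom c g \<star> a = (\<lambda>p. c * a (p - g))"
proof
  fix p
  have "{h. monom c g h * a (p - h) \<noteq> 0} \<subseteq> {g}"
    by (auto simp: monom_def)
  then show "(monom c g \<star> a) p = c * a (p - g)"
    by (simp add: hahn_mult_eq Sum_any.expand_superset[of "{g}"] monom_def)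
qed

lemma monom_mult_monom: "monom c g \<star> monom d h = monom (c * d) (g + h)"
  unfolding monom_mult by (auto simp: monom_def fun_eq_iff algebra_simps)

lemma monom_0 [simp]: "monom 0 g = (\<lambda>h. 0)"
  by (auto simp: monom_def)

lemma well_ordered_supp_add:
  fixes a b :: "'g::linordered_ab_group_add \<Rightarrow> 'k::field"
  assumes "well_ordered (supp a)" "well_ordered (supp b)"
  shows "well_ordered (supp (\<lambda>g. a g + b g))"
proof -
  have "well_ordered (supp a \<union> supp b)"
    using assms by (rule well_ordered_Un)
  then show ?thesis
    by (rule well_ordered_subset) (auto simp: supp_def)
qed

lemma cring_hahn_series: "cring (hahn_series :: ('g::linordered_ab_group_add \<Rightarrow> 'k::field) ring)"
proof (rule cringI)
  show "abelian_group (hahn_series :: ('g \<Rightarrow> 'k) ring)"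
  proof (rule abelian_groupI)
    fix a :: "'g \<Rightarrow> 'k"
    assume "a \<in> carrier hahn_series"
    then show "\<exists>b\<in>carrier hahn_series. b \<oplus>\<^bsub>hahn_series\<^esub> a = \<zero>\<^bsub>hahn_series\<^esub>"
      by (intro bexI[of _ "\<lambda>g. - a g"]) (auto simp: supp_def)
  qed (use well_ordered_supp_add in \<open>auto simp: add_ac\<close>, auto simp: supp_def well_ordered_empty)
  show "Group.comm_monoid (hahn_series :: ('g \<Rightarrow> 'k) ring)"
    by (rule comm_monoidI)
      (auto simp: well_ordered_supp_hahn_mult hahn_mult_assoc monom_mult intro: hahn_mult_commute)
qed (simp add: hahn_mult_distrib_right)

lemma hahn_mult_interchange:
  fixes a b c d :: "'g::linordered_ab_group_add \<Rightarrow> 'k::field"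
  assumes "well_ordered (supp a)" "well_ordered (supp b)" "well_ordered (supp c)" "well_ordered (supp d)"
  shows "(a \<star> b) \<star> (c \<star> d) = (a \<star> c) \<star> (b \<star> d)"
proof -
  interpret R: cring "hahn_series :: ('g \<Rightarrow> 'k) ring"
    by (rule cring_hahn_series)
  show ?thesis
    using assms by (simp add: R.m_ac well_ordered_supp_hahn_mult)
qed

lemma val_eqI: "a g \<noteq> 0 \<Longrightarrow> (\<And>h. h < g \<Longrightarrow> a h = 0) \<Longrightarrow> val a = g"
  unfolding val_def supp_def by (rule Least_equality) (auto simp: not_less[symmetric])

lemma val_props:
  assumes "well_ordered (supp a)" "a \<noteq> (\<lambda>g. 0)"
  shows val_nonzero: "a (val a) \<noteq> 0" and below_val: "\<And>h. h < val a \<Longrightarrow> a h = 0"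
proof -
  have "supp a \<noteq> {}"
    using assms(2) by (auto simp: supp_def)
  then obtain m where m: "m \<in> supp a" "\<forall>x\<in>supp a. m \<le> x"
    using assms(1) unfolding well_ordered_def by blast
  then have "val a = m"
    by (intro val_eqI) (auto simp: supp_def not_le[symmetric])
  with m show "a (val a) \<noteq> 0" "\<And>h. h < val a \<Longrightarrow> a h = 0"
    by (auto simp: supp_def not_le[symmetric])
qed

lemma val_monom: "c \<noteq> 0 \<Longrightarrow> val (monom c g) = g"
  by (rule val_eqI) (auto simp: monom_def)

text \<open>The coefficient of the product at \<open>v + w\<close> has a single summand.\<close>

lemma hahn_mult_leading:
  fixes a b :: "'g::linordered_ab_group_add \<Rightarrow> 'k::field"
  assumes "\<And>g. g < v \<Longrightarrow> a g = 0" "\<And>g. g < w \<Longrightarrow> b g = 0"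
  shows "(a \<star> b) (v + w) = a v * b w" and "\<And>p. p < v + w \<Longrightarrow> (a \<star> b) p = 0"
proof -
  have *: "v \<le> h \<and> w \<le> p - h" if "a h * b (p - h) \<noteq> 0" for h p
    using that assms by (auto simp: not_less[symmetric])
  have "{h. a h * b (v + w - h) \<noteq> 0} \<subseteq> {v}"
    using *[of _ "v + w"] by (fastforce simp: algebra_simps)
  then show "(a \<star> b) (v + w) = a v * b w"
    by (simp add: hahn_mult_eq Sum_any.expand_superset[of "{v}"])
  fix p assume "p < v + w"
  have "a h * b (p - h) = 0" for h
  proof (rule ccontr)
    assume "a h * b (p - h) \<noteq> 0"
    from *[OF this] have "v + w \<le> h + (p - h)"
      by (intro add_mono) auto
    with \<open>p < v + w\<close> show False by simp
  qed
  then show "(a \<star> b) p = 0"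
    unfolding hahn_mult_eq by (subst Sum_any.cong[of _ "\<lambda>_. 0"]) auto
qed

section \<open>Hahn fields and their one-units\<close>

locale hahn_subfield =
  fixes K :: "('g::linordered_ab_group_add \<Rightarrow> 'k::field) set"
  assumes hahn_field: "hahn_field K"
begin

interpretation R: cring "hahn_series :: ('g \<Rightarrow> 'k) ring"
  by (rule cring_hahn_series)

lemma subfield_K: "subfield K hahn_series"
  using hahn_field by (simp add: hahn_field_def)

lemma K_subring: "subring K hahn_series"
  using subfieldE(1)[OF subfield_K] .

lemma K_well_ordered [simp]: "a \<in> K \<Longrightarrow> well_ordered (supp a)"
  using subringE(1)[OF K_subring] by auto

lemma K_mult [simp]: "a \<in> K \<Longrightarrow> b \<in> K \<Longrightarrow> a \<star> b \<in> K"
  using subringE(6)[OF K_subring] .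

lemma K_add [simp]: "a \<in> K \<Longrightarrow> b \<in> K \<Longrightarrow> (\<lambda>g. a g + b g) \<in> K"
  using subringE(7)[OF K_subring] by simp

lemma K_zero [simp]: "(\<lambda>g. 0) \<in> K"
  using subringE(2)[OF K_subring] by simp

lemma K_one [simp]: "monom 1 0 \<in> K"
  using subringE(3)[OF K_subring] by simp

lemma K_uminus [simp]: 
  assumes "a \<in> K" shows "(\<lambda>g. - a g) \<in> K"
proof -
  have "(\<lambda>g. - a g) = \<ominus>\<^bsub>hahn_series\<^esub> a"
    using assms by (intro R.minus_equality[symmetric]) (auto simp: supp_def dest: K_well_ordered)
  then show ?thesis
    using subringE(5)[OF K_subring assms] by simp
qed

lemma K_monom [simp]: "monom c g \<in> K"
proof -
  have "inv\<^bsub>hahn_series\<^esub> (\<one>\<^bsub>hahn_series\<^esub> :: 'g \<Rightarrow> 'k) = \<one>\<^bsub>hahn_series\<^esub>"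
    by (rule R.inv_one)
  then have "monom c g = monom c g \<otimes>\<^bsub>hahn_series\<^esub> inv\<^bsub>hahn_series\<^esub> (monom 1 0)"
    by (simp add: monom_mult_monom)
  moreover have "monom c g \<in> group_ring" "monom 1 0 \<in> (group_ring :: ('g \<Rightarrow> 'k) set)"
    unfolding group_ring_def using finite_subset[OF supp_monom] by auto
  moreover have "monom 1 0 \<noteq> (\<lambda>g :: 'g. 0 :: 'k)"
    by simp
  ultimately have "monom c g \<in> group_ring_fractions"
    unfolding group_ring_fractions_def by (simp, blast)
  then show ?thesis
    using hahn_field unfolding hahn_field_def by blast
qed

lemma K_inverse:
  assumes "a \<in> K" "a \<noteq> (\<lambda>g. 0)"
  obtains b where "b \<in> K" "a \<star> b = monom 1 0"
proof -
  have "a \<in> Units (hahn_series\<lparr>carrier := K\<rparr>)"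
    using subfield.subfield_Units[OF subfield_K] assms by simp
  then show thesis
    using that by (auto simp: Units_def)
qed

text \<open>
  One-units in terms of coefficients, which avoids the case distinction on the zero series.
\<close>

lemma one_units_iff:
  "u \<in> carrier (one_units K) \<longleftrightarrow> u \<in> K \<and> u 0 = 1 \<and> (\<forall>g<0. u g = 0)"
proof
  assume "u \<in> carrier (one_units K)"
  then have "\<exists>a\<in>val_ideal K. u = (\<lambda>g. monom 1 0 g + a g)"
    by (auto simp: one_units_def)
  then obtain a where u: "u = (\<lambda>g. monom 1 0 g + a g)" and "a \<in> val_ideal K"
    by (rule bexE)
  then have a: "a \<in> K" "a = (\<lambda>g. 0) \<or> val a > 0"
    by (auto simp: val_ideal_def)
  have "a g = 0" if "g \<le> 0" for g
    using a that below_val[of a g] by (cases "a = (\<lambda>g. 0)") auto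
  moreover have "u \<in> K"
    unfolding u using a by simp
  ultimately show "u \<in> K \<and> u 0 = 1 \<and> (\<forall>g<0. u g = 0)"
    unfolding u by (auto simp: monom_def)
next
  assume u: "u \<in> K \<and> u 0 = 1 \<and> (\<forall>g<0. u g = 0)"
  define a where "a = (\<lambda>g. u g + (- monom 1 0 g))"
  have "a \<in> K"
    unfolding a_def using u by (intro K_add K_uminus) auto
  moreover have "a g = 0" if "g \<le> 0" for g
    using u that by (auto simp: a_def monom_def)
  then have "a = (\<lambda>g. 0) \<or> val a > 0"
    using val_nonzero[OF K_well_ordered[OF \<open>a \<in> K\<close>]] by (meson not_less)
  ultimately have "a \<in> val_ideal K"
    by (simp add: val_ideal_def)
  moreover have "u = \<one>\<^bsub>hahn_series\<^esub> \<oplus>\<^bsub>hahn_series\<^esub> a"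
    by (simp add: a_def)
  ultimately show "u \<in> carrier (one_units K)"
    unfolding one_units_def by (simp only: partial_object.simps) blast
qed

lemma one_units_simps [simp]:
  "\<one>\<^bsub>one_units K\<^esub> = monom 1 0" "u \<otimes>\<^bsub>one_units K\<^esub> w = u \<star> w"
  by (simp_all add: one_units_def)

lemma one_units_mult:
  assumes "u \<in> carrier (one_units K)" "w \<in> carrier (one_units K)"
  shows "u \<star> w \<in> carrier (one_units K)"
  using assms hahn_mult_leading[of 0 u 0 w] by (auto simp: one_units_iff)

lemma comm_group_one_units: "comm_group (one_units K)"
proof (rule comm_groupI)
  fix u assume u: "u \<in> carrier (one_units K)"
  then have "u \<noteq> (\<lambda>g. 0)" "u \<in> K"
    by (auto simp: one_units_iff)
  then obtain w where w: "w \<in> K" "u \<star> w = monom 1 0"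
    using K_inverse by blast
  have nz: "w \<noteq> (\<lambda>g. 0)"
  proof
    assume "w = (\<lambda>g. 0)"
    with w(2) have "monom 1 0 = (\<lambda>g :: 'g. 0 :: 'k)"
      by (simp add: hahn_mult_eq fun_eq_iff)
    then show False
      by simp
  qed
  have lead: "(u \<star> w) (0 + val w) = u 0 * w (val w)"
    by (rule hahn_mult_leading(1)) (use u nz w(1) below_val[of w] in \<open>auto simp: one_units_iff\<close>)
  \<comment> \<open>the leading term of the inverse is forced to be \<open>1\<close>, sitting at \<open>0\<close>\<close>
  have "monom 1 0 (val w) = w (val w)"
    using lead u w(2) by (simp add: one_units_iff)
  then have "val w = 0" "w 0 = 1"
    using val_nonzero[of w] w(1) nz by (auto simp: monom_def split: if_splits)
  then have "w \<in> carrier (one_units K)"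
    using below_val[of w] w(1) nz by (auto simp: one_units_iff)
  then show "\<exists>y\<in>carrier (one_units K). y \<otimes>\<^bsub>one_units K\<^esub> u = \<one>\<^bsub>one_units K\<^esub>"
    using w(2) by (intro bexI[of _ w]) (auto simp: hahn_mult_commute)
next
  fix x y z
  assume "x \<in> carrier (one_units K)" "y \<in> carrier (one_units K)" "z \<in> carrier (one_units K)"
  then show "x \<otimes>\<^bsub>one_units K\<^esub> y \<otimes>\<^bsub>one_units K\<^esub> z = x \<otimes>\<^bsub>one_units K\<^esub> (y \<otimes>\<^bsub>one_units K\<^esub> z)"
    by (simp add: hahn_mult_assoc one_units_iff)
next
  show "\<one>\<^bsub>one_units K\<^esub> \<in> carrier (one_units K)"
    by (auto simp: one_units_iff) (auto simp: monom_def)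
next
  fix x y
  show "x \<otimes>\<^bsub>one_units K\<^esub> y = y \<otimes>\<^bsub>one_units K\<^esub> x"
    by (simp only: one_units_simps) (rule hahn_mult_commute)
next
  fix x
  show "\<one>\<^bsub>one_units K\<^esub> \<otimes>\<^bsub>one_units K\<^esub> x = x"
    by (simp add: monom_mult)
qed (simp only: one_units_simps one_units_mult)

end

section \<open>Monomially controlled maps\<close>

lemma o_Aut_iff: "\<tau> \<in> carrier o_Aut \<longleftrightarrow> bij \<tau> \<and> (\<forall>g h. \<tau> (g + h) = \<tau> g + \<tau> h) \<and> strict_mono \<tau>"
  by (simp add: o_Aut_def)

lemma id_o_Aut: "id \<in> carrier o_Aut"
  by (simp add: o_Aut_iff strict_mono_def)

lemma o_Aut_zero: "\<tau> \<in> carrier o_Aut \<Longrightarrow> \<tau> 0 = 0"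
  by (metis add_cancel_right_right o_Aut_iff)

lemma o_Aut_diff: "\<tau> \<in> carrier o_Aut \<Longrightarrow> \<tau> (g - h) = \<tau> g - \<tau> h"
  by (metis add_diff_cancel diff_add_cancel o_Aut_iff)

lemma o_Aut_mono: "\<tau> \<in> carrier o_Aut \<Longrightarrow> mono \<tau>"
  by (simp add: o_Aut_iff strict_mono_mono)

lemma o_Aut_inj: "\<tau> \<in> carrier o_Aut \<Longrightarrow> inj \<tau>"
  by (simp add: o_Aut_iff bij_is_inj)

lemma o_Aut_inv_into:
  assumes "\<tau> \<in> carrier o_Aut"
  shows "inv_into UNIV \<tau> \<in> carrier o_Aut" "\<tau> (inv_into UNIV \<tau> x) = x" "inv_into UNIV \<tau> (\<tau> x) = x"
proof -
  show r: "\<tau> (inv_into UNIV \<tau> x) = x" and l: "inv_into UNIV \<tau> (\<tau> x) = x" for x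
    using assms by (simp_all add: o_Aut_iff bij_is_surj surj_f_inv_f bij_is_inj)
  show "inv_into UNIV \<tau> \<in> carrier o_Aut"
    unfolding o_Aut_iff
  proof (intro conjI allI strict_monoI)
    show "bij (inv_into UNIV \<tau>)"
      using assms by (simp add: o_Aut_iff bij_imp_bij_inv)
    show "inv_into UNIV \<tau> (g + h) = inv_into UNIV \<tau> g + inv_into UNIV \<tau> h" for g h
      using assms r l by (metis o_Aut_iff)
    show "inv_into UNIV \<tau> g < inv_into UNIV \<tau> h" if "g < h" for g h
      using assms r that by (metis o_Aut_iff strict_mono_less)
  qed
qed

context hahn_subfield
begin

text \<open>
  The last condition keeps the image of a monomial within one fixed well-ordered set, up to a shift
  by an order automorphism. So the images of the monomials of a series always form a summable family
  of Hahn series, and the only question left is whether the value at the series is its sum.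
\<close>

definition controlled :: "(('g \<Rightarrow> 'k) \<Rightarrow> ('g \<Rightarrow> 'k)) \<Rightarrow> ('g \<Rightarrow> 'g) \<Rightarrow> 'g set \<Rightarrow> bool" where
  "controlled \<sigma> \<tau> T \<longleftrightarrow>
     (\<forall>a\<in>K. \<sigma> a \<in> K) \<and> (\<forall>a\<in>K. \<forall>b\<in>K. \<sigma> (\<lambda>g. a g + b g) = (\<lambda>g. \<sigma> a g + \<sigma> b g)) \<and>
     \<tau> \<in> carrier o_Aut \<and> well_ordered T \<and> (\<forall>c g p. \<sigma> (monom c g) p \<noteq> 0 \<longrightarrow> p - \<tau> g \<in> T)"

lemma controlled_zero:
  assumes "controlled \<sigma> \<tau> T"
  shows "\<sigma> (\<lambda>g. 0) = (\<lambda>g. 0)"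
proof -
  have "\<sigma> (\<lambda>g. 0 + 0) = (\<lambda>g. \<sigma> (\<lambda>g. 0) g + \<sigma> (\<lambda>g. 0) g)"
    using assms K_zero unfolding controlled_def by fast
  then have "\<sigma> (\<lambda>g. 0) p = \<sigma> (\<lambda>g. 0) p + \<sigma> (\<lambda>g. 0) p" for p
    by (simp only: add_0_right) (rule fun_cong)
  then show ?thesis
    by (metis add_cancel_right_right)
qed

lemma controlled_sum_monom:
  assumes "controlled \<sigma> \<tau> T" "finite A"
  shows "\<sigma> (monom (\<Sum>i\<in>A. b i) h) p = (\<Sum>i\<in>A. \<sigma> (monom (b i) h) p)"
  using assms(2)
proof (induction A rule: finite_induct)
  case empty
  then show ?case
    using controlled_zero[OF assms(1)] by simp
next
  case (insert x A)
  have "monom (b x + sum b A) h = (\<lambda>g. monom (b x) h g + monom (sum b A) h g)"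
    by (auto simp: monom_def)
  moreover have "\<sigma> (\<lambda>g. monom (b x) h g + monom (sum b A) h g)
      = (\<lambda>g. \<sigma> (monom (b x) h) g + \<sigma> (monom (sum b A) h) g)"
    using assms(1) K_monom unfolding controlled_def by blast
  ultimately show ?case
    using insert by simp
qed

lemma controlled_Sum_any_monom:
  assumes "controlled \<sigma> \<tau> T" "finite {i. b i \<noteq> 0}"
  shows "\<sigma> (monom (\<Sum>i. b i) h) p = (\<Sum>i. \<sigma> (monom (b i) h) p)"
proof -
  have "\<sigma> (monom (\<Sum>i. b i) h) p = (\<Sum>i\<in>{i. b i \<noteq> 0}. \<sigma> (monom (b i) h) p)"
    using controlled_sum_monom[OF assms] by (simp add: Sum_any.expand_set)
  also have "\<dots> = (\<Sum>i. \<sigma> (monom (b i) h) p)"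
    by (rule Sum_any.expand_superset[symmetric, OF assms(2)])
      (use controlled_zero[OF assms(1)] in auto)
  finally show ?thesis .
qed

lemma controlled_support:
  assumes "controlled \<sigma> \<tau> T" "\<sigma> (monom (a g) g) p \<noteq> 0"
  shows "g \<in> supp a" "p - \<tau> g \<in> T"
  using assms controlled_zero[OF assms(1)] unfolding controlled_def supp_def by auto

lemma finite_controlled:
  assumes "controlled \<sigma> \<tau> T" "well_ordered S"
  shows "finite {g \<in> S. p - \<tau> g \<in> T}"
proof -
  have \<tau>: "\<tau> \<in> carrier o_Aut" "well_ordered T"
    using assms(1) by (simp_all add: controlled_def)
  have "finite {q \<in> \<tau> ` S. p - q \<in> T}"
    by (intro finite_antidiagonal well_ordered_image assms(2) \<tau> o_Aut_mono)
  then have "finite (\<tau> -` {q \<in> \<tau> ` S. p - q \<in> T})"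
    by (rule finite_vimageI) (rule o_Aut_inj[OF \<tau>(1)])
  then show ?thesis
    by (rule rev_finite_subset) auto
qed

lemma controlled_summable:
  assumes "controlled \<sigma> \<tau> T" "well_ordered (supp a)"
  shows "summable_family (\<lambda>g. \<sigma> (monom (a g) g)) (supp a)"
  unfolding summable_family_def
proof (intro conjI allI)
  have \<tau>: "\<tau> \<in> carrier o_Aut" "well_ordered T"
    using assms(1) by (simp_all add: controlled_def)
  have "(\<Union>g\<in>supp a. supp (\<sigma> (monom (a g) g))) \<subseteq> \<tau> ` supp a + T"
  proof
    fix p assume "p \<in> (\<Union>g\<in>supp a. supp (\<sigma> (monom (a g) g)))"
    then obtain g where g: "g \<in> supp a" "\<sigma> (monom (a g) g) p \<noteq> 0"
      by (auto simp: supp_def)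
    then have "\<tau> g + (p - \<tau> g) \<in> \<tau> ` supp a + T"
      using controlled_support[OF assms(1)] by (intro set_plus_intro imageI)
    then show "p \<in> \<tau> ` supp a + T"
      by simp
  qed
  moreover have "well_ordered (\<tau> ` supp a + T)"
    by (intro well_ordered_plus well_ordered_image assms \<tau> o_Aut_mono)
  ultimately show "well_ordered (\<Union>g\<in>supp a. supp (\<sigma> (monom (a g) g)))"
    by (rule well_ordered_subset[rotated])
  fix p
  show "finite {g \<in> supp a. p \<in> supp (\<sigma> (monom (a g) g))}"
    by (rule finite_subset[OF _ finite_controlled[OF assms, of p]])
      (use controlled_support[OF assms(1)] in \<open>auto simp: supp_def[of "\<sigma> _"]\<close>)
qed

lemma family_sum_eq:
  assumes "\<And>i p. F i p \<noteq> 0 \<Longrightarrow> i \<in> I"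
  shows "family_sum F I = (\<lambda>p. \<Sum>i. F i p)"
proof
  fix p
  have "{i \<in> I. F i p \<noteq> 0} = {i. F i p \<noteq> 0}"
    using assms by auto
  then show "family_sum F I p = (\<Sum>i. F i p)"
    by (simp add: family_sum_def Sum_any.expand_set)
qed

text \<open>
  The family is summable in the field of all Hahn series, and its sum lies in \<open>K\<close> as soon as it is
  the value of the map.
\<close>

lemma controlled_K_summable_iff:
  assumes "controlled \<sigma> \<tau> T"
  shows "K_summable_map K \<sigma> \<longleftrightarrow> (\<forall>a\<in>K. \<sigma> a = (\<lambda>p. \<Sum>g. \<sigma> (monom (a g) g) p))"
proof -
  have eq: "family_sum (\<lambda>g. \<sigma> (monom (a g) g)) (supp a) = (\<lambda>p. \<Sum>g. \<sigma> (monom (a g) g) p)" for a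
    by (rule family_sum_eq) (rule controlled_support[OF assms])
  have inK: "\<sigma> a \<in> K" if "a \<in> K" for a
    using assms that by (simp add: controlled_def)
  have "K_summable_family K (\<lambda>g. \<sigma> (monom (a g) g)) (supp a) \<and>
      family_sum (\<lambda>g. \<sigma> (monom (a g) g)) (supp a) = \<sigma> a \<longleftrightarrow> \<sigma> a = (\<lambda>p. \<Sum>g. \<sigma> (monom (a g) g) p)"
    if a: "a \<in> K" for a
    unfolding K_summable_family_def eq
    using controlled_summable[OF assms K_well_ordered[OF a]] inK[OF K_monom] inK[OF a] by metis
  then show ?thesis
    unfolding K_summable_map_def by (intro ball_cong refl)
qed

lemma K_summable_map_cong:
  assumes "\<And>a. a \<in> K \<Longrightarrow> \<sigma> a = \<sigma>' a"
  shows "K_summable_map K \<sigma> \<longleftrightarrow> K_summable_map K \<sigma>'"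
  unfolding K_summable_map_def using assms by simp

text \<open>
  Composition rests on exchanging two infinite sums; the control sets bound both indices, so that
  only finitely many terms contribute to a given coefficient.
\<close>

lemma controlled_compose:
  assumes \<sigma>1: "controlled \<sigma>1 \<tau>1 T1" "K_summable_map K \<sigma>1"
    and \<sigma>2: "controlled \<sigma>2 \<tau>2 T2" "K_summable_map K \<sigma>2"
    and \<sigma>: "\<And>a. a \<in> K \<Longrightarrow> \<sigma> a = \<sigma>1 (\<sigma>2 a)"
  shows "controlled \<sigma> (\<tau>1 \<circ> \<tau>2) (T1 + \<tau>1 ` T2)" and "K_summable_map K \<sigma>"
proof -
  have \<tau>: "\<tau>1 \<in> carrier o_Aut" "well_ordered T1" "\<tau>2 \<in> carrier o_Aut" "well_ordered T2"
    using \<sigma>1 \<sigma>2 by (simp_all add: controlled_def)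
  have K2: "\<sigma>2 a \<in> K" if "a \<in> K" for a
    using \<sigma>2 that by (simp add: controlled_def)
  have sum1: "\<sigma>1 a p = (\<Sum>g. \<sigma>1 (monom (a g) g) p)" if "a \<in> K" for a p
    using controlled_K_summable_iff[OF \<sigma>1(1)] \<sigma>1(2) that by metis
  have sum2: "\<sigma>2 a p = (\<Sum>g. \<sigma>2 (monom (a g) g) p)" if "a \<in> K" for a p
    using controlled_K_summable_iff[OF \<sigma>2(1)] \<sigma>2(2) that by metis
  show ctrl: "controlled \<sigma> (\<tau>1 \<circ> \<tau>2) (T1 + \<tau>1 ` T2)"
    unfolding controlled_def
  proof (intro conjI ballI allI impI)
    show "\<sigma> a \<in> K" if "a \<in> K" for a
      using \<sigma>1 \<sigma>2 that by (simp add: controlled_def \<sigma>)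
    show "\<sigma> (\<lambda>g. a g + b g) = (\<lambda>g. \<sigma> a g + \<sigma> b g)" if "a \<in> K" "b \<in> K" for a b
      using \<sigma>1(1) \<sigma>2(1) that K_add[OF that] by (simp add: controlled_def \<sigma>)
    show "\<tau>1 \<circ> \<tau>2 \<in> carrier o_Aut"
      using \<tau> by (auto simp: o_Aut_iff bij_comp strict_mono_def)
    show "well_ordered (T1 + \<tau>1 ` T2)"
      by (intro well_ordered_plus well_ordered_image \<tau> o_Aut_mono)
    fix c g p assume "\<sigma> (monom c g) p \<noteq> 0"
    then have "(\<Sum>h. \<sigma>1 (monom (\<sigma>2 (monom c g) h) h) p) \<noteq> 0"
      by (simp add: \<sigma> sum1[OF K2] del: Sum_any.cong)
    then obtain h where h: "\<sigma>1 (monom (\<sigma>2 (monom c g) h) h) p \<noteq> 0"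
      by (rule Sum_any.not_neutral_obtains_not_neutral)
    from controlled_support[OF \<sigma>1(1), of "\<sigma>2 (monom c g)", OF h]
    have 1: "p - \<tau>1 h \<in> T1" and "\<sigma>2 (monom c g) h \<noteq> 0"
      by (auto simp: supp_def)
    then have "h - \<tau>2 g \<in> T2"
      using \<sigma>2(1) by (simp add: controlled_def)
    then have "(p - \<tau>1 h) + \<tau>1 (h - \<tau>2 g) \<in> T1 + \<tau>1 ` T2"
      using 1 by (intro set_plus_intro imageI)
    then show "p - (\<tau>1 \<circ> \<tau>2) g \<in> T1 + \<tau>1 ` T2"
      by (simp add: o_Aut_diff[OF \<tau>(1)])
  qed
  have "\<sigma> a p = (\<Sum>g. \<sigma> (monom (a g) g) p)" if a: "a \<in> K" for a p
  proof -
    define F where "F g h = \<sigma>1 (monom (\<sigma>2 (monom (a g) g) h) h) p" for g h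
    define S where "S = \<tau>2 ` supp a + T2"
    define H where "H = {h \<in> S. p - \<tau>1 h \<in> T1}"
    have "well_ordered S"
      unfolding S_def using a by (intro well_ordered_plus well_ordered_image \<tau> o_Aut_mono) simp
    then have finH: "finite H"
      unfolding H_def by (rule finite_controlled[OF \<sigma>1(1)])
    have fin2: "finite {g \<in> supp a. h - \<tau>2 g \<in> T2}" for h
      using finite_controlled[OF \<sigma>2(1)] a by simp
    have FH: "h \<in> H \<and> g \<in> {g \<in> supp a. h - \<tau>2 g \<in> T2}" if F: "F g h \<noteq> 0" for g h
    proof -
      have 1: "p - \<tau>1 h \<in> T1" "\<sigma>2 (monom (a g) g) h \<noteq> 0"
        using controlled_support[OF \<sigma>1(1), of "\<sigma>2 (monom (a g) g)", OF F[unfolded F_def]]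
        by (auto simp: supp_def)
      then have 2: "g \<in> supp a" "h - \<tau>2 g \<in> T2"
        using controlled_support[OF \<sigma>2(1)] by blast+
      then have "\<tau>2 g + (h - \<tau>2 g) \<in> S"
        unfolding S_def by (intro set_plus_intro imageI)
      then show ?thesis
        using 1 2 by (simp add: H_def)
    qed
    have "(\<Sum>g. \<sigma> (monom (a g) g) p) = (\<Sum>g. \<Sum>h. F g h)"
      unfolding F_def by (rule Sum_any.cong) (simp only: \<sigma> K_monom sum1[OF K2])
    also have "\<dots> = (\<Sum>h. \<Sum>g. F g h)"
      by (rule Sum_any_swap[symmetric, OF finH fin2 FH])
    also have "\<dots> = (\<Sum>h. \<sigma>1 (monom (\<sigma>2 a h) h) p)"
    proof (rule Sum_any.cong)
      fix h
      have "finite {g. \<sigma>2 (monom (a g) g) h \<noteq> 0}"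
        by (rule finite_subset[OF _ fin2[of h]]) (use controlled_support[OF \<sigma>2(1)] in auto)
      from controlled_Sum_any_monom[OF \<sigma>1(1) this]
      show "(\<Sum>g. F g h) = \<sigma>1 (monom (\<sigma>2 a h) h) p"
        unfolding F_def sum2[OF a] by simp
    qed
    also have "\<dots> = \<sigma> a p"
      by (simp only: \<sigma>[OF a] sum1[OF K2[OF a]])
    finally show ?thesis
      by simp
  qed
  then show "K_summable_map K \<sigma>"
    unfolding controlled_K_summable_iff[OF ctrl] by blast
qed

end

section \<open>Maps attached to homomorphisms into the one-units\<close>

text \<open>
  The least exponent of the inverse outside of the monoid \<open>T\<close> could not cancel in the product.
\<close>

lemma supp_inverse_subset:
  fixes u w :: "'g::linordered_ab_group_add \<Rightarrow> 'k::field"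
  assumes "u \<star> w = monom 1 0" "well_ordered (supp w)"
    and u: "u 0 = 1" "\<And>g. g < 0 \<Longrightarrow> u g = 0" "supp u \<subseteq> T"
    and T: "0 \<in> T" "\<And>s t. s \<in> T \<Longrightarrow> t \<in> T \<Longrightarrow> s + t \<in> T"
  shows "supp w \<subseteq> T"
proof (rule ccontr)
  assume "\<not> supp w \<subseteq> T"
  then have "supp w - T \<subseteq> supp w" "supp w - T \<noteq> {}"
    by auto
  then obtain g where g: "g \<in> supp w - T" "\<forall>x\<in>supp w - T. g \<le> x"
    using assms(2) unfolding well_ordered_def by metis
  have "h = 0" if h: "u h * w (g - h) \<noteq> 0" for h
  proof (rule ccontr)
    assume "h \<noteq> 0"
    have "h \<in> T" "0 \<le> h"
      using h u(2)[of h] u(3) by (auto simp: supp_def not_less[symmetric])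
    moreover have "g - h \<in> T"
    proof (rule ccontr)
      assume "g - h \<notin> T"
      then have "g \<le> g - h"
        using g(2) h by (auto simp: supp_def)
      with \<open>h \<noteq> 0\<close> \<open>0 \<le> h\<close> show False
        by simp
    qed
    ultimately have "h + (g - h) \<in> T"
      using T(2) by blast
    with g(1) show False
      by simp
  qed
  then have "{h. u h * w (g - h) \<noteq> 0} \<subseteq> {0}"
    by blast
  then have "(u \<star> w) g = w g"
    by (simp add: hahn_mult_eq Sum_any.expand_superset[of "{0}"] u(1))
  moreover have "g \<noteq> 0"
    using g(1) T(1) by auto
  ultimately show False
    using g(1) assms(1) by (simp add: monom_def supp_def)
qed

lemma group_add_group: "group (add_group :: 'g::ab_group_add monoid)"
  by (rule groupI) (auto simp: add_group_def add.assoc intro: exI[of _ "- _"])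

lemma add_group_simps [simp]:
  "carrier add_group = UNIV" "x \<otimes>\<^bsub>add_group\<^esub> y = x + y" "\<one>\<^bsub>add_group\<^esub> = 0"
  by (simp_all add: add_group_def)

lemma inv_add_group [simp]: "inv\<^bsub>add_group\<^esub> x = - (x :: 'g::ab_group_add)"
  by (rule group.inv_equality[OF group_add_group]) simp_all

locale fg_hahn_subfield = hahn_subfield K for K :: "('g::linordered_ab_group_add \<Rightarrow> 'k::field) set" +
  fixes E :: "'g set"
  assumes finite_E: "finite E" and generate_E: "generate add_group E = UNIV"
begin

lemma hom_one_units:
  fixes u :: "'g \<Rightarrow> 'g \<Rightarrow> 'k"
  assumes "u \<in> hom add_group (one_units K)"
  shows "u g \<in> carrier (one_units K)" "u (g + h) = u g \<star> u h" "u 0 = monom 1 0"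
  using assms hom_one[OF assms group_add_group comm_group.axioms(2)[OF comm_group_one_units]]
  by (auto simp: hom_def)

text \<open>
  Neumann's lemma gives one well-ordered set carrying all values of a homomorphism: the monoid
  generated by the supports of its values at the finitely many generators.
\<close>

lemma hom_one_units_support:
  fixes u :: "'g \<Rightarrow> 'g \<Rightarrow> 'k"
  assumes u: "u \<in> hom add_group (one_units K)"
  obtains T where "well_ordered T" "\<And>g. supp (u g) \<subseteq> T"
proof -
  define A where "A = (\<Union>x\<in>E. supp (u x)) - {0}"
  define T where "T = additive_closure A"
  have uK: "u g \<in> K" "u g 0 = 1" "\<And>p. p < 0 \<Longrightarrow> u g p = 0" for g
    using hom_one_units(1)[OF u, of g] by (auto simp: one_units_iff)
  have posA: "0 < p" if "p \<in> A" for p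
    using that uK(3)[of p] by (fastforce simp: A_def supp_def)
  have "well_ordered (\<Union>x\<in>E. supp (u x))"
    using finite_E by (rule well_ordered_UN) (simp add: uK)
  then have "well_ordered A"
    by (rule well_ordered_subset) (simp add: A_def)
  then have T: "well_ordered T"
    unfolding T_def by (rule well_ordered_additive_closure) (rule posA)
  have T0: "0 \<in> T" and T_add: "\<And>s t. s \<in> T \<Longrightarrow> t \<in> T \<Longrightarrow> s + t \<in> T"
    unfolding T_def by (rule additive_closure_zero, rule additive_closure_add)
  have TE: "supp (u x) \<subseteq> T" if "x \<in> E" for x
  proof
    fix p assume "p \<in> supp (u x)"
    then have "p = 0 \<or> p \<in> A"
      using that unfolding A_def by blast
    then show "p \<in> T"
      using T0 additive_closure_incl unfolding T_def by blast
  qed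
  have "supp (u g) \<subseteq> T" if "g \<in> generate add_group E" for g
    using that
  proof (induction rule: generate.induct)
    case one
    then show ?case
      using hom_one_units(3)[OF u] supp_monom[of "1 :: 'k" 0] T0 by auto
  next
    case (incl h)
    then show ?case by (rule TE)
  next
    case (inv h)
    have "u h \<star> u (- h) = monom 1 0"
      using hom_one_units(2)[OF u, of h "- h"] hom_one_units(3)[OF u] by simp
    then show ?case
      using supp_inverse_subset[of "u h" "u (- h)" T] uK TE[OF inv] T0 T_add by simp
  next
    case (eng h1 h2)
    have "supp (u h1 \<star> u h2) \<subseteq> supp (u h1) + supp (u h2)"
      by (rule supp_hahn_mult)
    also have "\<dots> \<subseteq> T + T"
      using eng.IH by (rule set_plus_mono2)
    also have "\<dots> \<subseteq> T"
      using T_add by (auto elim!: set_plus_elim)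
    finally show ?case
      by (simp add: hom_one_units(2)[OF u])
  qed
  then have "supp (u g) \<subseteq> T" for g
    by (simp add: generate_E)
  then show thesis
    using that[of T] T by blast
qed

lemma tau_family_eq: "tau_family u a g p = a g * u g (p - g)"
  by (simp add: tau_family_def monom_mult)

lemma tau_eq:
  assumes "a \<in> K"
  shows "tau K u a = (\<lambda>p. \<Sum>g. a g * u g (p - g))"
proof -
  have "family_sum (tau_family u a) (supp a) = (\<lambda>p. \<Sum>g. tau_family u a g p)"
    by (rule family_sum_eq) (auto simp: tau_family_eq supp_def)
  then show ?thesis
    using assms by (simp add: tau_def tau_family_eq)
qed

lemma Hom_plus_hom: "u \<in> carrier (Hom_plus K) \<Longrightarrow> u \<in> hom add_group (one_units K)"
  by (simp add: Hom_plus_def)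

lemma tau_closed:
  assumes "u \<in> carrier (Hom_plus K)" "a \<in> K"
  shows "tau K u a \<in> K"
  using assms by (simp add: Hom_plus_def K_summable_family_def tau_def)

lemma tau_monom: "tau K u (monom c g) = monom c g \<star> u g"
proof
  fix p
  have "{h. monom c g h * u h (p - h) \<noteq> 0} \<subseteq> {g}"
    by (auto simp: monom_def)
  then have "(\<Sum>h. monom c g h * u h (p - h)) = c * u g (p - g)"
    by (simp add: Sum_any.expand_superset[of "{g}"] monom_def)
  then show "tau K u (monom c g) p = (monom c g \<star> u g) p"
    by (simp add: tau_eq monom_mult)
qed

text \<open>A \<open>K\<close>-summable map is determined by its values at the monomials.\<close>

lemma Hom_plusI:
  assumes "v \<in> hom add_group (one_units K)" "K_summable_map K \<sigma>"
    and \<sigma>: "\<And>c g. \<sigma> (monom c g) = monom c g \<star> v g"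
  shows "v \<in> carrier (Hom_plus K)" and "\<And>a. a \<in> K \<Longrightarrow> tau K v a = \<sigma> a"
proof -
  have "tau_family v a = (\<lambda>g. \<sigma> (monom (a g) g))" for a
    by (simp add: tau_family_def \<sigma>)
  then show "v \<in> carrier (Hom_plus K)" "\<And>a. a \<in> K \<Longrightarrow> tau K v a = \<sigma> a"
    using assms(1,2) by (simp_all add: Hom_plus_def K_summable_map_def tau_def)
qed

lemma tau_inj:
  assumes "\<And>g. tau K u (monom 1 g) = tau K w (monom 1 g)"
  shows "u = w"
proof (intro ext)
  fix g p
  have "(monom 1 g \<star> u g) (p + g) = (monom 1 g \<star> w g) (p + g)"
    using assms[of g] by (simp add: tau_monom)
  then show "u g p = w g p"
    by (simp add: monom_mult)
qed

lemma finite_tau_terms: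
  assumes "u \<in> hom add_group (one_units K)" "a \<in> K"
  shows "finite {g. a g * u g (p - g) \<noteq> 0}"
proof -
  obtain T where T: "well_ordered T" "\<And>g. supp (u g) \<subseteq> T"
    using hom_one_units_support[OF assms(1)] by metis
  show ?thesis
    by (rule finite_product_terms[OF K_well_ordered[OF assms(2)] T(1), of _ p])
      (use T(2) in \<open>auto simp: supp_def\<close>)
qed

text \<open>
  The control set is the one given by Neumann's lemma, and the order automorphism is the identity.
\<close>

lemma tau_controlled:
  assumes "u \<in> carrier (Hom_plus K)"
  obtains T where "controlled (tau K u) id T"
proof -
  note u = Hom_plus_hom[OF assms]
  obtain T where T: "well_ordered T" "\<And>g. supp (u g) \<subseteq> T"
    using hom_one_units_support[OF u] by metis
  have "controlled (tau K u) id T"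
    unfolding controlled_def
  proof (intro conjI ballI allI impI)
    show "tau K u (\<lambda>g. a g + b g) = (\<lambda>g. tau K u a g + tau K u b g)" if "a \<in> K" "b \<in> K" for a b
      using Sum_any.distrib[OF finite_tau_terms[OF u that(1)] finite_tau_terms[OF u that(2)]]
      by (simp add: tau_eq that distrib_right)
    show "p - id g \<in> T" if "tau K u (monom c g) p \<noteq> 0" for c g p
    proof -
      have "u g (p - g) \<noteq> 0"
        using that by (auto simp: tau_monom monom_mult)
      then show ?thesis
        using T(2)[of g] by (auto simp: supp_def)
    qed
  qed (simp_all add: tau_closed assms id_o_Aut T)
  then show thesis
    by (rule that)
qed

lemma tau_K_summable:
  assumes "u \<in> carrier (Hom_plus K)"
  shows "K_summable_map K (tau K u)"
proof -
  obtain T where T: "controlled (tau K u) id T"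
    using tau_controlled[OF assms] .
  have "(\<Sum>g. tau K u (monom (a g) g) p) = (\<Sum>g. a g * u g (p - g))" for a p
    by (rule Sum_any.cong) (simp add: tau_monom monom_mult)
  then show ?thesis
    by (simp add: controlled_K_summable_iff[OF T] tau_eq)
qed

text \<open>
  All values of \<open>u\<close> have constant term \<open>1\<close>, so the leading term of a series is not touched.
\<close>

lemma tau_leading:
  assumes "u \<in> carrier (Hom_plus K)" "a \<in> K" and a: "\<And>h. h < g \<Longrightarrow> a h = 0"
  shows "tau K u a g = a g" and "\<And>p. p < g \<Longrightarrow> tau K u a p = 0"
proof -
  have u: "u h 0 = 1" "p < 0 \<Longrightarrow> u h p = 0" for h p
    using hom_one_units(1)[OF Hom_plus_hom[OF assms(1)], of h] by (auto simp: one_units_iff)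
  have *: "g \<le> h \<and> h \<le> p" if "a h * u h (p - h) \<noteq> 0" for h p
    using that a[of h] u(2)[of "p - h" h] by (auto simp: not_less[symmetric])
  have "{h. a h * u h (g - h) \<noteq> 0} \<subseteq> {g}"
    using *[of _ g] by fastforce
  then show "tau K u a g = a g"
    by (simp add: tau_eq assms(2) Sum_any.expand_superset[of "{g}"] u(1))
  fix p assume "p < g"
  then have "a h * u h (p - h) = 0" for h
    using *[of h p] by fastforce
  then have "(\<Sum>h. a h * u h (p - h)) = (\<Sum>h :: 'g. 0)"
    by (rule Sum_any.cong)
  then show "tau K u a p = 0"
    by (simp add: tau_eq assms(2))
qed

lemma tau_one_units:
  assumes "u \<in> carrier (Hom_plus K)" "w \<in> carrier (one_units K)"
  shows "tau K u w \<in> carrier (one_units K)"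
  using assms tau_leading[OF assms(1), of w 0] by (simp add: one_units_iff tau_closed)

lemma tau_one:
  assumes "u \<in> carrier (Hom_plus K)"
  shows "tau K u (monom c 0) = monom c 0"
proof -
  have "tau K u (monom c 0) = monom c 0 \<star> monom 1 0"
    by (simp add: tau_monom hom_one_units(3)[OF Hom_plus_hom[OF assms]])
  then show ?thesis
    by (simp add: monom_mult_monom)
qed

text \<open>
  Since \<open>u(h + l) = u(h) u(l)\<close>, both sides expand into the same sum over triples: the exponents of the
  two series and the exponent at which the two image monomials are multiplied.
\<close>

lemma tau_mult:
  assumes uH: "u \<in> carrier (Hom_plus K)" and ab: "a \<in> K" "b \<in> K"
  shows "tau K u (a \<star> b) = tau K u a \<star> tau K u b"
proof
  fix p
  note u = Hom_plus_hom[OF uH]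
  obtain T where T: "well_ordered T" "\<And>g. supp (u g) \<subseteq> T"
    using hom_one_units_support[OF u] by metis
  note wo = K_well_ordered[OF ab(1)] K_well_ordered[OF ab(2)] T(1)
  have uT: "u g h \<noteq> 0 \<Longrightarrow> h \<in> T" for g h
    using T(2)[of g] by (auto simp: supp_def)
  have uK: "u g \<in> K" for g
    using hom_one_units(1)[OF u] by (simp add: one_units_iff)
  \<comment> \<open>both sides are the sum of \<open>F h l q\<close> over all triples, of which only finitely many are nonzero\<close>
  define F where "F h l q = (a h * u h (q - h)) * (b l * u l (p - q - l))" for h l q
  define Q where "Q = {q \<in> supp a + T. p - q \<in> supp b + T}"
  have finQ: "finite Q" "finite {h \<in> supp a. q - h \<in> T}" "finite {l \<in> supp b. p - q - l \<in> T}" for q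
    unfolding Q_def by (intro finite_antidiagonal well_ordered_plus wo)+
  have F: "q \<in> Q" "h \<in> {h \<in> supp a. q - h \<in> T}" "l \<in> {l \<in> supp b. p - q - l \<in> T}"
    if "F h l q \<noteq> 0" for h l q
  proof -
    have nz: "h \<in> supp a" "l \<in> supp b" "q - h \<in> T" "p - q - l \<in> T"
      using that uT by (auto simp: F_def supp_def)
    then show "h \<in> {h \<in> supp a. q - h \<in> T}" "l \<in> {l \<in> supp b. p - q - l \<in> T}"
      by simp_all
    show "q \<in> Q"
      using set_plus_intro[OF nz(1,3)] set_plus_intro[OF nz(2,4)] by (simp add: Q_def)
  qed
  have F': "q \<in> Q \<and> h \<in> {h \<in> supp a. q - h \<in> T}" if nz: "(\<Sum>l. F h l q) \<noteq> 0" for q h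
  proof -
    obtain l where "F h l q \<noteq> 0"
      using nz by (rule Sum_any.not_neutral_obtains_not_neutral)
    with F show ?thesis
      by blast
  qed
  have bij: "bij (\<lambda>l. k + l)" for k :: 'g
    by (rule o_bij[of "\<lambda>l. - k + l"]) auto
  have "(tau K u a \<star> tau K u b) p
      = (\<Sum>q. (\<Sum>h. a h * u h (q - h)) * (\<Sum>l. b l * u l (p - q - l)))"
    by (simp only: hahn_mult_eq tau_eq[OF ab(1)] tau_eq[OF ab(2)])
  also have "\<dots> = (\<Sum>q. \<Sum>h. \<Sum>l. F h l q)"
    unfolding F_def
    by (intro Sum_any.cong Sum_any_product finite_tau_terms[OF u] ab)
  also have "\<dots> = (\<Sum>h. \<Sum>q. \<Sum>l. F h l q)"
    by (rule Sum_any_swap[OF finQ(1,2) F'])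
  also have "\<dots> = (\<Sum>h. \<Sum>l. \<Sum>q. F h l q)"
    by (intro Sum_any.cong Sum_any_swap[OF finQ(1,3)] conjI F(1,3))
  also have "\<dots> = (\<Sum>h. \<Sum>l. a h * b l * u (h + l) (p - (h + l)))"
  proof (intro Sum_any.cong)
    fix h l
    have "(\<Sum>q. F h l q) = (\<Sum>s. a h * b l * (u h s * u l (p - (h + l) - s)))"
      by (rule Sum_any.reindex_cong[OF bij[of h]])
        (auto simp: F_def algebra_simps)
    also have "\<dots> = a h * b l * (\<Sum>s. u h s * u l (p - (h + l) - s))"
      by (rule Sum_any_right_distrib[symmetric]) (intro finite_hahn_mult K_well_ordered uK)
    also have "\<dots> = a h * b l * u (h + l) (p - (h + l))"
      by (simp only: hom_one_units(2)[OF u] hahn_mult_eq)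
    finally show "(\<Sum>q. F h l q) = a h * b l * u (h + l) (p - (h + l))" .
  qed
  also have "\<dots> = (\<Sum>h. \<Sum>g. a h * b (g - h) * u g (p - g))"
  proof (rule Sum_any.cong)
    fix h
    show "(\<Sum>l. a h * b l * u (h + l) (p - (h + l))) = (\<Sum>g. a h * b (g - h) * u g (p - g))"
      by (rule Sum_any.reindex_cong[OF bij[of h], symmetric]) auto
  qed
  also have "\<dots> = (\<Sum>g. \<Sum>h. a h * b (g - h) * u g (p - g))"
  proof (rule Sum_any_swap[symmetric])
    show "finite {g \<in> supp a + supp b. p - g \<in> T}"
      by (intro finite_antidiagonal well_ordered_plus wo)
    show "finite {h \<in> supp a. g - h \<in> supp b}" for g
      by (intro finite_antidiagonal wo)
    fix g h assume "a h * b (g - h) * u g (p - g) \<noteq> 0"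
    then have nz: "h \<in> supp a" "g - h \<in> supp b" "p - g \<in> T"
      using uT by (auto simp: supp_def)
    then show "g \<in> {g \<in> supp a + supp b. p - g \<in> T} \<and> h \<in> {h \<in> supp a. g - h \<in> supp b}"
      using set_plus_intro[OF nz(1,2)] by simp
  qed
  also have "\<dots> = (\<Sum>g. (a \<star> b) g * u g (p - g))"
    by (intro Sum_any.cong) (simp only: hahn_mult_eq Sum_any_left_distrib[OF finite_hahn_mult[OF wo(1,2)]])
  also have "\<dots> = tau K u (a \<star> b) p"
    by (simp only: tau_eq[OF K_mult[OF ab]])
  finally show "tau K u (a \<star> b) p = (tau K u a \<star> tau K u b) p"
    by simp
qed

lemma Hom_plus_mult_eq: "(u \<otimes>\<^bsub>Hom_plus K\<^esub> w) g = tau K u (w g) \<star> u g"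
  by (simp add: Hom_plus_def)

text \<open>The product on \<open>Hom_plus K\<close> is made so that it turns into composition.\<close>

lemma Hom_plus_mult:
  assumes u: "u \<in> carrier (Hom_plus K)" and w: "w \<in> carrier (Hom_plus K)"
  shows "u \<otimes>\<^bsub>Hom_plus K\<^esub> w \<in> carrier (Hom_plus K)"
    and "\<And>a. a \<in> K \<Longrightarrow> tau K (u \<otimes>\<^bsub>Hom_plus K\<^esub> w) a = tau K u (tau K w a)"
proof -
  interpret U: comm_group "one_units K"
    by (rule comm_group_one_units)
  define v where "v = u \<otimes>\<^bsub>Hom_plus K\<^esub> w"
  have v: "v g = tau K u (w g) \<star> u g" for g
    unfolding v_def by (rule Hom_plus_mult_eq)
  note hu = hom_one_units[OF Hom_plus_hom[OF u]] and hw = hom_one_units[OF Hom_plus_hom[OF w]]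
  have uK: "u g \<in> K" "w g \<in> K" for g
    using hu(1)[of g] hw(1)[of g] by (simp_all add: one_units_iff)
  have tw: "tau K u (w g) \<in> carrier (one_units K)" for g
    by (rule tau_one_units[OF u hw(1)])
  have vhom: "v \<in> hom add_group (one_units K)"
  proof (rule homI)
    fix g show "v g \<in> carrier (one_units K)"
      unfolding v by (rule one_units_mult[OF tw hu(1)])
  next
    fix g h
    have "v (g + h) = (tau K u (w g) \<star> tau K u (w h)) \<star> (u g \<star> u h)"
      by (simp add: v hu(2) hw(2) tau_mult[OF u] uK)
    also have "\<dots> = v g \<star> v h"
      using U.m_ac tw[of g] tw[of h] hu(1)[of g] hu(1)[of h] by (simp add: v one_units_mult)
    finally show "v (g \<otimes>\<^bsub>add_group\<^esub> h) = v g \<otimes>\<^bsub>one_units K\<^esub> v h"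
      by simp
  qed
  obtain T1 where T1: "controlled (tau K u) id T1"
    using tau_controlled[OF u] .
  obtain T2 where T2: "controlled (tau K w) id T2"
    using tau_controlled[OF w] .
  have summ: "K_summable_map K (\<lambda>a. tau K u (tau K w a))"
    by (rule controlled_compose(2)[OF T1 tau_K_summable[OF u] T2 tau_K_summable[OF w]]) simp
  have mon: "tau K u (tau K w (monom c g)) = monom c g \<star> v g" for c g
  proof -
    have "tau K u (tau K w (monom c g)) = (monom c g \<star> u g) \<star> tau K u (w g)"
      by (simp add: tau_monom tau_mult[OF u] uK)
    also have "\<dots> = monom c g \<star> (u g \<star> tau K u (w g))"
      by (intro hahn_mult_assoc K_well_ordered K_monom uK tau_closed[OF u])
    also have "u g \<star> tau K u (w g) = v g"
      unfolding v by (rule hahn_mult_commute)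
    finally show ?thesis .
  qed
  show "u \<otimes>\<^bsub>Hom_plus K\<^esub> w \<in> carrier (Hom_plus K)"
    using Hom_plusI(1)[OF vhom summ mon] by (simp only: v_def)
  show "tau K (u \<otimes>\<^bsub>Hom_plus K\<^esub> w) a = tau K u (tau K w a)" if "a \<in> K" for a
    using Hom_plusI(2)[OF vhom summ mon that] by (simp only: v_def)
qed

lemma id_K_summable: "K_summable_map K (\<lambda>a. a)"
proof -
  have "controlled (\<lambda>a. a) id {0}"
    by (auto simp: controlled_def id_o_Aut well_ordered_singleton) (auto simp: monom_def split: if_splits)
  moreover have "(\<Sum>g. monom (a g) g p) = a p" for a :: "'g \<Rightarrow> 'k" and p
  proof -
    have "{g. monom (a g) g p \<noteq> 0} \<subseteq> {p}"
      by (auto simp: monom_def)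
    then show ?thesis
      by (simp add: Sum_any.expand_superset[of "{p}"] monom_def)
  qed
  ultimately show ?thesis
    by (simp add: controlled_K_summable_iff)
qed

lemma Hom_plus_one:
  shows "\<one>\<^bsub>Hom_plus K\<^esub> \<in> carrier (Hom_plus K)" and "\<And>a. a \<in> K \<Longrightarrow> tau K \<one>\<^bsub>Hom_plus K\<^esub> a = a"
proof -
  interpret U: comm_group "one_units K"
    by (rule comm_group_one_units)
  have "(\<lambda>g. monom 1 0) \<in> hom add_group (one_units K)"
    using U.one_closed by (intro homI) (auto simp: monom_mult_monom)
  note one = Hom_plusI[OF this id_K_summable]
  have eq: "\<one>\<^bsub>Hom_plus K\<^esub> = (\<lambda>g. monom 1 0)"
    by (simp add: Hom_plus_def)
  show "\<one>\<^bsub>Hom_plus K\<^esub> \<in> carrier (Hom_plus K)" "\<And>a. a \<in> K \<Longrightarrow> tau K \<one>\<^bsub>Hom_plus K\<^esub> a = a"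
    unfolding eq by (rule one; simp add: monom_mult_monom)+
qed

end

section \<open>Evaluation at generators\<close>

text \<open>
  Hence \<^const>\<open>from_gens\<close> really inverts \<^const>\<open>at_gens\<close> on the image of the homomorphisms.
\<close>

lemma hom_eq_on_generators:
  assumes H: "group H" and E: "generate add_group E = (UNIV :: 'g::ab_group_add set)"
    and f: "f \<in> hom add_group H" "f' \<in> hom add_group H" "\<And>x. x \<in> E \<Longrightarrow> f x = f' x"
  shows "f = f'"
proof
  fix g
  interpret F: group_hom add_group H f
    using f(1) H group_add_group by (simp add: group_hom_def group_hom_axioms_def)
  interpret F': group_hom add_group H f'
    using f(2) H group_add_group by (simp add: group_hom_def group_hom_axioms_def)
  have "f g = f' g" if "g \<in> generate add_group E"
    using that
  proof (induction rule: generate.induct)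
    case one
    then show ?case using F.hom_one F'.hom_one by simp
  next
    case (incl h)
    then show ?case by (rule f(3))
  next
    case (inv h)
    then show ?case using F.hom_inv[of h] F'.hom_inv[of h] f(3) by simp
  next
    case (eng h1 h2)
    then show ?case using F.hom_mult[of h1 h2] F'.hom_mult[of h1 h2] by simp
  qed
  then show "f g = f' g"
    by (simp add: E)
qed

lemma from_gens_at_gens:
  assumes "group H" "generate add_group (range e) = UNIV" "f \<in> hom add_group H"
  shows "from_gens H e (at_gens e f) = f"
proof -
  have "inj_on (at_gens e) (hom add_group H)"
    by (rule inj_onI, rule hom_eq_on_generators[OF assms(1,2)])
      (auto simp: at_gens_def fun_eq_iff)
  then show ?thesis
    unfolding from_gens_def using assms(3) by (rule inv_into_f_f)
qed

locale generated_hahn_subfield = hahn_subfield K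
  for K :: "('g::linordered_ab_group_add \<Rightarrow> 'k::field) set" +
  fixes e :: "'n::finite \<Rightarrow> 'g"
  assumes generate_e: "generate add_group (range e) = UNIV"
begin

sublocale fg_hahn_subfield K "range e"
  by unfold_locales (simp_all add: generate_e)

lemma from_gens_one_units:
  assumes "u \<in> carrier (Hom_plus K)"
  shows "from_gens (one_units K) e (at_gens e u) = u"
  by (rule from_gens_at_gens[OF comm_group.axioms(2)[OF comm_group_one_units] generate_e
        Hom_plus_hom[OF assms]])

lemma tau_tuple_at_gens:
  "u \<in> carrier (Hom_plus K) \<Longrightarrow> tau_tuple K e (at_gens e u) = tau K u"
  by (simp add: tau_tuple_def from_gens_one_units)

lemma one_units_plus_at_gens:
  "carrier (one_units_plus K e) = at_gens e ` carrier (Hom_plus K)"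
  "\<one>\<^bsub>one_units_plus K e\<^esub> = at_gens e \<one>\<^bsub>Hom_plus K\<^esub>"
  "u \<in> carrier (Hom_plus K) \<Longrightarrow> w \<in> carrier (Hom_plus K) \<Longrightarrow>
    at_gens e u \<otimes>\<^bsub>one_units_plus K e\<^esub> at_gens e w = at_gens e (u \<otimes>\<^bsub>Hom_plus K\<^esub> w)"
  by (simp_all add: one_units_plus_def from_gens_one_units)

lemma tau_extensional: "tau K u \<in> extensional K"
  by (simp add: tau_def)

lemma tau_tuple_mult:
  assumes "x \<in> carrier (one_units_plus K e)" "y \<in> carrier (one_units_plus K e)"
  shows "x \<otimes>\<^bsub>one_units_plus K e\<^esub> y \<in> carrier (one_units_plus K e)"
    and "tau_tuple K e (x \<otimes>\<^bsub>one_units_plus K e\<^esub> y) = compose K (tau_tuple K e x) (tau_tuple K e y)"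
proof -
  obtain u w where uw: "u \<in> carrier (Hom_plus K)" "x = at_gens e u"
      "w \<in> carrier (Hom_plus K)" "y = at_gens e w"
    using assms unfolding one_units_plus_at_gens(1) by blast
  note eq = one_units_plus_at_gens(3)[OF uw(1,3)] and m = Hom_plus_mult[OF uw(1,3)]
  show "x \<otimes>\<^bsub>one_units_plus K e\<^esub> y \<in> carrier (one_units_plus K e)"
    unfolding uw(2,4) eq one_units_plus_at_gens(1) using m(1) by (rule imageI)
  have "tau K (u \<otimes>\<^bsub>Hom_plus K\<^esub> w) = compose K (tau K u) (tau K w)"
    by (rule extensionalityI[OF tau_extensional compose_extensional]) (simp add: m(2) compose_eq)
  then show "tau_tuple K e (x \<otimes>\<^bsub>one_units_plus K e\<^esub> y) = compose K (tau_tuple K e x) (tau_tuple K e y)"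
    unfolding uw(2,4) eq by (simp only: tau_tuple_at_gens m(1) uw(1,3))
qed

lemma tau_tuple_one:
  "\<one>\<^bsub>one_units_plus K e\<^esub> \<in> carrier (one_units_plus K e)"
  "tau_tuple K e \<one>\<^bsub>one_units_plus K e\<^esub> = (\<lambda>a\<in>K. a)"
proof -
  show "\<one>\<^bsub>one_units_plus K e\<^esub> \<in> carrier (one_units_plus K e)"
    unfolding one_units_plus_at_gens using Hom_plus_one(1) by (rule imageI)
  show "tau_tuple K e \<one>\<^bsub>one_units_plus K e\<^esub> = (\<lambda>a\<in>K. a)"
    unfolding one_units_plus_at_gens tau_tuple_at_gens[OF Hom_plus_one(1)]
    by (rule extensionalityI[OF tau_extensional restrict_extensional]) (simp add: Hom_plus_one(2))
qed

lemma tau_tuple_inj: "inj_on (tau_tuple K e) (carrier (one_units_plus K e))"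
proof (rule inj_onI)
  fix x y
  assume xy: "x \<in> carrier (one_units_plus K e)" "y \<in> carrier (one_units_plus K e)"
    and eq: "tau_tuple K e x = tau_tuple K e y"
  obtain u w where uw: "u \<in> carrier (Hom_plus K)" "x = at_gens e u"
      "w \<in> carrier (Hom_plus K)" "y = at_gens e w"
    using xy unfolding one_units_plus_at_gens(1) by blast
  have "tau K u = tau K w"
    using eq uw by (simp add: tau_tuple_at_gens)
  then have "u = w"
    by (intro tau_inj) simp
  then show "x = y"
    by (simp add: uw)
qed

lemma tau_tuple_funcset: "x \<in> carrier (one_units_plus K e) \<Longrightarrow> tau_tuple K e x \<in> K \<rightarrow> K"
  unfolding one_units_plus_at_gens(1) by (auto simp: tau_tuple_at_gens tau_closed)

lemma tau_tuple_extensional: "tau_tuple K e x \<in> extensional K"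
  by (simp add: tau_tuple_def tau_extensional)

text \<open>
  The laws are pulled back along the injective map into endomaps of \<open>K\<close>, where the product becomes
  composition.
\<close>

lemma monoid_one_units_plus: "monoid (one_units_plus K e)"
proof (rule monoidI)
  fix x y z
  assume xyz: "x \<in> carrier (one_units_plus K e)" "y \<in> carrier (one_units_plus K e)"
    "z \<in> carrier (one_units_plus K e)"
  show "x \<otimes>\<^bsub>one_units_plus K e\<^esub> y \<otimes>\<^bsub>one_units_plus K e\<^esub> z
      = x \<otimes>\<^bsub>one_units_plus K e\<^esub> (y \<otimes>\<^bsub>one_units_plus K e\<^esub> z)"
    by (rule inj_onD[OF tau_tuple_inj])
      (simp_all add: tau_tuple_mult xyz compose_assoc[OF tau_tuple_funcset[OF xyz(3)]])
next
  fix x assume x: "x \<in> carrier (one_units_plus K e)"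
  show "\<one>\<^bsub>one_units_plus K e\<^esub> \<otimes>\<^bsub>one_units_plus K e\<^esub> x = x"
    by (rule inj_onD[OF tau_tuple_inj])
      (simp_all add: tau_tuple_mult tau_tuple_one x Id_compose[OF tau_tuple_funcset[OF x] tau_tuple_extensional])
  show "x \<otimes>\<^bsub>one_units_plus K e\<^esub> \<one>\<^bsub>one_units_plus K e\<^esub> = x"
    by (rule inj_onD[OF tau_tuple_inj])
      (simp_all add: tau_tuple_mult tau_tuple_one x compose_Id[OF tau_tuple_funcset[OF x] tau_tuple_extensional])
qed (simp_all add: tau_tuple_mult tau_tuple_one)

end

section \<open>Valuation-compatible automorphisms\<close>

context hahn_subfield
begin

lemma v_Aut_carrier_iff:
  "\<sigma> \<in> carrier (v_Aut K) \<longleftrightarrow> \<sigma> \<in> Bij K \<and> \<sigma> \<in> ring_iso (hahn_series\<lparr>carrier := K\<rparr>) (hahn_series\<lparr>carrier := K\<rparr>) \<and>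
     (\<exists>\<tau>\<in>carrier o_Aut. \<forall>a \<in> K. a \<noteq> (\<lambda>g. 0) \<longrightarrow> \<tau> (val a) = val (\<sigma> a))"
  by (auto simp: v_Aut_def)

lemma v_AutI:
  assumes "\<sigma> \<in> extensional K" "bij_betw \<sigma> K K"
    and "\<And>a b. a \<in> K \<Longrightarrow> b \<in> K \<Longrightarrow> \<sigma> (\<lambda>g. a g + b g) = (\<lambda>g. \<sigma> a g + \<sigma> b g)"
    and "\<And>a b. a \<in> K \<Longrightarrow> b \<in> K \<Longrightarrow> \<sigma> (a \<star> b) = \<sigma> a \<star> \<sigma> b"
    and "\<sigma> (monom 1 0) = monom 1 0"
    and "\<tau> \<in> carrier o_Aut" "\<And>a. a \<in> K \<Longrightarrow> a \<noteq> (\<lambda>g. 0) \<Longrightarrow> val (\<sigma> a) = \<tau> (val a)"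
  shows "\<sigma> \<in> carrier (v_Aut K)"
  unfolding v_Aut_carrier_iff
proof (intro conjI)
  show "\<sigma> \<in> Bij K"
    using assms(1,2) by (simp add: Bij_def)
  have "\<sigma> a \<in> K" if "a \<in> K" for a
    using assms(2) that by (rule bij_betwE[THEN bspec])
  then show "\<sigma> \<in> ring_iso (hahn_series\<lparr>carrier := K\<rparr>) (hahn_series\<lparr>carrier := K\<rparr>)"
    using assms(2-5) by (intro ring_iso_memI) simp_all
  show "\<exists>\<tau>\<in>carrier o_Aut. \<forall>a \<in> K. a \<noteq> (\<lambda>g. 0) \<longrightarrow> \<tau> (val a) = val (\<sigma> a)"
    using assms(6,7) by (intro bexI[of _ \<tau>]) simp_all
qed

lemma v_AutD:
  assumes "\<sigma> \<in> carrier (v_Aut K)"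
  shows "\<sigma> \<in> Bij K" "\<sigma> \<in> extensional K" "bij_betw \<sigma> K K" "\<And>a. a \<in> K \<Longrightarrow> \<sigma> a \<in> K"
    and "\<And>a b. a \<in> K \<Longrightarrow> b \<in> K \<Longrightarrow> \<sigma> (\<lambda>g. a g + b g) = (\<lambda>g. \<sigma> a g + \<sigma> b g)"
    and "\<And>a b. a \<in> K \<Longrightarrow> b \<in> K \<Longrightarrow> \<sigma> (a \<star> b) = \<sigma> a \<star> \<sigma> b"
    and "\<sigma> (monom 1 0) = monom 1 0"
proof -
  have iso: "\<sigma> \<in> ring_iso (hahn_series\<lparr>carrier := K\<rparr>) (hahn_series\<lparr>carrier := K\<rparr>)" and Bij: "\<sigma> \<in> Bij K"
    using assms by (simp_all add: v_Aut_carrier_iff)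
  then show "\<sigma> \<in> Bij K" "\<sigma> \<in> extensional K" "bij_betw \<sigma> K K"
    by (simp_all add: Bij_def)
  show "\<And>a. a \<in> K \<Longrightarrow> \<sigma> a \<in> K" "\<sigma> (monom 1 0) = monom 1 0"
    "\<And>a b. a \<in> K \<Longrightarrow> b \<in> K \<Longrightarrow> \<sigma> (\<lambda>g. a g + b g) = (\<lambda>g. \<sigma> a g + \<sigma> b g)"
    "\<And>a b. a \<in> K \<Longrightarrow> b \<in> K \<Longrightarrow> \<sigma> (a \<star> b) = \<sigma> a \<star> \<sigma> b"
    using ring_iso_memE(1-4)[OF iso] by simp_all
qed

lemma v_Aut_val:
  assumes "\<sigma> \<in> carrier (v_Aut K)"
  obtains \<tau> where "\<tau> \<in> carrier o_Aut" "\<And>a. a \<in> K \<Longrightarrow> a \<noteq> (\<lambda>g. 0) \<Longrightarrow> val (\<sigma> a) = \<tau> (val a)"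
  using assms unfolding v_Aut_carrier_iff by metis

lemma v_Aut_zero:
  assumes "\<sigma> \<in> carrier (v_Aut K)"
  shows "\<sigma> (\<lambda>g. 0) = (\<lambda>g. 0)"
proof -
  have "\<sigma> (\<lambda>g. 0) = (\<lambda>g. \<sigma> (\<lambda>g. 0) g + \<sigma> (\<lambda>g. 0) g)"
    using v_AutD(5)[OF assms K_zero K_zero] by simp
  then have "\<sigma> (\<lambda>g. 0) p = \<sigma> (\<lambda>g. 0) p + \<sigma> (\<lambda>g. 0) p" for p
    by (rule fun_cong)
  then show ?thesis
    by (metis add_cancel_right_right)
qed

lemma v_Aut_nonzero:
  assumes "\<sigma> \<in> carrier (v_Aut K)" "a \<in> K" "a \<noteq> (\<lambda>g. 0)"
  shows "\<sigma> a \<noteq> (\<lambda>g. 0)"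
  using v_AutD(3)[OF assms(1)] v_Aut_zero[OF assms(1)] assms(2,3) K_zero
  by (metis bij_betw_imp_inj_on inj_onD)

lemma compose_v_Aut:
  assumes \<sigma>: "\<sigma> \<in> carrier (v_Aut K)" and \<sigma>': "\<sigma>' \<in> carrier (v_Aut K)"
  shows "compose K \<sigma> \<sigma>' \<in> carrier (v_Aut K)"
proof -
  obtain \<tau> where \<tau>: "\<tau> \<in> carrier o_Aut" "\<And>a. a \<in> K \<Longrightarrow> a \<noteq> (\<lambda>g. 0) \<Longrightarrow> val (\<sigma> a) = \<tau> (val a)"
    using v_Aut_val[OF \<sigma>] by metis
  obtain \<tau>' where \<tau>': "\<tau>' \<in> carrier o_Aut" "\<And>a. a \<in> K \<Longrightarrow> a \<noteq> (\<lambda>g. 0) \<Longrightarrow> val (\<sigma>' a) = \<tau>' (val a)"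
    using v_Aut_val[OF \<sigma>'] by metis
  show ?thesis
  proof (rule v_AutI[where \<tau> = "\<tau> \<circ> \<tau>'"])
    show "bij_betw (compose K \<sigma> \<sigma>') K K"
      by (rule bij_betw_compose[OF v_AutD(3)[OF \<sigma>'] v_AutD(3)[OF \<sigma>]])
    show "\<tau> \<circ> \<tau>' \<in> carrier o_Aut"
      using \<tau> \<tau>' by (auto simp: o_Aut_iff bij_comp strict_mono_def)
    show "val (compose K \<sigma> \<sigma>' a) = (\<tau> \<circ> \<tau>') (val a)" if "a \<in> K" "a \<noteq> (\<lambda>g. 0)" for a
      using that by (simp add: compose_eq \<tau> \<tau>' v_AutD(4)[OF \<sigma>'] v_Aut_nonzero[OF \<sigma>'])
  qed (simp_all add: compose_eq v_AutD(4-7)[OF \<sigma>] v_AutD(4-7)[OF \<sigma>'] compose_extensional)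
qed

lemma inv_into_v_Aut:
  assumes \<sigma>: "\<sigma> \<in> carrier (v_Aut K)"
  shows "restrict (inv_into K \<sigma>) K \<in> carrier (v_Aut K)"
proof -
  obtain \<tau> where \<tau>: "\<tau> \<in> carrier o_Aut" "\<And>a. a \<in> K \<Longrightarrow> a \<noteq> (\<lambda>g. 0) \<Longrightarrow> val (\<sigma> a) = \<tau> (val a)"
    using v_Aut_val[OF \<sigma>] by metis
  have surj: "\<exists>a\<in>K. \<sigma> a = b" if "b \<in> K" for b
    using bij_betw_imp_surj_on[OF v_AutD(3)[OF \<sigma>]] that by (metis imageE)
  have left: "inv_into K \<sigma> (\<sigma> a) = a" if "a \<in> K" for a
    using v_AutD(3)[OF \<sigma>] that by (simp add: bij_betw_def)
  show ?thesis
  proof (rule v_AutI[where \<tau> = "inv_into UNIV \<tau>"])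
    show "bij_betw (restrict (inv_into K \<sigma>) K) K K"
      using bij_betw_inv_into[OF v_AutD(3)[OF \<sigma>]] by simp
    show "inv_into UNIV \<tau> \<in> carrier o_Aut"
      by (rule o_Aut_inv_into(1)[OF \<tau>(1)])
  next
    fix a b assume ab: "a \<in> K" "b \<in> K"
    then obtain x y where xy: "x \<in> K" "\<sigma> x = a" "y \<in> K" "\<sigma> y = b"
      using surj by metis
    have "inv_into K \<sigma> (\<lambda>g. \<sigma> x g + \<sigma> y g) = (\<lambda>g. x g + y g)"
      using left[OF K_add[OF xy(1,3)]] by (simp add: v_AutD(5)[OF \<sigma> xy(1,3)])
    then show "restrict (inv_into K \<sigma>) K (\<lambda>g. a g + b g)
        = (\<lambda>g. restrict (inv_into K \<sigma>) K a g + restrict (inv_into K \<sigma>) K b g)"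
      using xy left[OF xy(1)] left[OF xy(3)] K_add[OF ab] ab by simp
    have "inv_into K \<sigma> (\<sigma> x \<star> \<sigma> y) = x \<star> y"
      using left[OF K_mult[OF xy(1,3)]] by (simp add: v_AutD(6)[OF \<sigma> xy(1,3)])
    then show "restrict (inv_into K \<sigma>) K (a \<star> b)
        = restrict (inv_into K \<sigma>) K a \<star> restrict (inv_into K \<sigma>) K b"
      using xy left[OF xy(1)] left[OF xy(3)] K_mult[OF ab] ab by simp
  next
    show "restrict (inv_into K \<sigma>) K (monom 1 0) = monom 1 0"
      using left[OF K_one] v_AutD(7)[OF \<sigma>] by simp
  next
    fix a assume a: "a \<in> K" "a \<noteq> (\<lambda>g. 0)"
    then obtain x where x: "x \<in> K" "\<sigma> x = a"
      using surj by metis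
    have "x \<noteq> (\<lambda>g. 0)"
      using x a v_Aut_zero[OF \<sigma>] by metis
    then have "val a = \<tau> (val x)"
      using \<tau>(2)[OF x(1)] x(2) by simp
    then show "val (restrict (inv_into K \<sigma>) K a) = inv_into UNIV \<tau> (val a)"
      using a x left[OF x(1)] o_Aut_inv_into(3)[OF \<tau>(1)] by simp
  qed simp
qed

lemma subgroup_v_Aut: "subgroup (carrier (v_Aut K)) (BijGroup K)"
proof (rule group.subgroupI[OF group_BijGroup])
  show "carrier (v_Aut K) \<subseteq> carrier (BijGroup K)"
    by (auto simp: BijGroup_def dest: v_AutD(1))
  show "inv\<^bsub>BijGroup K\<^esub> \<sigma> \<in> carrier (v_Aut K)" if "\<sigma> \<in> carrier (v_Aut K)" for \<sigma>
    using inv_into_v_Aut[OF that] inv_BijGroup[OF v_AutD(1)[OF that]] by simp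
  show "\<sigma> \<otimes>\<^bsub>BijGroup K\<^esub> \<sigma>' \<in> carrier (v_Aut K)" if "\<sigma> \<in> carrier (v_Aut K)" "\<sigma>' \<in> carrier (v_Aut K)" for \<sigma> \<sigma>'
    using compose_v_Aut[OF that] v_AutD(1)[OF that(1)] v_AutD(1)[OF that(2)] by (simp add: BijGroup_def)
  have "(\<lambda>a\<in>K. a) \<in> carrier (v_Aut K)"
    by (rule v_AutI[where \<tau> = id]) (simp_all add: id_o_Aut bij_betw_def inj_on_def)
  then show "carrier (v_Aut K) \<noteq> {}"
    by blast
qed

lemma v_Aut_BijGroup: "v_Aut K = BijGroup K\<lparr>carrier := carrier (v_Aut K)\<rparr>"
  by (simp add: v_Aut_def)

lemma group_v_Aut: "group (v_Aut K)"
  using subgroup.subgroup_is_group[OF subgroup_v_Aut group_BijGroup] by (simp add: v_Aut_BijGroup[symmetric])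

lemma v_Aut_mult:
  assumes "\<sigma> \<in> carrier (v_Aut K)" "\<sigma>' \<in> carrier (v_Aut K)"
  shows "\<sigma> \<otimes>\<^bsub>v_Aut K\<^esub> \<sigma>' = compose K \<sigma> \<sigma>'"
proof -
  have "mult (v_Aut K) = mult (BijGroup K)"
    by (simp add: v_Aut_def)
  then show ?thesis
    using v_AutD(1)[OF assms(1)] v_AutD(1)[OF assms(2)] by (simp add: BijGroup_def)
qed

lemma v_Aut_one: "\<one>\<^bsub>v_Aut K\<^esub> = (\<lambda>a\<in>K. a)"
  by (simp add: v_Aut_def BijGroup_def)

lemma v_Aut_inv:
  assumes "\<sigma> \<in> carrier (v_Aut K)"
  shows "inv\<^bsub>v_Aut K\<^esub> \<sigma> = restrict (inv_into K \<sigma>) K"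
proof -
  have "inv\<^bsub>v_Aut K\<^esub> \<sigma> = inv\<^bsub>BijGroup K\<^esub> \<sigma>"
    using group.m_inv_consistent[OF group_BijGroup subgroup_v_Aut assms] by (simp add: v_Aut_BijGroup[symmetric])
  then show ?thesis
    by (simp add: inv_BijGroup v_AutD(1)[OF assms])
qed

lemma v_Aut_apply:
  assumes "\<sigma> \<in> carrier (v_Aut K)" "\<sigma>' \<in> carrier (v_Aut K)" "a \<in> K"
  shows "(\<sigma> \<otimes>\<^bsub>v_Aut K\<^esub> \<sigma>') a = \<sigma> (\<sigma>' a)"
  using assms by (simp add: v_Aut_mult compose_eq)

lemma v_Aut_inv_apply:
  assumes "\<sigma> \<in> carrier (v_Aut K)" "a \<in> K"
  shows "(inv\<^bsub>v_Aut K\<^esub> \<sigma>) (\<sigma> a) = a" "\<sigma> ((inv\<^bsub>v_Aut K\<^esub> \<sigma>) a) = a" "(inv\<^bsub>v_Aut K\<^esub> \<sigma>) a = inv_into K \<sigma> a"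
  using v_AutD(3,4)[OF assms(1)] assms
  by (auto simp: v_Aut_inv bij_betw_def f_inv_into_f)

lemma strongly_additive_iff:
  assumes "\<sigma> \<in> carrier (v_Aut K)"
  shows "strongly_additive K \<sigma> \<longleftrightarrow> K_summable_map K \<sigma> \<and> K_summable_map K (inv\<^bsub>v_Aut K\<^esub> \<sigma>)"
proof -
  have "K_summable_map K (inv_into K \<sigma>) \<longleftrightarrow> K_summable_map K (inv\<^bsub>v_Aut K\<^esub> \<sigma>)"
    by (rule K_summable_map_cong) (simp add: v_Aut_inv_apply(3)[OF assms])
  then show ?thesis
    by (simp add: strongly_additive_def)
qed

lemma monom_in_constants: "monom c 0 \<in> constants"
  by (simp add: constants_def)

lemma constants_subset_K: "a \<in> constants \<Longrightarrow> a \<in> K"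
  by (auto simp: constants_def)

end

context fg_hahn_subfield
begin

lemma v_Aut_monom_add:
  assumes "\<sigma> \<in> carrier (v_Aut K)"
  shows "\<sigma> (monom 1 (g + h)) = \<sigma> (monom 1 g) \<star> \<sigma> (monom 1 h)"
  using v_AutD(6)[OF assms K_monom[of 1 g] K_monom[of 1 h]] by (simp add: monom_mult_monom)

lemma v_Aut_monom_leading:
  assumes \<sigma>: "\<sigma> \<in> carrier (v_Aut K)"
    and val: "\<And>a. a \<in> K \<Longrightarrow> a \<noteq> (\<lambda>g. 0) \<Longrightarrow> val (\<sigma> a) = \<tau> (val a)"
  shows "\<sigma> (monom 1 g) (\<tau> g) \<noteq> 0" and "\<And>p. p < \<tau> g \<Longrightarrow> \<sigma> (monom 1 g) p = 0"
proof -
  have K: "\<sigma> (monom 1 g) \<in> K"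
    by (rule v_AutD(4)[OF \<sigma> K_monom])
  have nz: "\<sigma> (monom 1 g) \<noteq> (\<lambda>h. 0)"
    by (rule v_Aut_nonzero[OF \<sigma> K_monom monom_one_nonzero])
  have v: "val (\<sigma> (monom 1 g)) = \<tau> g"
    using val[OF K_monom monom_one_nonzero, of g] by (simp add: val_monom)
  show "\<sigma> (monom 1 g) (\<tau> g) \<noteq> 0" "\<And>p. p < \<tau> g \<Longrightarrow> \<sigma> (monom 1 g) p = 0"
    using val_nonzero[OF K_well_ordered[OF K] nz] below_val[OF K_well_ordered[OF K] nz] by (simp_all add: v)
qed

text \<open>Leading coefficients multiply, so dividing by the leading term keeps the homomorphism property.\<close>

lemma one_unit_part_hom:
  assumes \<sigma>: "\<sigma> \<in> carrier (v_Aut K)" and \<tau>: "\<tau> \<in> carrier o_Aut"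
    and val: "\<And>a. a \<in> K \<Longrightarrow> a \<noteq> (\<lambda>g. 0) \<Longrightarrow> val (\<sigma> a) = \<tau> (val a)"
  shows "(\<lambda>g. monom (inverse (\<sigma> (monom 1 g) (\<tau> g))) (- \<tau> g) \<star> \<sigma> (monom 1 g)) \<in> hom add_group (one_units K)"
proof (rule homI)
  define s where "s g = \<sigma> (monom 1 g)" for g
  define x where "x g = s g (\<tau> g)" for g
  have sK: "s g \<in> K" for g
    unfolding s_def by (rule v_AutD(4)[OF \<sigma> K_monom])
  note lead = v_Aut_monom_leading[OF \<sigma> val, folded s_def]
  fix g h
  show "monom (inverse (\<sigma> (monom 1 g) (\<tau> g))) (- \<tau> g) \<star> \<sigma> (monom 1 g) \<in> carrier (one_units K)"
    unfolding one_units_iff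
  proof (intro conjI allI impI)
    show "monom (inverse (\<sigma> (monom 1 g) (\<tau> g))) (- \<tau> g) \<star> \<sigma> (monom 1 g) \<in> K"
      by (intro K_mult K_monom v_AutD(4)[OF \<sigma>])
  qed (use lead(1)[of g] lead(2)[of _ g] in \<open>simp_all add: monom_mult[of _ _ "\<sigma> _"] s_def\<close>)
  have \<tau>_add: "\<tau> (g + h) = \<tau> g + \<tau> h"
    using \<tau> by (simp add: o_Aut_iff)
  have s_mult: "s (g + h) = s g \<star> s h"
    unfolding s_def by (rule v_Aut_monom_add[OF \<sigma>])
  have x_mult: "x (g + h) = x g * x h"
    unfolding x_def s_mult \<tau>_add by (rule hahn_mult_leading(1)[OF lead(2) lead(2)])
  have "monom (inverse (x (g + h))) (- \<tau> (g + h)) \<star> s (g + h)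
      = (monom (inverse (x g)) (- \<tau> g) \<star> monom (inverse (x h)) (- \<tau> h)) \<star> (s g \<star> s h)"
    by (simp add: x_mult s_mult \<tau>_add monom_mult_monom algebra_simps)
  also have "\<dots> = (monom (inverse (x g)) (- \<tau> g) \<star> s g) \<star> (monom (inverse (x h)) (- \<tau> h) \<star> s h)"
    by (intro hahn_mult_interchange K_well_ordered K_monom sK)
  finally show "monom (inverse (\<sigma> (monom 1 (g \<otimes>\<^bsub>add_group\<^esub> h)) (\<tau> (g \<otimes>\<^bsub>add_group\<^esub> h)))) (- \<tau> (g \<otimes>\<^bsub>add_group\<^esub> h))
        \<star> \<sigma> (monom 1 (g \<otimes>\<^bsub>add_group\<^esub> h))
      = (monom (inverse (\<sigma> (monom 1 g) (\<tau> g))) (- \<tau> g) \<star> \<sigma> (monom 1 g)) \<otimes>\<^bsub>one_units K\<^esub>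
        (monom (inverse (\<sigma> (monom 1 h) (\<tau> h))) (- \<tau> h) \<star> \<sigma> (monom 1 h))"
    by (simp add: x_def s_def)
qed

text \<open>
  The one-unit parts of the images of the powers \<open>t\<^sup>g\<close> all live on one well-ordered set. Hence an
  automorphism that preserves the constants is controlled, whatever it does to infinite sums.
\<close>

lemma stabilizer_controlled:
  assumes \<sigma>: "\<sigma> \<in> carrier (v_Aut K)" and const: "\<sigma> ` constants \<subseteq> constants"
  obtains \<tau> T where "controlled \<sigma> \<tau> T"
proof -
  obtain \<tau> where \<tau>: "\<tau> \<in> carrier o_Aut" and val: "\<And>a. a \<in> K \<Longrightarrow> a \<noteq> (\<lambda>g. 0) \<Longrightarrow> val (\<sigma> a) = \<tau> (val a)"
    using v_Aut_val[OF \<sigma>] by metis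
  define w where "w g = monom (inverse (\<sigma> (monom 1 g) (\<tau> g))) (- \<tau> g) \<star> \<sigma> (monom 1 g)" for g
  have "w \<in> hom add_group (one_units K)"
    unfolding w_def by (rule one_unit_part_hom[OF \<sigma> \<tau> val])
  then obtain T where T: "well_ordered T" "\<And>g. supp (w g) \<subseteq> T"
    using hom_one_units_support by metis
  have "controlled \<sigma> \<tau> T"
    unfolding controlled_def
  proof (intro conjI ballI allI impI)
    fix c g p assume *: "\<sigma> (monom c g) p \<noteq> 0"
    have "\<sigma> (monom c 0) \<in> constants"
      using const monom_in_constants[of c] by blast
    then obtain c' where c': "\<sigma> (monom c 0) = monom c' 0"
      unfolding constants_def by (rule rangeE)
    have "\<sigma> (monom c 0 \<star> monom 1 g) = monom c' 0 \<star> \<sigma> (monom 1 g)"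
      using v_AutD(6)[OF \<sigma> K_monom K_monom] c' by simp
    moreover have "monom c 0 \<star> monom 1 g = monom c g"
      by (simp add: monom_mult_monom)
    ultimately have "\<sigma> (monom c g) p = c' * \<sigma> (monom 1 g) p"
      by (simp add: monom_mult[of c'])
    then have "w g (p - \<tau> g) \<noteq> 0"
      using * v_Aut_monom_leading(1)[OF \<sigma> val, of g] by (auto simp: w_def monom_mult[of _ _ "\<sigma> _"])
    then show "p - \<tau> g \<in> T"
      using T(2)[of g] by (auto simp: supp_def)
  qed (use v_AutD[OF \<sigma>] \<tau> T in simp_all)
  then show thesis
    by (rule that)
qed

lemma v_Aut_stab_plus_iff:
  "\<sigma> \<in> carrier (v_Aut_stab_plus K) \<longleftrightarrow> \<sigma> \<in> carrier (v_Aut K) \<and> \<sigma> ` constants = constants \<and>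
    K_summable_map K \<sigma> \<and> K_summable_map K (inv\<^bsub>v_Aut K\<^esub> \<sigma>)"
  using strongly_additive_iff by (auto simp: v_Aut_stab_plus_def)

lemma v_Aut_fix_plus_iff:
  "\<sigma> \<in> carrier (v_Aut_fix_plus K) \<longleftrightarrow> \<sigma> \<in> carrier (v_Aut_stab_plus K) \<and> (\<forall>c. \<sigma> (monom c 0) = monom c 0)"
proof -
  have "\<sigma> ` constants = constants" if "\<forall>c. \<sigma> (monom c 0) = monom c 0"
    using that by (simp add: constants_def image_image)
  then show ?thesis
    by (auto simp: v_Aut_fix_plus_def v_Aut_stab_plus_def) (auto simp: constants_def)
qed

lemma subgroup_stab_plus: "subgroup (carrier (v_Aut_stab_plus K)) (v_Aut K)"
proof (rule group.subgroupI[OF group_v_Aut])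
  interpret A: group "v_Aut K"
    by (rule group_v_Aut)
  note iff = v_Aut_stab_plus_iff
  show "carrier (v_Aut_stab_plus K) \<subseteq> carrier (v_Aut K)"
    by (auto simp: iff)
  have inv_const: "(inv\<^bsub>v_Aut K\<^esub> \<sigma>) ` constants = constants"
    if \<sigma>: "\<sigma> \<in> carrier (v_Aut K)" and c: "\<sigma> ` constants = constants" for \<sigma>
  proof -
    have "(inv\<^bsub>v_Aut K\<^esub> \<sigma>) ` \<sigma> ` constants = (\<lambda>a. a) ` constants"
      unfolding image_image by (rule image_cong[OF refl]) (simp add: v_Aut_inv_apply(1)[OF \<sigma>] constants_subset_K)
    then show ?thesis
      by (simp add: c)
  qed
  show inv: "inv\<^bsub>v_Aut K\<^esub> \<sigma> \<in> carrier (v_Aut_stab_plus K)" if "\<sigma> \<in> carrier (v_Aut_stab_plus K)" for \<sigma>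
    using that inv_const by (simp add: iff)
  have summ: "K_summable_map K (\<sigma> \<otimes>\<^bsub>v_Aut K\<^esub> \<sigma>')"
    if "\<sigma> \<in> carrier (v_Aut_stab_plus K)" "\<sigma>' \<in> carrier (v_Aut_stab_plus K)" for \<sigma> \<sigma>'
  proof -
    note \<sigma> = that(1)[unfolded iff] and \<sigma>' = that(2)[unfolded iff]
    obtain \<tau> T where T: "controlled \<sigma> \<tau> T"
      using stabilizer_controlled \<sigma> by (metis order_refl)
    obtain \<tau>' T' where T': "controlled \<sigma>' \<tau>' T'"
      using stabilizer_controlled \<sigma>' by (metis order_refl)
    show ?thesis
      by (rule controlled_compose(2)[OF T _ T']) (use \<sigma> \<sigma>' in \<open>simp_all add: v_Aut_apply\<close>)
  qed
  show "\<sigma> \<otimes>\<^bsub>v_Aut K\<^esub> \<sigma>' \<in> carrier (v_Aut_stab_plus K)"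
    if \<sigma>: "\<sigma> \<in> carrier (v_Aut_stab_plus K)" and \<sigma>': "\<sigma>' \<in> carrier (v_Aut_stab_plus K)" for \<sigma> \<sigma>'
  proof -
    note \<sigma>A = \<sigma>[unfolded iff] and \<sigma>'A = \<sigma>'[unfolded iff]
    have "(\<sigma> \<otimes>\<^bsub>v_Aut K\<^esub> \<sigma>') ` constants = \<sigma> ` \<sigma>' ` constants"
      unfolding image_image by (rule image_cong[OF refl]) (use \<sigma>A \<sigma>'A in \<open>simp add: v_Aut_apply constants_subset_K\<close>)
    moreover have "inv\<^bsub>v_Aut K\<^esub> (\<sigma> \<otimes>\<^bsub>v_Aut K\<^esub> \<sigma>') = inv\<^bsub>v_Aut K\<^esub> \<sigma>' \<otimes>\<^bsub>v_Aut K\<^esub> inv\<^bsub>v_Aut K\<^esub> \<sigma>"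
      using \<sigma>A \<sigma>'A by (intro A.inv_mult_group) auto
    ultimately show ?thesis
      unfolding iff using \<sigma>A \<sigma>'A summ[OF \<sigma> \<sigma>'] summ[OF inv[OF \<sigma>'] inv[OF \<sigma>]] by simp
  qed
  have one: "\<one>\<^bsub>v_Aut K\<^esub> ` constants = constants"
    using constants_subset_K by (force simp: v_Aut_one image_iff)
  have "K_summable_map K \<one>\<^bsub>v_Aut K\<^esub>"
    using id_K_summable K_summable_map_cong[of "\<one>\<^bsub>v_Aut K\<^esub>" "\<lambda>a. a"] by (simp add: v_Aut_one)
  then have "\<one>\<^bsub>v_Aut K\<^esub> \<in> carrier (v_Aut_stab_plus K)"
    using one by (simp add: iff)
  then show "carrier (v_Aut_stab_plus K) \<noteq> {}"
    by blast
qed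

lemma fix_const_inv:
  assumes \<sigma>: "\<sigma> \<in> carrier (v_Aut K)" "\<And>c. \<sigma> (monom c 0) = monom c 0"
  shows "(inv\<^bsub>v_Aut K\<^esub> \<sigma>) (monom c 0) = monom c 0"
  using v_Aut_inv_apply(1)[OF \<sigma>(1) K_monom[of c 0]] by (simp add: \<sigma>(2))

lemma subgroup_fix_plus: "subgroup (carrier (v_Aut_fix_plus K)) (v_Aut K)"
proof (rule group.subgroupI[OF group_v_Aut])
  interpret S: subgroup "carrier (v_Aut_stab_plus K)" "v_Aut K"
    by (rule subgroup_stab_plus)
  note iff = v_Aut_fix_plus_iff
  show "carrier (v_Aut_fix_plus K) \<subseteq> carrier (v_Aut K)"
    using S.subset by (auto simp: iff)
  have "\<one>\<^bsub>v_Aut K\<^esub> \<in> carrier (v_Aut_fix_plus K)"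
    unfolding iff using S.one_closed by (simp add: v_Aut_one)
  then show "carrier (v_Aut_fix_plus K) \<noteq> {}"
    by blast
  show "inv\<^bsub>v_Aut K\<^esub> \<sigma> \<in> carrier (v_Aut_fix_plus K)" if "\<sigma> \<in> carrier (v_Aut_fix_plus K)" for \<sigma>
    using that fix_const_inv[OF S.mem_carrier] S.m_inv_closed by (simp add: iff)
  show "\<sigma> \<otimes>\<^bsub>v_Aut K\<^esub> \<sigma>' \<in> carrier (v_Aut_fix_plus K)"
    if "\<sigma> \<in> carrier (v_Aut_fix_plus K)" "\<sigma>' \<in> carrier (v_Aut_fix_plus K)" for \<sigma> \<sigma>'
    using that S.m_closed S.mem_carrier by (simp add: iff v_Aut_apply)
qed

end

section \<open>Internal semi-direct products\<close>

text \<open>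
  The group laws are pulled back along the injection.
\<close>

lemma group_from_injection:
  assumes "group A" and hom: "f \<in> hom M A" and inj: "inj_on f (carrier M)"
    and closed: "\<And>x y. x \<in> carrier M \<Longrightarrow> y \<in> carrier M \<Longrightarrow> x \<otimes>\<^bsub>M\<^esub> y \<in> carrier M"
    and one: "\<one>\<^bsub>M\<^esub> \<in> carrier M" "f \<one>\<^bsub>M\<^esub> = \<one>\<^bsub>A\<^esub>"
    and inv: "\<And>x. x \<in> carrier M \<Longrightarrow> \<exists>y\<in>carrier M. f y = inv\<^bsub>A\<^esub> (f x)"
  shows "group M"
proof (rule groupI)
  interpret A: group A by fact
  note mult = hom_mult[OF hom] and cl = hom_in_carrier[OF hom]
  fix x y z assume xyz: "x \<in> carrier M" "y \<in> carrier M" "z \<in> carrier M"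
  show "x \<otimes>\<^bsub>M\<^esub> y \<otimes>\<^bsub>M\<^esub> z = x \<otimes>\<^bsub>M\<^esub> (y \<otimes>\<^bsub>M\<^esub> z)"
    by (rule inj_onD[OF inj]) (simp_all add: mult cl closed xyz A.m_assoc)
next
  interpret A: group A by fact
  note mult = hom_mult[OF hom] and cl = hom_in_carrier[OF hom]
  fix x assume x: "x \<in> carrier M"
  show "\<one>\<^bsub>M\<^esub> \<otimes>\<^bsub>M\<^esub> x = x"
    by (rule inj_onD[OF inj]) (simp_all add: mult cl closed x one)
  obtain y where y: "y \<in> carrier M" "f y = inv\<^bsub>A\<^esub> (f x)"
    using inv[OF x] by blast
  have "y \<otimes>\<^bsub>M\<^esub> x = \<one>\<^bsub>M\<^esub>"
    by (rule inj_onD[OF inj]) (simp_all add: mult cl closed x y one)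
  then show "\<exists>y\<in>carrier M. y \<otimes>\<^bsub>M\<^esub> x = \<one>\<^bsub>M\<^esub>"
    using y by blast
qed (rule closed one; assumption?)+

text \<open>
  Groups \<open>N\<close> and \<open>H\<close> embedded in an ambient group along \<open>j\<close> and \<open>l\<close>, such that the image of \<open>H\<close>
  normalizes that of \<open>N\<close> and meets it trivially. Injectivity of \<open>l\<close> is the instance \<open>n = \<one>\<close> of the
  last assumption.
\<close>

locale internal_semidirect =
  A: group A + N: group N + H: group H
  for A :: "('c, 'p) monoid_scheme" and N :: "('a, 'q) monoid_scheme" and H :: "('b, 'r) monoid_scheme" +
  fixes j :: "'a \<Rightarrow> 'c" and l :: "'b \<Rightarrow> 'c"
  assumes j_hom: "j \<in> hom N A" and j_inj: "inj_on j (carrier N)" and l_hom: "l \<in> hom H A"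
    and normalized: "\<And>h n. h \<in> carrier H \<Longrightarrow> n \<in> carrier N \<Longrightarrow>
      l h \<otimes>\<^bsub>A\<^esub> j n \<otimes>\<^bsub>A\<^esub> inv\<^bsub>A\<^esub> (l h) \<in> j ` carrier N"
    and trivial_intersection: "\<And>h n. h \<in> carrier H \<Longrightarrow> n \<in> carrier N \<Longrightarrow> j n = l h \<Longrightarrow> h = \<one>\<^bsub>H\<^esub>"
begin

sublocale J: group_hom N A j
  by unfold_locales (rule j_hom)

sublocale L: group_hom H A l
  by unfold_locales (rule l_hom)

abbreviation \<theta> :: "'b \<Rightarrow> 'a \<Rightarrow> 'a" where
  "\<theta> \<equiv> conj_action A N j l"

lemma action:
  assumes "h \<in> carrier H" "n \<in> carrier N"
  shows "\<theta> h n \<in> carrier N" "j (\<theta> h n) = l h \<otimes>\<^bsub>A\<^esub> j n \<otimes>\<^bsub>A\<^esub> inv\<^bsub>A\<^esub> (l h)"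
  using normalized[OF assms] assms(2)
  by (simp_all add: conj_action_def inv_into_into f_inv_into_f)

lemma action_mult:
  assumes "h \<in> carrier H" "m \<in> carrier N" "n \<in> carrier N"
  shows "\<theta> h (m \<otimes>\<^bsub>N\<^esub> n) = \<theta> h m \<otimes>\<^bsub>N\<^esub> \<theta> h n"
proof (rule inj_onD[OF j_inj])
  have "l h \<otimes>\<^bsub>A\<^esub> j m \<otimes>\<^bsub>A\<^esub> inv\<^bsub>A\<^esub> (l h) \<otimes>\<^bsub>A\<^esub> (l h \<otimes>\<^bsub>A\<^esub> j n \<otimes>\<^bsub>A\<^esub> inv\<^bsub>A\<^esub> (l h))
      = l h \<otimes>\<^bsub>A\<^esub> (j m \<otimes>\<^bsub>A\<^esub> j n) \<otimes>\<^bsub>A\<^esub> inv\<^bsub>A\<^esub> (l h)"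
    using assms by (simp add: A.m_assoc A.inv_solve_left' A.m_assoc[symmetric, of "inv\<^bsub>A\<^esub> (l h)" "l h"])
  then show "j (\<theta> h (m \<otimes>\<^bsub>N\<^esub> n)) = j (\<theta> h m \<otimes>\<^bsub>N\<^esub> \<theta> h n)"
    using assms by (simp add: action)
qed (use assms in \<open>simp_all add: action\<close>)

lemma action_compose:
  assumes "h \<in> carrier H" "h' \<in> carrier H" "n \<in> carrier N"
  shows "\<theta> (h \<otimes>\<^bsub>H\<^esub> h') n = \<theta> h (\<theta> h' n)"
  by (rule inj_onD[OF j_inj]) (use assms in \<open>simp_all add: action A.m_assoc A.inv_mult_group\<close>)

lemma action_one: "n \<in> carrier N \<Longrightarrow> \<theta> \<one>\<^bsub>H\<^esub> n = n"
  by (rule inj_onD[OF j_inj]) (simp_all add: action)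

lemma action_auto:
  assumes h: "h \<in> carrier H"
  shows "\<theta> h \<in> auto N"
proof -
  have "bij_betw (\<theta> h) (carrier N) (carrier N)"
  proof (rule bij_betw_byWitness[where f' = "\<theta> (inv\<^bsub>H\<^esub> h)"])
    show "\<forall>n\<in>carrier N. \<theta> (inv\<^bsub>H\<^esub> h) (\<theta> h n) = n" "\<forall>n\<in>carrier N. \<theta> h (\<theta> (inv\<^bsub>H\<^esub> h) n) = n"
      using h by (simp_all add: action_compose[symmetric] action_one)
  qed (use h in \<open>auto simp: action\<close>)
  moreover have "\<theta> h \<in> extensional (carrier N)"
    by (simp add: conj_action_def)
  ultimately show ?thesis
    using h by (simp add: auto_def Bij_def hom_def action action_mult)
qed

theorem action_hom: "\<theta> \<in> hom H (AutoGroup N)"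
proof (rule homI)
  fix h h' assume h: "h \<in> carrier H" "h' \<in> carrier H"
  have "\<theta> (h \<otimes>\<^bsub>H\<^esub> h') = compose (carrier N) (\<theta> h) (\<theta> h')"
    by (rule extensionalityI[of _ "carrier N"])
      (simp_all add: conj_action_def[of _ _ _ _ "h \<otimes>\<^bsub>H\<^esub> h'"] compose_eq flip: action_compose[OF h])
  then show "\<theta> (h \<otimes>\<^bsub>H\<^esub> h') = \<theta> h \<otimes>\<^bsub>AutoGroup N\<^esub> \<theta> h'"
    using action_auto[OF h(1)] action_auto[OF h(2)] by (simp add: AutoGroup_def BijGroup_def auto_def)
qed (simp add: AutoGroup_def action_auto)

definition product_map :: "'a \<times> 'b \<Rightarrow> 'c" where
  "product_map = (\<lambda>(n, h). j n \<otimes>\<^bsub>A\<^esub> l h)"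

lemma semidirect_simps:
  "carrier (semidirect N H \<theta>) = carrier N \<times> carrier H"
  "\<one>\<^bsub>semidirect N H \<theta>\<^esub> = (\<one>\<^bsub>N\<^esub>, \<one>\<^bsub>H\<^esub>)"
  "(n, h) \<otimes>\<^bsub>semidirect N H \<theta>\<^esub> (n', h') = (n \<otimes>\<^bsub>N\<^esub> \<theta> h n', h \<otimes>\<^bsub>H\<^esub> h')"
  by (simp_all add: semidirect_def)

lemma product_map_hom: "product_map \<in> hom (semidirect N H \<theta>) A"
proof (rule homI)
  fix x y assume xy: "x \<in> carrier (semidirect N H \<theta>)" "y \<in> carrier (semidirect N H \<theta>)"
  obtain n h n' h' where eq: "x = (n, h)" "y = (n', h')"
    by (cases x, cases y)
  have mem: "n \<in> carrier N" "h \<in> carrier H" "n' \<in> carrier N" "h' \<in> carrier H"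
    using xy by (simp_all add: semidirect_simps eq)
  have "j n \<otimes>\<^bsub>A\<^esub> (l h \<otimes>\<^bsub>A\<^esub> j n' \<otimes>\<^bsub>A\<^esub> inv\<^bsub>A\<^esub> (l h)) \<otimes>\<^bsub>A\<^esub> (l h \<otimes>\<^bsub>A\<^esub> l h')
      = j n \<otimes>\<^bsub>A\<^esub> l h \<otimes>\<^bsub>A\<^esub> j n' \<otimes>\<^bsub>A\<^esub> (inv\<^bsub>A\<^esub> (l h) \<otimes>\<^bsub>A\<^esub> l h) \<otimes>\<^bsub>A\<^esub> l h'"
    using mem by (simp only: A.m_assoc A.m_closed A.inv_closed J.hom_closed L.hom_closed)
  then show "product_map (x \<otimes>\<^bsub>semidirect N H \<theta>\<^esub> y) = product_map x \<otimes>\<^bsub>A\<^esub> product_map y"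
    using mem by (simp add: eq semidirect_simps product_map_def action A.m_assoc)
qed (auto simp: semidirect_simps product_map_def)

lemma product_map_inj: "inj_on product_map (carrier (semidirect N H \<theta>))"
proof (rule inj_onI)
  fix x y assume xy: "x \<in> carrier (semidirect N H \<theta>)" "y \<in> carrier (semidirect N H \<theta>)"
    and eq': "product_map x = product_map y"
  obtain n h n' h' where eq: "x = (n, h)" "y = (n', h')"
    by (cases x, cases y)
  have mem: "n \<in> carrier N" "h \<in> carrier H" "n' \<in> carrier N" "h' \<in> carrier H"
    using xy by (simp_all add: semidirect_simps eq)
  have e: "j n \<otimes>\<^bsub>A\<^esub> l h = j n' \<otimes>\<^bsub>A\<^esub> l h'"
    using eq' by (simp add: eq product_map_def)
  have "inv\<^bsub>A\<^esub> (j n') \<otimes>\<^bsub>A\<^esub> j n = inv\<^bsub>A\<^esub> (j n') \<otimes>\<^bsub>A\<^esub> (j n \<otimes>\<^bsub>A\<^esub> l h) \<otimes>\<^bsub>A\<^esub> inv\<^bsub>A\<^esub> (l h)"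
    using mem by (simp add: A.m_assoc)
  also have "\<dots> = (inv\<^bsub>A\<^esub> (j n') \<otimes>\<^bsub>A\<^esub> j n') \<otimes>\<^bsub>A\<^esub> l h' \<otimes>\<^bsub>A\<^esub> inv\<^bsub>A\<^esub> (l h)"
    unfolding e using mem by (simp only: A.m_assoc A.m_closed A.inv_closed J.hom_closed L.hom_closed)
  also have "\<dots> = l h' \<otimes>\<^bsub>A\<^esub> inv\<^bsub>A\<^esub> (l h)"
    using mem by simp
  finally have "inv\<^bsub>A\<^esub> (j n') \<otimes>\<^bsub>A\<^esub> j n = l h' \<otimes>\<^bsub>A\<^esub> inv\<^bsub>A\<^esub> (l h)" .
  moreover have "j (inv\<^bsub>N\<^esub> n' \<otimes>\<^bsub>N\<^esub> n) = inv\<^bsub>A\<^esub> (j n') \<otimes>\<^bsub>A\<^esub> j n"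
    "l (h' \<otimes>\<^bsub>H\<^esub> inv\<^bsub>H\<^esub> h) = l h' \<otimes>\<^bsub>A\<^esub> inv\<^bsub>A\<^esub> (l h)"
    using mem by (simp_all only: J.hom_mult J.hom_inv L.hom_mult L.hom_inv N.inv_closed H.inv_closed)
  ultimately have eq_jl: "j (inv\<^bsub>N\<^esub> n' \<otimes>\<^bsub>N\<^esub> n) = l (h' \<otimes>\<^bsub>H\<^esub> inv\<^bsub>H\<^esub> h)"
    by (simp only:)
  have "h' \<otimes>\<^bsub>H\<^esub> inv\<^bsub>H\<^esub> h = \<one>\<^bsub>H\<^esub>"
    by (rule trivial_intersection[OF _ _ eq_jl]) (use mem in simp_all)
  then have h: "h' = h"
    using mem by (metis H.inv_closed H.inv_equality H.inv_inv)
  then have "j n = j n'"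
    using e mem by simp
  then have "n = n'"
    using mem by (intro inj_onD[OF j_inj])
  with h show "x = y"
    by (simp add: eq)
qed

lemma product_map_image:
  assumes "\<And>n h. n \<in> carrier N \<Longrightarrow> h \<in> carrier H \<Longrightarrow> j n \<otimes>\<^bsub>A\<^esub> l h \<in> S"
    and "\<And>s. s \<in> S \<Longrightarrow> \<exists>n\<in>carrier N. \<exists>h\<in>carrier H. s = j n \<otimes>\<^bsub>A\<^esub> l h"
  shows "product_map ` carrier (semidirect N H \<theta>) = S"
  using assms unfolding semidirect_simps product_map_def by force

theorem group_semidirect: "group (semidirect N H \<theta>)"
proof (rule group_from_injection[OF A.is_group product_map_hom product_map_inj])
  fix x assume x: "x \<in> carrier (semidirect N H \<theta>)"
  obtain n h where eq: "x = (n, h)"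
    by (cases x)
  have mem: "n \<in> carrier N" "h \<in> carrier H"
    using x by (simp_all add: semidirect_simps eq)
  define y where "y = (\<theta> (inv\<^bsub>H\<^esub> h) (inv\<^bsub>N\<^esub> n), inv\<^bsub>H\<^esub> h)"
  have "y \<in> carrier (semidirect N H \<theta>)"
    using mem by (simp add: y_def semidirect_simps action)
  moreover have "product_map y = inv\<^bsub>A\<^esub> (product_map x)"
    using mem by (simp add: y_def eq product_map_def action A.m_assoc A.inv_mult_group)
  ultimately show "\<exists>y\<in>carrier (semidirect N H \<theta>). product_map y = inv\<^bsub>A\<^esub> (product_map x)"
    by blast
qed (auto simp: semidirect_simps product_map_def action)

theorem iso_semidirect:
  assumes image: "product_map ` carrier (semidirect N H \<theta>) = S"
  shows "A\<lparr>carrier := S\<rparr> \<cong> semidirect N H \<theta>"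
proof (rule group.iso_sym[OF group_semidirect])
  have "product_map \<in> iso (semidirect N H \<theta>) (A\<lparr>carrier := S\<rparr>)"
    using product_map_hom product_map_inj image
    by (auto simp: iso_def hom_def bij_betw_def)
  then show "semidirect N H \<theta> \<cong> A\<lparr>carrier := S\<rparr>"
    by (rule is_isoI)
qed

end

section \<open>Order automorphisms of the lexicographic group\<close>

lemma coords_simps [simp]:
  "coords 0 = 0" "coords (x + y) = coords x + coords y" "coords (- x) = - coords x"
  "coords (x - y) = coords x - coords y" "coords (of_coords v) = v" "of_coords (coords x) = x"
  by (simp_all add: zero_zlex_def plus_zlex_def uminus_zlex_def minus_zlex_def of_coords_inverse coords_inverse)

lemma of_coords_add: "of_coords (v + w) = of_coords v + of_coords w"
  by (simp add: plus_zlex_def)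

lemma vector_matrix_component: "(x v* A) $ j = (\<Sum>i\<in>UNIV. x $ i * A $ i $ j)" for x :: "int ^ 'n::finite"
  by (simp add: vector_matrix_mult_def mult.commute)

definition row_act :: "('n::{finite,linorder}) int_matrix \<Rightarrow> 'n zlex \<Rightarrow> 'n zlex" where
  "row_act A x = of_coords (coords x v* A)"

lemma row_act_add: "row_act A (x + y) = row_act A x + row_act A y"
  by (simp add: row_act_def vector_matrix_left_distrib of_coords_add)

lemma row_act_mult: "row_act (A ** B) x = row_act B (row_act A x)"
  by (simp add: row_act_def vector_matrix_mul_assoc)

lemma row_act_one: "row_act (mat 1) x = x"
  by (simp add: row_act_def)

lemma zlex_pos_iff: "0 < x \<longleftrightarrow> lex_pos (coords x)"
  by (simp add: less_zlex_def)

definition unit_vector :: "'n \<Rightarrow> ('n::{finite,linorder}) zlex" where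
  "unit_vector i = of_coords (axis i 1)"

lemma coords_unit_vector: "coords (unit_vector i) $ j = (if j = i then 1 else 0)"
  by (simp add: unit_vector_def axis_def)

lemma row_act_unit_vector: "coords (row_act A (unit_vector i)) $ j = A $ i $ j"
proof -
  have "(\<Sum>k\<in>UNIV. (if k = i then 1 else 0) * A $ k $ j) = (\<Sum>k\<in>UNIV. if k = i then A $ k $ j else 0)"
    by (rule sum.cong) auto
  then show ?thesis
    by (simp add: row_act_def vector_matrix_component coords_unit_vector)
qed

lemma row_act_inj:
  assumes "row_act A = row_act B" shows "A = B"
  using row_act_unit_vector[of A] row_act_unit_vector[of B] assms by (simp add: vec_eq_iff)

lemma UUT_iff: "A \<in> carrier UUT \<longleftrightarrow> (\<forall>i. A $ i $ i = 1) \<and> (\<forall>i j. j < i \<longrightarrow> A $ i $ j = 0)"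
  by (simp add: UUT_def)

text \<open>
  In the columns up to the first nonzero coordinate of a row vector, an upper triangular matrix
  meets that vector at most in a diagonal entry.
\<close>

lemma UUT_leading_coordinate:
  fixes x :: "int ^ 'n::{finite,linorder}"
  assumes A: "A \<in> carrier UUT" and x: "\<And>j. j < i \<Longrightarrow> x $ j = 0"
  shows "(x v* A) $ i = x $ i" and "\<And>j. j < i \<Longrightarrow> (x v* A) $ j = 0"
proof -
  have zero: "x $ k * A $ k $ j = 0" if "j \<le> i" "k \<noteq> j \<or> j < i" for j k
    using A x[of k] that by (cases "k < i") (auto simp: UUT_iff)
  have "(\<Sum>k\<in>UNIV. x $ k * A $ k $ i) = (\<Sum>k\<in>{i}. x $ k * A $ k $ i)"
    by (rule sum.mono_neutral_right) (use zero[of i] in auto)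
  then show "(x v* A) $ i = x $ i"
    using A by (simp add: vector_matrix_component UUT_iff)
  show "(x v* A) $ j = 0" if "j < i" for j
    unfolding vector_matrix_component using zero[of j] that by (intro sum.neutral) auto
qed

lemma row_act_pos:
  assumes A: "A \<in> carrier UUT" and "0 < x"
  shows "0 < row_act A x"
proof -
  obtain i where "coords x $ i > 0" "\<And>j. j < i \<Longrightarrow> coords x $ j = 0"
    using assms(2) by (auto simp: zlex_pos_iff lex_pos_def)
  then have "(coords x v* A) $ i > 0" "\<forall>j<i. (coords x v* A) $ j = 0"
    using UUT_leading_coordinate[OF A] by simp_all
  then show ?thesis
    by (auto simp: zlex_pos_iff lex_pos_def row_act_def)
qed

lemma row_act_strict_mono:
  assumes "A \<in> carrier UUT"
  shows "strict_mono (row_act A)"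
proof (rule strict_monoI)
  fix x y :: "'a zlex" assume "x < y"
  then have "0 < row_act A (y - x)"
    by (intro row_act_pos[OF assms]) simp
  also have "row_act A (y - x) = row_act A y - row_act A x"
    using row_act_add[of A "y - x" x] by simp
  finally show "row_act A x < row_act A y"
    by simp
qed

text \<open>Forward substitution, clearing one leading coordinate after the other.\<close>

lemma row_act_surj:
  assumes A: "A \<in> carrier UUT"
  shows "\<exists>x. row_act A x = y"
proof (induction "card {j. \<exists>i\<le>j. coords y $ i \<noteq> 0}" arbitrary: y rule: less_induct)
  case less
  show ?case
  proof (cases "y = 0")
    case True
    have "row_act A 0 = 0"
      using row_act_add[of A 0 0] by simp
    with True show ?thesis by blast
  next
    case False
    then have "{i. coords y $ i \<noteq> 0} \<noteq> {}"
      by (metis (mono_tags, lifting) coords_simps(1,6) empty_Collect_eq vec_eq_iff zero_index)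
    then obtain m where m: "coords y $ m \<noteq> 0" "\<And>j. coords y $ j \<noteq> 0 \<Longrightarrow> m \<le> j"
      using Min_in[of "{i. coords y $ i \<noteq> 0}"] Min_le[of "{i. coords y $ i \<noteq> 0}"] by auto
    define z where "z = of_coords (coords y $ m *s axis m 1)"
    have z: "coords z $ j = (if j = m then coords y $ m else 0)" for j
      by (simp add: z_def axis_def)
    define y' where "y' = y - row_act A z"
    have z_low: "coords z $ j = 0" if "j < m" for j
      using that by (auto simp: z)
    have "coords (row_act A z) $ m = coords y $ m" "\<And>j. j < m \<Longrightarrow> coords (row_act A z) $ j = 0"
      using UUT_leading_coordinate[OF A z_low] by (simp_all add: row_act_def z)
    then have y': "coords y' $ j = 0" if "j \<le> m" for j
      using that m(2)[of j] by (cases "j = m") (auto simp: y'_def)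
    have "{j. \<exists>i\<le>j. coords y' $ i \<noteq> 0} \<subset> {j. \<exists>i\<le>j. coords y $ i \<noteq> 0}"
    proof
      show "{j. \<exists>i\<le>j. coords y' $ i \<noteq> 0} \<subseteq> {j. \<exists>i\<le>j. coords y $ i \<noteq> 0}"
      proof
        fix j assume "j \<in> {j. \<exists>i\<le>j. coords y' $ i \<noteq> 0}"
        then obtain i where i: "i \<le> j" "coords y' $ i \<noteq> 0"
          by blast
        then have "m \<le> j"
          using y'[of i] by (metis linear order_trans)
        then show "j \<in> {j. \<exists>i\<le>j. coords y $ i \<noteq> 0}"
          using m(1) by blast
      qed
      have "m \<in> {j. \<exists>i\<le>j. coords y $ i \<noteq> 0}" "m \<notin> {j. \<exists>i\<le>j. coords y' $ i \<noteq> 0}"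
        using m(1) y' by auto
      then show "{j. \<exists>i\<le>j. coords y' $ i \<noteq> 0} \<noteq> {j. \<exists>i\<le>j. coords y $ i \<noteq> 0}"
        by blast
    qed
    then have "card {j. \<exists>i\<le>j. coords y' $ i \<noteq> 0} < card {j. \<exists>i\<le>j. coords y $ i \<noteq> 0}"
      by (intro psubset_card_mono) simp_all
    then obtain x where "row_act A x = y'"
      using less.hyps by blast
    then have "row_act A (x + z) = y"
      by (simp add: row_act_add y'_def)
    then show ?thesis by blast
  qed
qed

lemma row_act_o_Aut:
  assumes "A \<in> carrier UUT"
  shows "row_act A \<in> carrier o_Aut"
proof -
  have "surj (row_act A)"
    using row_act_surj[OF assms] by (metis surjI)
  then show ?thesis
    using row_act_strict_mono[OF assms]
    by (simp add: o_Aut_iff row_act_add bij_def strict_mono_imp_inj_on)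
qed

definition zlex_matrix :: "('n::{finite,linorder} zlex \<Rightarrow> 'n zlex) \<Rightarrow> 'n int_matrix" where
  "zlex_matrix f = (\<chi> i j. coords (f (unit_vector i)) $ j)"

lemma additive_scale:
  fixes f :: "'n::{finite,linorder} zlex \<Rightarrow> 'm::{finite,linorder} zlex"
  assumes add: "\<And>x y. f (x + y) = f x + f y"
  shows "coords (f (of_coords (m *s v))) = m *s coords (f (of_coords v))"
proof -
  have zero: "f 0 = 0"
    using add[of 0 0] by simp
  have nat: "coords (f (of_coords (int k *s v))) = int k *s coords (f (of_coords v))" for k v
  proof (induction k)
    case 0
    have "of_coords 0 = (0 :: 'n zlex)"
      by (simp add: zero_zlex_def)
    then show ?case by (simp add: zero)
  next
    case (Suc k)
    have split: "int (Suc k) *s w = int k *s w + w" for w :: "int ^ 'l::finite"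
      by (simp add: vec_eq_iff algebra_simps)
    show ?case
      by (simp only: split of_coords_add add coords_simps Suc)
  qed
  have neg: "f (- x) = - f x" for x
    using add[of "- x" x] by (simp add: zero eq_neg_iff_add_eq_0)
  show ?thesis
  proof (cases "m \<ge> 0")
    case True
    then show ?thesis
      using nat[of "nat m" v] by simp
  next
    case False
    then have flip: "m *s w = - (int (nat (- m)) *s w)" for w :: "int ^ 'l::finite"
      by (simp add: vec_eq_iff)
    have "of_coords (m *s v) = - of_coords (int (nat (- m)) *s v)"
      unfolding flip by (simp only: uminus_zlex_def coords_simps)
    then show ?thesis
      by (simp only: neg coords_simps nat flip)
  qed
qed

lemma additive_eq_row_act:
  assumes add: "\<And>x y. f (x + y) = f x + f y"
  shows "f = row_act (zlex_matrix f)"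
proof
  fix x
  have zero: "f 0 = 0"
    using add[of 0 0] by simp
  have "coords (f (of_coords (\<Sum>i\<in>S. c i *s axis i 1))) = (\<Sum>i\<in>S. c i *s coords (f (unit_vector i)))"
    if "finite S" for S and c :: "'a \<Rightarrow> int"
    using that
  proof (induction S rule: finite_induct)
    case empty
    then show ?case by (simp add: zero_zlex_def[symmetric] zero)
  next
    case (insert i S)
    then show ?case
      by (simp add: of_coords_add add additive_scale[of f, OF add] unit_vector_def)
  qed
  from this[of UNIV "\<lambda>i. coords x $ i"]
  have "coords (f x) = (\<Sum>i\<in>UNIV. coords x $ i *s coords (f (unit_vector i)))"
    by (simp add: basis_expansion)
  also have "\<dots> = coords x v* zlex_matrix f"
    by (simp add: vec_eq_iff vector_matrix_component zlex_matrix_def)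
  finally show "f x = row_act (zlex_matrix f) x"
    by (metis coords_simps(6) row_act_def)
qed

text \<open>
  A first point moved down would be moved down further by its own image, and dually.
\<close>

lemma strict_mono_finite_id:
  fixes f :: "'n::{finite,linorder} \<Rightarrow> 'n"
  assumes "strict_mono f"
  shows "f i = i"
proof -
  have "f ` UNIV = UNIV"
    by (rule finite_UNIV_inj_surj) (simp_all add: strict_mono_imp_inj_on assms)
  have ge: "i \<le> f i" for i
  proof (rule ccontr)
    assume "\<not> i \<le> f i"
    then have "i \<in> {i. f i < i}"
      by simp
    then have ne: "{i. f i < i} \<noteq> {}"
      by blast
    define m where "m = Min {i. f i < i}"
    have "f m < m"
      using Min_in[OF _ ne] by (simp add: m_def)
    then have "f (f m) < f m"
      using assms by (simp add: strict_mono_less)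
    then have "m \<le> f m"
      unfolding m_def by (intro Min_le) auto
    with \<open>f m < m\<close> show False by simp
  qed
  have le: "f i \<le> i" for i
  proof (rule ccontr)
    assume "\<not> f i \<le> i"
    then have "i \<in> {i. i < f i}"
      by simp
    then have ne: "{i. i < f i} \<noteq> {}"
      by blast
    define m where "m = Max {i. i < f i}"
    have "m < f m"
      using Max_in[OF _ ne] by (simp add: m_def)
    then have "f m < f (f m)"
      using assms by (simp add: strict_mono_less)
    then have "f m \<le> m"
      unfolding m_def by (intro Max_ge) auto
    with \<open>m < f m\<close> show False by simp
  qed
  show ?thesis
    using ge le by (simp add: antisym)
qed

definition multiple :: "nat \<Rightarrow> 'g::ab_group_add \<Rightarrow> 'g" where
  "multiple k x = ((+) x ^^ k) 0"

lemma multiple_simps [simp]: "multiple 0 x = 0" "multiple (Suc k) x = x + multiple k x"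
  by (simp_all add: multiple_def)

lemma coords_multiple: "coords (multiple k x) $ i = int k * coords x $ i"
  by (induction k) (simp_all add: algebra_simps)

lemma o_Aut_multiple:
  assumes "\<tau> \<in> carrier o_Aut"
  shows "\<tau> (multiple k x) = multiple k (\<tau> x)"
  using assms by (induction k) (auto simp: o_Aut_zero o_Aut_iff)

definition lead :: "('n::{finite,linorder}) zlex \<Rightarrow> 'n" where
  "lead x = Min {i. coords x $ i \<noteq> 0}"

lemma lead_props:
  assumes "0 < x"
  shows "coords x $ lead x > 0" "\<And>j. j < lead x \<Longrightarrow> coords x $ j = 0"
proof -
  obtain i where i: "coords x $ i > 0" "\<And>j. j < i \<Longrightarrow> coords x $ j = 0"
    using assms by (auto simp: zlex_pos_iff lex_pos_def)
  have "lead x = i"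
    unfolding lead_def by (rule Min_eqI) (use i in \<open>auto simp: not_less[symmetric]\<close>)
  with i show "coords x $ lead x > 0" "\<And>j. j < lead x \<Longrightarrow> coords x $ j = 0"
    by auto
qed

text \<open>
  The right-hand side says that \<open>y\<close> is infinitely smaller than \<open>x\<close>. It only mentions the group structure
  and the order, so every order automorphism preserves it.
\<close>

lemma lead_less_iff:
  assumes x: "0 < x" and y: "0 < y"
  shows "lead x < lead y \<longleftrightarrow> (\<forall>k. multiple k y < x)"
proof
  assume less: "lead x < lead y"
  show "\<forall>k. multiple k y < x"
  proof
    fix k
    have "coords (x - multiple k y) $ lead x > 0" "\<forall>j<lead x. coords (x - multiple k y) $ j = 0"
      using lead_props[OF x] lead_props(2)[OF y] less by (auto simp: coords_multiple)
    then have "lex_pos (coords (x - multiple k y))"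
      unfolding lex_pos_def by blast
    then show "multiple k y < x"
      by (simp add: less_zlex_def)
  qed
next
  assume all: "\<forall>k. multiple k y < x"
  show "lead x < lead y"
  proof (rule ccontr)
    assume "\<not> lead x < lead y"
    then have le: "lead y \<le> lead x"
      by simp
    \<comment> \<open>a multiple of \<open>y\<close> exceeding \<open>x\<close> at the leading position of \<open>y\<close>\<close>
    define k where "k = nat (coords x $ lead y + 1)"
    have pos: "coords y $ lead y \<ge> 1"
      using lead_props(1)[OF y] by simp
    have "coords x $ lead y \<ge> 0"
      using lead_props[OF x] le by (cases "lead y = lead x") (auto intro: less_imp_le)
    then have k: "int k = coords x $ lead y + 1"
      by (simp add: k_def)
    have "int k * 1 \<le> int k * coords y $ lead y"
      using pos by (intro mult_left_mono) auto
    then have "coords (multiple k y - x) $ lead y > 0"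
      using k by (simp add: coords_multiple)
    moreover have "\<forall>j<lead y. coords (multiple k y - x) $ j = 0"
      using lead_props(2)[OF x] lead_props(2)[OF y] le by (auto simp: coords_multiple)
    ultimately have "lex_pos (coords (multiple k y - x))"
      unfolding lex_pos_def by blast
    then have "x < multiple k y"
      by (simp add: less_zlex_def)
    with all show False
      by (metis less_asym)
  qed
qed

lemma unit_vector_pos: "0 < unit_vector i"
  unfolding zlex_pos_iff lex_pos_def by (rule exI[of _ i]) (auto simp: coords_unit_vector)

lemma lead_unit_vector: "lead (unit_vector i) = i"
  unfolding lead_def by (rule Min_eqI) (auto simp: coords_unit_vector split: if_splits)

text \<open>
  The positions of the leading coordinates of the images of the unit vectors increase strictly; on a
  finite order this forces them to stay in place.
\<close>

lemma o_Aut_lead: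
  assumes \<tau>: "\<tau> \<in> carrier o_Aut"
  shows "lead (\<tau> (unit_vector i)) = i" and "0 < \<tau> (unit_vector i)"
proof -
  have less: "\<tau> x < \<tau> y \<longleftrightarrow> x < y" for x y
    using \<tau> by (simp add: o_Aut_iff strict_mono_less)
  show pos: "0 < \<tau> (unit_vector i)" for i
    using less[of 0 "unit_vector i"] by (simp add: o_Aut_zero[OF \<tau>] unit_vector_pos)
  have "strict_mono (\<lambda>i. lead (\<tau> (unit_vector i)))"
  proof (rule strict_monoI)
    fix i j :: 'a assume "i < j"
    then have "\<forall>k. multiple k (unit_vector j) < (unit_vector i :: 'a zlex)"
      using lead_less_iff[OF unit_vector_pos unit_vector_pos] by (metis lead_unit_vector)
    then have "\<forall>k. multiple k (\<tau> (unit_vector j)) < \<tau> (unit_vector i)"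
      by (simp add: o_Aut_multiple[OF \<tau>, symmetric] less)
    then show "lead (\<tau> (unit_vector i)) < lead (\<tau> (unit_vector j))"
      using lead_less_iff[OF pos pos] by blast
  qed
  from strict_mono_finite_id[OF this] show "lead (\<tau> (unit_vector i)) = i" .
qed

text \<open>
  The leading coordinates give the triangular shape. The diagonal entries are positive integers, and so
  are those of the inverse.
\<close>

lemma o_Aut_eq_row_act:
  assumes \<tau>: "\<tau> \<in> carrier o_Aut"
  shows "zlex_matrix \<tau> \<in> carrier UUT" and "\<tau> = row_act (zlex_matrix \<tau>)"
proof -
  have repr: "\<tau> = row_act (zlex_matrix \<tau>)" if "\<tau> \<in> carrier o_Aut" for \<tau> :: "'a zlex \<Rightarrow> 'a zlex"
    by (rule additive_eq_row_act) (use that in \<open>simp add: o_Aut_iff\<close>)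
  then show "\<tau> = row_act (zlex_matrix \<tau>)"
    using \<tau> .
  have upper: "zlex_matrix \<tau> $ i $ j = 0" if "\<tau> \<in> carrier o_Aut" "j < i"
    for \<tau> :: "'a zlex \<Rightarrow> 'a zlex" and i j
    using lead_props(2)[OF o_Aut_lead(2)[OF that(1)], of j i] o_Aut_lead(1)[OF that(1), of i] that(2)
    by (simp add: zlex_matrix_def)
  have diag: "zlex_matrix \<tau> $ i $ i > 0" if "\<tau> \<in> carrier o_Aut" for \<tau> :: "'a zlex \<Rightarrow> 'a zlex" and i
    using lead_props(1)[OF o_Aut_lead(2)[OF that], of i] o_Aut_lead(1)[OF that, of i]
    by (simp add: zlex_matrix_def)
  define \<tau>' where "\<tau>' = inv_into UNIV \<tau>"
  have \<tau>': "\<tau>' \<in> carrier o_Aut" "\<And>x. \<tau>' (\<tau> x) = x"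
    using o_Aut_inv_into[OF \<tau>] by (simp_all add: \<tau>'_def)
  \<comment> \<open>positive integers on the diagonals of two inverse triangular matrices equal \<open>1\<close>\<close>
  have "row_act (zlex_matrix \<tau> ** zlex_matrix \<tau>') = row_act (mat 1)"
    using repr[OF \<tau>] repr[OF \<tau>'(1)] \<tau>'(2) by (metis ext row_act_mult row_act_one)
  then have prod: "zlex_matrix \<tau> ** zlex_matrix \<tau>' = mat 1"
    by (rule row_act_inj)
  have "zlex_matrix \<tau> $ i $ i = 1" for i
  proof -
    have "(zlex_matrix \<tau> ** zlex_matrix \<tau>') $ i $ i = (\<Sum>k\<in>UNIV. zlex_matrix \<tau> $ i $ k * zlex_matrix \<tau>' $ k $ i)"
      by (simp add: matrix_matrix_mult_def)
    also have "\<dots> = (\<Sum>k\<in>{i}. zlex_matrix \<tau> $ i $ k * zlex_matrix \<tau>' $ k $ i)"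
    proof (rule sum.mono_neutral_right)
      show "\<forall>k\<in>UNIV - {i}. zlex_matrix \<tau> $ i $ k * zlex_matrix \<tau>' $ k $ i = 0"
        using upper[OF \<tau>] upper[OF \<tau>'(1)] by (metis DiffD2 insertI1 mult_eq_0_iff neqE)
    qed auto
    finally have "zlex_matrix \<tau> $ i $ i * zlex_matrix \<tau>' $ i $ i = 1"
      unfolding prod by (simp add: mat_def)
    then show ?thesis
      using diag[OF \<tau>, of i] by (simp add: zmult_eq_1_iff)
  qed
  then show "zlex_matrix \<tau> \<in> carrier UUT"
    using upper[OF \<tau>] by (simp add: UUT_iff)
qed

text \<open>
  The inverse is the matrix of the inverse order automorphism, so it is uni-triangular again.
\<close>

lemma UUT_inverse:
  assumes A: "A \<in> carrier UUT"
  shows "matrix_inv A \<in> carrier UUT" "A ** matrix_inv A = mat 1" "matrix_inv A ** A = mat 1"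
proof -
  note o = o_Aut_inv_into[OF row_act_o_Aut[OF A]]
  define B where "B = zlex_matrix (inv_into UNIV (row_act A))"
  have B: "B \<in> carrier UUT" "inv_into UNIV (row_act A) = row_act B"
    unfolding B_def using o_Aut_eq_row_act[OF o(1)] by simp_all
  have AB: "A ** B = mat 1" "B ** A = mat 1"
    by (rule row_act_inj; rule ext; use o(2,3) B(2) in \<open>simp add: row_act_mult row_act_one\<close>)+
  then have inv: "A ** matrix_inv A = mat 1 \<and> matrix_inv A ** A = mat 1"
    unfolding matrix_inv_def by (intro someI[of "\<lambda>A'. A ** A' = mat 1 \<and> A' ** A = mat 1" B]) simp
  then show "A ** matrix_inv A = mat 1" "matrix_inv A ** A = mat 1"
    by simp_all
  have "matrix_inv A = B"
    using AB inv by (metis matrix_mul_assoc matrix_mul_lid matrix_mul_rid)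
  with B show "matrix_inv A \<in> carrier UUT"
    by simp
qed

lemma UUT_mult:
  assumes "A \<in> carrier UUT" "B \<in> carrier UUT"
  shows "A ** B \<in> carrier UUT"
proof -
  define \<tau> where "\<tau> = row_act (A ** B)"
  have "\<tau> = row_act B \<circ> row_act A"
    by (simp add: \<tau>_def fun_eq_iff row_act_mult)
  then have "\<tau> \<in> carrier o_Aut"
    using row_act_o_Aut[OF assms(1)] row_act_o_Aut[OF assms(2)]
    by (auto simp: o_Aut_iff bij_comp strict_mono_def)
  from o_Aut_eq_row_act[OF this] have "zlex_matrix \<tau> \<in> carrier UUT" "row_act (A ** B) = row_act (zlex_matrix \<tau>)"
    by (simp_all add: \<tau>_def)
  then show ?thesis
    using row_act_inj by metis
qed

lemma group_o_Aut: "group (o_Aut :: ('g::linordered_ab_group_add \<Rightarrow> 'g) monoid)"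
proof (rule groupI)
  fix \<tau> :: "'g \<Rightarrow> 'g" assume \<tau>: "\<tau> \<in> carrier o_Aut"
  show "\<exists>\<tau>'\<in>carrier o_Aut. \<tau>' \<otimes>\<^bsub>o_Aut\<^esub> \<tau> = \<one>\<^bsub>o_Aut\<^esub>"
    by (rule bexI[OF _ o_Aut_inv_into(1)[OF \<tau>]]) (simp add: o_Aut_def o_Aut_inv_into(3)[OF \<tau>] fun_eq_iff)
qed (auto simp: o_Aut_def bij_comp strict_mono_def)

lemma UUT_simps [simp]: "A \<otimes>\<^bsub>UUT\<^esub> B = A ** B" "\<one>\<^bsub>UUT\<^esub> = mat 1"
  by (simp_all add: UUT_def)

lemma o_Aut_simps [simp]: "\<sigma> \<otimes>\<^bsub>o_Aut\<^esub> \<tau> = \<sigma> \<circ> \<tau>" "\<one>\<^bsub>o_Aut\<^esub> = id"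
  by (simp_all add: o_Aut_def)

lemma UUT_act_eq: "UUT_act A = row_act (matrix_inv A)"
  by (simp add: fun_eq_iff UUT_act_def row_act_def)

lemma UUT_act_hom: "UUT_act \<in> hom (UUT :: 'n::{finite,linorder} int_matrix monoid) o_Aut"
proof (rule homI)
  fix A B :: "'n int_matrix" assume AB: "A \<in> carrier UUT" "B \<in> carrier UUT"
  have "(A ** B) ** (matrix_inv B ** matrix_inv A) = A ** (B ** matrix_inv B) ** matrix_inv A"
    by (simp only: matrix_mul_assoc)
  then have "(A ** B) ** (matrix_inv B ** matrix_inv A) = mat 1"
    by (simp add: UUT_inverse(2)[OF AB(1)] UUT_inverse(2)[OF AB(2)])
  then have "matrix_inv (A ** B) = matrix_inv B ** matrix_inv A"
    using UUT_inverse(3)[OF UUT_mult[OF AB]] by (metis matrix_mul_assoc matrix_mul_lid matrix_mul_rid)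
  then show "UUT_act (A \<otimes>\<^bsub>UUT\<^esub> B) = UUT_act A \<otimes>\<^bsub>o_Aut\<^esub> UUT_act B"
    by (simp add: fun_eq_iff UUT_act_eq row_act_mult)
qed (simp add: UUT_act_eq row_act_o_Aut UUT_inverse(1))

lemma UUT_act_inj: "inj_on UUT_act (carrier UUT)"
proof (rule inj_onI)
  fix A B :: "'a int_matrix" assume AB: "A \<in> carrier UUT" "B \<in> carrier UUT" "UUT_act A = UUT_act B"
  then have "matrix_inv A = matrix_inv B"
    by (intro row_act_inj) (simp add: UUT_act_eq)
  then show "A = B"
    using UUT_inverse(2)[OF AB(1)] UUT_inverse(3)[OF AB(2)]
    by (metis matrix_mul_assoc matrix_mul_lid matrix_mul_rid)
qed

lemma UUT_act_surj:
  assumes \<tau>: "\<tau> \<in> carrier o_Aut"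
  shows "\<exists>A\<in>carrier UUT. UUT_act A = \<tau>"
proof (rule bexI)
  define M where "M = zlex_matrix \<tau>"
  have M: "M \<in> carrier UUT" "\<tau> = row_act M"
    unfolding M_def using o_Aut_eq_row_act[OF \<tau>] by simp_all
  note A = UUT_inverse[OF M(1)]
  have inv_inv: "matrix_inv (matrix_inv M) = M"
    using UUT_inverse(2)[OF A(1)] A(2) by (metis matrix_mul_assoc matrix_mul_lid matrix_mul_rid)
  show "UUT_act (matrix_inv (zlex_matrix \<tau>)) = \<tau>"
    by (simp only: UUT_act_eq M_def[symmetric] inv_inv M(2)[symmetric])
  show "matrix_inv (zlex_matrix \<tau>) \<in> carrier UUT"
    using A(1) by (simp add: M_def)
qed

lemma group_UUT: "group (UUT :: 'n::{finite,linorder} int_matrix monoid)"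
proof (rule group_from_injection[OF group_o_Aut UUT_act_hom UUT_act_inj])
  interpret O: group "o_Aut :: ('n zlex \<Rightarrow> 'n zlex) monoid"
    by (rule group_o_Aut)
  show one: "\<one>\<^bsub>UUT\<^esub> \<in> carrier (UUT :: 'n int_matrix monoid)"
    by (simp add: UUT_iff mat_def)
  show "UUT_act \<one>\<^bsub>UUT\<^esub> = (\<one>\<^bsub>o_Aut\<^esub> :: 'n zlex \<Rightarrow> 'n zlex)"
    using UUT_inverse(3)[OF one] by (simp add: UUT_act_eq fun_eq_iff row_act_one)
  fix A :: "'n int_matrix" assume "A \<in> carrier UUT"
  then have "inv\<^bsub>o_Aut\<^esub> (UUT_act A) \<in> carrier o_Aut"
    using hom_in_carrier[OF UUT_act_hom] by (intro O.inv_closed)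
  then show "\<exists>B\<in>carrier UUT. UUT_act B = inv\<^bsub>o_Aut\<^esub> (UUT_act A)"
    by (rule UUT_act_surj)
qed (simp add: UUT_mult)

section \<open>Homomorphisms from the lattice to the multiplicative group of the field\<close>

lemma field_units_simps [simp]:
  "x \<in> carrier field_units \<longleftrightarrow> x \<noteq> 0" "x \<otimes>\<^bsub>field_units\<^esub> y = x * y" "\<one>\<^bsub>field_units\<^esub> = 1"
  by (simp_all add: field_units_def)

lemma group_field_units: "group (field_units :: 'k::field monoid)"
proof (rule groupI)
  fix x :: 'k assume "x \<in> carrier field_units"
  then show "\<exists>y\<in>carrier field_units. y \<otimes>\<^bsub>field_units\<^esub> x = \<one>\<^bsub>field_units\<^esub>"
    by (intro bexI[of _ "inverse x"]) simp_all
qed (simp_all add: mult.assoc)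

lemma field_units_power_simps [simp]:
  "x \<in> carrier field_units_power \<longleftrightarrow> (\<forall>i. x i \<noteq> 0)"
  "x \<otimes>\<^bsub>field_units_power\<^esub> y = (\<lambda>i. x i * y i)" "\<one>\<^bsub>field_units_power\<^esub> = (\<lambda>i. 1)"
  by (auto simp: field_units_power_def PiE_iff)

lemma group_field_units_power: "group (field_units_power :: ('n \<Rightarrow> 'k::field) monoid)"
  unfolding field_units_power_def by (rule product_group) (rule group_field_units)

lemma hom_field_units_iff:
  "x \<in> hom add_group field_units \<longleftrightarrow> (\<forall>g. x g \<noteq> 0) \<and> (\<forall>g h. x (g + h) = x g * x h)"
  by (auto simp: hom_def)

lemma hom_field_units_zero:
  fixes x :: "'g::ab_group_add \<Rightarrow> 'k::field"
  assumes "x \<in> hom add_group field_units"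
  shows "x 0 = 1"
  using hom_one[OF assms group_add_group group_field_units] by simp

lemma int_matrix_left_inverse:
  fixes A B :: "int ^ 'n::finite ^ 'n"
  assumes "A ** B = mat 1"
  shows "B ** A = mat 1"
proof -
  define R where "R M = (\<chi> i j. real_of_int (M $ i $ j))" for M :: "int ^ 'n ^ 'n"
  have mult: "R (M ** M') = R M ** R M'" for M M'
    by (simp add: R_def matrix_matrix_mult_def vec_eq_iff)
  have one: "R (mat 1) = mat 1"
    by (simp add: R_def mat_def vec_eq_iff)
  have inj: "M = M'" if "R M = R M'" for M M'
    using that by (simp add: R_def vec_eq_iff)
  have "R A ** R B = mat 1"
    by (simp add: mult[symmetric] assms one)
  then have "R (B ** A) = R (mat 1)"
    by (simp add: mult one matrix_left_right_inverse)
  then show ?thesis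
    by (rule inj)
qed

text \<open>
  As many generators as coordinates form a basis: the matrix of the generators has a left
  inverse, hence it is invertible.
\<close>

lemma generators_coordinates:
  fixes e :: "'n::{finite,linorder} \<Rightarrow> 'n zlex"
  assumes gen: "generate add_group (range e) = UNIV"
  obtains B where "\<And>i. row_act B (e i) = unit_vector i"
proof -
  define M where "M = (\<chi> i. coords (e i))"
  have e: "row_act M (unit_vector i) = e i" for i
  proof -
    have "coords (row_act M (unit_vector i)) = coords (e i)"
      by (simp add: vec_eq_iff row_act_unit_vector M_def)
    then show ?thesis
      by (simp only: coords_inject)
  qed
  have "\<exists>x. row_act M x = g" if "g \<in> generate add_group (range e)" for g
    using that
  proof (induction rule: generate.induct)
    case one
    have "row_act M 0 = 0"
      using row_act_add[of M 0 0] by simp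
    then show ?case
      by auto
  next
    case (incl h)
    then show ?case
      using e by blast
  next
    case (inv h)
    then obtain i where "row_act M (unit_vector i) = h"
      using e by blast
    then have "row_act M (- unit_vector i) = - h"
      using row_act_add[of M "- unit_vector i" "unit_vector i"] row_act_add[of M 0 0]
      by (simp add: eq_neg_iff_add_eq_0)
    then show ?case
      by auto
  next
    case (eng h1 h2)
    then obtain x y where "row_act M x = h1" "row_act M y = h2"
      by blast
    then have "row_act M (x + y) = h1 + h2"
      by (simp add: row_act_add)
    then show ?case
      by auto
  qed
  then have "\<forall>i. \<exists>x. row_act M x = unit_vector i"
    by (simp add: gen)
  then obtain b where b: "\<And>i. row_act M (b i) = unit_vector i"
    by metis
  define B where "B = (\<chi> i. coords (b i))"
  have B: "row_act B (unit_vector i) = b i" for i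
  proof -
    have "coords (row_act B (unit_vector i)) = coords (b i)"
      by (simp add: vec_eq_iff row_act_unit_vector B_def)
    then show ?thesis
      by (simp only: coords_inject)
  qed
  have "(B ** M) $ i $ j = mat 1 $ i $ j" for i j
    using row_act_unit_vector[of "B ** M" i j]
    by (cases "i = j") (simp_all add: row_act_mult B b coords_unit_vector mat_def)
  then have "B ** M = mat 1"
    by (simp add: vec_eq_iff)
  then have "M ** B = mat 1"
    by (rule int_matrix_left_inverse)
  then have "row_act B (e i) = unit_vector i" for i
    using row_act_mult[of M B "unit_vector i"] by (simp add: e row_act_one)
  then show thesis
    by (rule that)
qed

lemma at_gens_field_units_surj:
  fixes e :: "'n::{finite,linorder} \<Rightarrow> 'n zlex" and x :: "'n \<Rightarrow> 'k::field"
  assumes gen: "generate add_group (range e) = UNIV" and x: "\<And>i. x i \<noteq> 0"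
  obtains X where "X \<in> hom add_group field_units" "at_gens e X = x"
proof -
  obtain B where B: "\<And>i. row_act B (e i) = unit_vector i"
    using generators_coordinates[OF gen] by metis
  define X where "X g = (\<Prod>i\<in>UNIV. x i powi (coords (row_act B g) $ i))" for g
  have "X \<in> hom add_group field_units"
    unfolding hom_field_units_iff
  proof (intro conjI allI)
    show "X g \<noteq> 0" for g
      by (simp add: X_def x)
    show "X (g + h) = X g * X h" for g h
      by (simp add: X_def row_act_add power_int_add x prod.distrib)
  qed
  moreover have "X (e j) = x j" for j
  proof -
    have "X (e j) = (\<Prod>i\<in>UNIV. if i = j then x i else 1)"
      unfolding X_def by (rule prod.cong) (simp_all add: B coords_unit_vector)
    then show ?thesis
      by simp
  qed
  then have "at_gens e X = x"
    by (simp add: at_gens_def fun_eq_iff)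
  ultimately show thesis
    by (rule that)
qed

locale lex_hahn_subfield = generated_hahn_subfield K e
  for K :: "('n::{finite,linorder} zlex \<Rightarrow> 'k::field) set" and e :: "'n \<Rightarrow> 'n zlex" +
  assumes second: "canonical_second_lifting_property K"
begin

sublocale A: group "v_Aut K"
  by (rule group_v_Aut)

sublocale Stab: subgroup "carrier (v_Aut_stab_plus K)" "v_Aut K"
  by (rule subgroup_stab_plus)

sublocale Fix: subgroup "carrier (v_Aut_fix_plus K)" "v_Aut K"
  by (rule subgroup_fix_plus)

text \<open>As rewrite rules these would run in a circle with the characterizations of the carriers.\<close>

declare Stab.mem_carrier [simp del] Fix.mem_carrier [simp del]

lemma fix_plus_stab_plus: "\<sigma> \<in> carrier (v_Aut_fix_plus K) \<Longrightarrow> \<sigma> \<in> carrier (v_Aut_stab_plus K)"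
  by (simp add: v_Aut_fix_plus_iff)

lemma fix_plus_monom:
  assumes "\<sigma> \<in> carrier (v_Aut_fix_plus K)"
  shows "\<sigma> (monom c g) p = c * \<sigma> (monom 1 g) p"
proof -
  have "\<sigma> (monom c 0 \<star> monom 1 g) = \<sigma> (monom c 0) \<star> \<sigma> (monom 1 g)"
    by (rule v_AutD(6)[OF Fix.mem_carrier[OF assms] K_monom K_monom])
  also have "\<sigma> (monom c 0) = monom c 0"
    using assms by (simp add: v_Aut_fix_plus_iff)
  finally show ?thesis
    by (simp only: monom_mult_monom) (simp add: monom_mult)
qed

subsection \<open>Rescaling automorphisms\<close>

lemma rho_v_Aut:
  assumes "x \<in> hom add_group field_units"
  shows "rho K x \<in> carrier (v_Aut K)"
proof -
  have "rho K x \<in> carrier (IntAut K)"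
    using second assms hom_in_carrier[of "rho K" Hom_units "IntAut K" x]
    by (simp add: canonical_second_lifting_property_def Hom_units_def)
  then show ?thesis
    by (simp add: IntAut_def kernel_def)
qed

lemma rho_mult:
  assumes "x \<in> hom add_group field_units" "y \<in> hom add_group field_units"
  shows "rho K (\<lambda>g. x g * y g) = rho K x \<otimes>\<^bsub>v_Aut K\<^esub> rho K y"
proof -
  have "rho K (x \<otimes>\<^bsub>Hom_units\<^esub> y) = rho K x \<otimes>\<^bsub>IntAut K\<^esub> rho K y"
    by (rule hom_mult[OF second[unfolded canonical_second_lifting_property_def]])
      (use assms in \<open>simp_all add: Hom_units_def\<close>)
  then show ?thesis
    by (simp add: Hom_units_def IntAut_def)
qed

lemma rho_monom: "rho K x (monom c g) = monom (c * x g) g"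
proof -
  have "rho K x (monom c g) = (\<lambda>h. monom c g h * x h)"
    by (simp add: rho_def)
  then show ?thesis
    by (auto simp: monom_def)
qed

lemma rho_apply: "a \<in> K \<Longrightarrow> rho K x a g = a g * x g"
  by (simp add: rho_def)

lemma inverse_hom:
  assumes "x \<in> hom add_group (field_units :: 'k monoid)"
  shows "(\<lambda>g. inverse (x g)) \<in> hom add_group field_units"
  using assms by (simp add: hom_field_units_iff)

lemma rho_inv:
  assumes "x \<in> hom add_group field_units"
  shows "inv\<^bsub>v_Aut K\<^esub> (rho K x) = rho K (\<lambda>g. inverse (x g))"
proof (rule A.inv_equality)
  have "rho K (\<lambda>g. inverse (x g) * x g) = \<one>\<^bsub>v_Aut K\<^esub>"
    using assms by (auto simp: v_Aut_one rho_def hom_field_units_iff fun_eq_iff)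
  then show "rho K (\<lambda>g. inverse (x g)) \<otimes>\<^bsub>v_Aut K\<^esub> rho K x = \<one>\<^bsub>v_Aut K\<^esub>"
    by (simp only: rho_mult[OF inverse_hom[OF assms] assms])
qed (rule rho_v_Aut inverse_hom assms)+

lemma rho_constants:
  assumes "x \<in> hom add_group field_units"
  shows "rho K x (monom c 0) = monom c 0"
  by (simp add: rho_monom hom_field_units_zero[OF assms])

lemma rho_K_summable:
  assumes x: "x \<in> hom add_group field_units"
  shows "K_summable_map K (rho K x)"
proof -
  have "rho K x ` constants \<subseteq> constants"
    by (auto simp: constants_def rho_constants[OF x])
  then obtain \<tau> T where T: "controlled (rho K x) \<tau> T"
    using stabilizer_controlled[OF rho_v_Aut[OF x]] by metis
  have "(\<Sum>g. rho K x (monom (a g) g) p) = a p * x p" for a p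
  proof -
    have "{g. rho K x (monom (a g) g) p \<noteq> 0} \<subseteq> {p}"
      unfolding rho_monom by (auto simp: monom_def split: if_splits)
    then have "(\<Sum>g. rho K x (monom (a g) g) p) = rho K x (monom (a p) p) p"
      by (simp add: Sum_any.expand_superset[of "{p}"])
    then show ?thesis
      unfolding rho_monom by (simp add: monom_def)
  qed
  then show ?thesis
    unfolding controlled_K_summable_iff[OF T] by (simp add: rho_def)
qed

lemma rho_fix_plus:
  assumes x: "x \<in> hom add_group field_units"
  shows "rho K x \<in> carrier (v_Aut_fix_plus K)"
proof -
  have "rho K x ` constants = constants"
    by (simp add: constants_def image_image rho_constants[OF x])
  then show ?thesis
    unfolding v_Aut_fix_plus_iff v_Aut_stab_plus_iff rho_inv[OF x]
    using rho_v_Aut[OF x] rho_K_summable[OF x] rho_K_summable[OF inverse_hom[OF x]] rho_constants[OF x]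
    by simp
qed

lemma rho_val:
  assumes x: "x \<in> hom add_group field_units" and a: "a \<in> K" "a \<noteq> (\<lambda>g. 0)"
  shows "val (rho K x a) = val a"
  by (rule val_eqI)
    (use x a val_nonzero[OF K_well_ordered[OF a(1)] a(2)] below_val[OF K_well_ordered[OF a(1)] a(2)]
     in \<open>auto simp: rho_apply hom_field_units_iff\<close>)

lemma from_gens_field_units:
  assumes "x \<in> carrier field_units_power"
  shows "from_gens field_units e x \<in> hom add_group (field_units :: 'k monoid)"
    and "at_gens e (from_gens field_units e x) = x"
proof -
  obtain X where X: "X \<in> hom add_group field_units" "at_gens e X = x"
    using at_gens_field_units_surj[OF generate_e] assms by (metis field_units_power_simps(1))
  have "from_gens field_units e (at_gens e X) = X"
    by (rule from_gens_at_gens[OF group_field_units generate_e X(1)])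
  then show "from_gens field_units e x \<in> hom add_group (field_units :: 'k monoid)"
    and "at_gens e (from_gens field_units e x) = x"
    using X by simp_all
qed

lemma rho_tuple_hom: "rho_tuple K e \<in> hom field_units_power (v_Aut K)"
proof (rule homI)
  fix x :: "'n \<Rightarrow> 'k" assume x: "x \<in> carrier field_units_power"
  then show "rho_tuple K e x \<in> carrier (v_Aut K)"
    unfolding rho_tuple_def by (intro rho_v_Aut from_gens_field_units)
  fix y :: "'n \<Rightarrow> 'k" assume y: "y \<in> carrier field_units_power"
  note X = from_gens_field_units[OF x] and Y = from_gens_field_units[OF y]
  have hom: "(\<lambda>g. from_gens field_units e x g * from_gens field_units e y g) \<in> hom add_group field_units"
    using X(1) Y(1) by (simp add: hom_field_units_iff)
  have "at_gens e (\<lambda>g. from_gens field_units e x g * from_gens field_units e y g)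
      = x \<otimes>\<^bsub>field_units_power\<^esub> y"
    using X(2) Y(2) by (auto simp: at_gens_def fun_eq_iff)
  then have "from_gens field_units e (x \<otimes>\<^bsub>field_units_power\<^esub> y)
      = (\<lambda>g. from_gens field_units e x g * from_gens field_units e y g)"
    using from_gens_at_gens[OF group_field_units generate_e hom] by simp
  then show "rho_tuple K e (x \<otimes>\<^bsub>field_units_power\<^esub> y) = rho_tuple K e x \<otimes>\<^bsub>v_Aut K\<^esub> rho_tuple K e y"
    unfolding rho_tuple_def by (simp only: rho_mult[OF X(1) Y(1)])
qed

subsection \<open>One-unit automorphisms\<close>

text \<open>
  This will be the image of the one-unit tuples; in this form it is visibly stable under
  conjugation by the maps \<open>\<rho>\<^sub>x\<close>.
\<close>

definition leading_fixing :: "(('n zlex \<Rightarrow> 'k) \<Rightarrow> ('n zlex \<Rightarrow> 'k)) set" where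
  "leading_fixing = {\<sigma> \<in> carrier (v_Aut_fix_plus K).
     \<forall>g. \<sigma> (monom 1 g) g = 1 \<and> (\<forall>p<g. \<sigma> (monom 1 g) p = 0)}"

text \<open>
  Divide the image of \<open>t\<^sup>g\<close> by \<open>t\<^sup>g\<close>.
\<close>

lemma leading_fixing_Hom_plus:
  assumes "\<sigma> \<in> leading_fixing"
  obtains u where "u \<in> carrier (Hom_plus K)" "tau K u = \<sigma>"
proof -
  have \<sigma>: "\<sigma> \<in> carrier (v_Aut_fix_plus K)" and lead: "\<And>g. \<sigma> (monom 1 g) g = 1"
      "\<And>p g. p < g \<Longrightarrow> \<sigma> (monom 1 g) p = 0"
    using assms by (auto simp: leading_fixing_def)
  note A = Fix.mem_carrier[OF \<sigma>]
  define u where "u g = monom 1 (- g) \<star> \<sigma> (monom 1 g)" for g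
  have u_apply: "u g p = \<sigma> (monom 1 g) (p + g)" for g p
    by (simp add: u_def monom_mult)
  obtain \<tau> where \<tau>: "\<tau> \<in> carrier o_Aut" and val: "\<And>a. a \<in> K \<Longrightarrow> a \<noteq> (\<lambda>g. 0) \<Longrightarrow> val (\<sigma> a) = \<tau> (val a)"
    using v_Aut_val[OF A] by metis
  have "\<tau> g = g" for g
    using val[OF K_monom monom_one_nonzero, of g] val_eqI[of "\<sigma> (monom 1 g)" g] lead by (simp add: val_monom)
  then have hom: "u \<in> hom add_group (one_units K)"
    using one_unit_part_hom[OF A \<tau> val] by (simp add: u_def[abs_def] lead)
  have mon: "\<sigma> (monom c g) = monom c g \<star> u g" for c g
  proof
    fix p
    show "\<sigma> (monom c g) p = (monom c g \<star> u g) p"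
      unfolding fix_plus_monom[OF \<sigma>, of c] by (simp add: monom_mult u_apply)
  qed
  have summ: "K_summable_map K \<sigma>"
    using \<sigma> by (simp add: v_Aut_fix_plus_iff v_Aut_stab_plus_iff)
  note u = Hom_plusI[OF hom summ mon]
  have "tau K u = \<sigma>"
    by (rule extensionalityI[OF tau_extensional v_AutD(2)[OF A] u(2)])
  with u(1) show thesis
    by (rule that)
qed

lemma leading_fixing_leading_term:
  assumes \<sigma>: "\<sigma> \<in> leading_fixing"
  shows "a \<in> K \<Longrightarrow> a \<noteq> (\<lambda>g. 0) \<Longrightarrow> val (\<sigma> a) = val a"
    and "a \<in> K \<Longrightarrow> (\<And>h. h < g \<Longrightarrow> a h = 0) \<Longrightarrow> \<sigma> a g = a g"
proof -
  obtain u where u: "u \<in> carrier (Hom_plus K)" "tau K u = \<sigma>"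
    using leading_fixing_Hom_plus[OF \<sigma>] .
  show "a \<in> K \<Longrightarrow> (\<And>h. h < g \<Longrightarrow> a h = 0) \<Longrightarrow> \<sigma> a g = a g"
    using tau_leading(1)[OF u(1)] by (simp add: u(2))
  assume a: "a \<in> K" "a \<noteq> (\<lambda>g. 0)"
  note v = val_nonzero[OF K_well_ordered[OF a(1)] a(2)] below_val[OF K_well_ordered[OF a(1)] a(2)]
  show "val (\<sigma> a) = val a"
    by (rule val_eqI) (use v tau_leading[OF u(1) a(1), of "val a"] in \<open>simp_all add: u(2)\<close>)
qed

text \<open>
  The map \<open>\<tau>\<^sub>u\<close> preserves leading terms of all series, in particular that of the preimage of \<open>t\<^sup>g\<close>.
\<close>

lemma leading_fixing_inv:
  assumes \<sigma>: "\<sigma> \<in> leading_fixing"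
  shows "inv\<^bsub>v_Aut K\<^esub> \<sigma> \<in> leading_fixing"
proof -
  have F: "\<sigma> \<in> carrier (v_Aut_fix_plus K)"
    using \<sigma> by (simp add: leading_fixing_def)
  note A = Fix.mem_carrier[OF F]
  have "(inv\<^bsub>v_Aut K\<^esub> \<sigma>) (monom 1 g) g = 1 \<and> (\<forall>p<g. (inv\<^bsub>v_Aut K\<^esub> \<sigma>) (monom 1 g) p = 0)" for g
  proof -
    define a where "a = (inv\<^bsub>v_Aut K\<^esub> \<sigma>) (monom 1 g)"
    have \<sigma>a: "\<sigma> a = monom 1 g"
      unfolding a_def by (rule v_Aut_inv_apply(2)[OF A K_monom])
    have aK: "a \<in> K"
      unfolding a_def by (rule v_AutD(4)[OF A.inv_closed[OF A] K_monom])
    have nz: "a \<noteq> (\<lambda>g. 0)"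
      using \<sigma>a v_Aut_zero[OF A] monom_one_nonzero by metis
    have va: "val a = g"
      using leading_fixing_leading_term(1)[OF \<sigma> aK nz] by (simp add: \<sigma>a val_monom)
    have low: "a p = 0" if "p < g" for p
      using below_val[OF K_well_ordered[OF aK] nz] that by (simp add: va)
    have "a g = 1"
      using leading_fixing_leading_term(2)[OF \<sigma> aK, of g] low by (simp add: \<sigma>a) (simp add: monom_def)
    with low show ?thesis
      by (simp add: a_def)
  qed
  then show ?thesis
    unfolding leading_fixing_def using Fix.m_inv_closed[OF F] by simp
qed

lemma tau_leading_fixing:
  assumes u: "u \<in> carrier (Hom_plus K)" and w: "w \<in> carrier (Hom_plus K)"
    and uw: "\<And>a. a \<in> K \<Longrightarrow> tau K u (tau K w a) = a" and wu: "\<And>a. a \<in> K \<Longrightarrow> tau K w (tau K u a) = a"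
  shows "tau K u \<in> leading_fixing"
proof -
  obtain T where T: "controlled (tau K u) id T"
    using tau_controlled[OF u] .
  have v_Aut: "tau K u \<in> carrier (v_Aut K)"
  proof (rule v_AutI[where \<tau> = id])
    show "bij_betw (tau K u) K K"
      by (rule bij_betw_byWitness[where f' = "tau K w"]) (auto simp: uw wu tau_closed[OF u] tau_closed[OF w])
    show "val (tau K u a) = id (val a)" if a: "a \<in> K" "a \<noteq> (\<lambda>g. 0)" for a
    proof -
      note v = val_nonzero[OF K_well_ordered[OF a(1)] a(2)] below_val[OF K_well_ordered[OF a(1)] a(2)]
      have "val (tau K u a) = val a"
        by (rule val_eqI) (use v tau_leading[OF u a(1), of "val a"] in simp_all)
      then show ?thesis
        by simp
    qed
  qed (use T in \<open>simp_all add: controlled_def tau_extensional tau_mult[OF u] tau_one[OF u] id_o_Aut\<close>)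
  have "K_summable_map K (inv\<^bsub>v_Aut K\<^esub> (tau K u)) \<longleftrightarrow> K_summable_map K (tau K w)"
  proof (rule K_summable_map_cong)
    fix a assume "a \<in> K"
    then show "(inv\<^bsub>v_Aut K\<^esub> (tau K u)) a = tau K w a"
      using v_Aut_inv_apply(1)[OF v_Aut tau_closed[OF w], of a] by (simp add: uw)
  qed
  moreover have "tau K u ` constants = constants"
    by (simp add: constants_def image_image tau_one[OF u])
  ultimately have "tau K u \<in> carrier (v_Aut_fix_plus K)"
    unfolding v_Aut_fix_plus_iff v_Aut_stab_plus_iff
    using v_Aut tau_K_summable[OF u] tau_K_summable[OF w] tau_one[OF u] by simp
  moreover have "tau K u (monom 1 g) g = 1 \<and> (\<forall>p<g. tau K u (monom 1 g) p = 0)" for g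
    using tau_leading[OF u K_monom, of g 1 g] by (simp add: monom_def)
  ultimately show ?thesis
    by (simp add: leading_fixing_def)
qed

text \<open>
  An inverse tuple provides the inverse map, so that \<open>\<tau>\<^sub>u\<close> is an automorphism. Conversely, the inverse
  of an automorphism that fixes leading terms again comes from a homomorphism into the one-units.
\<close>

lemma tau_tuple_image: "tau_tuple K e ` carrier (units_of (one_units_plus K e)) = leading_fixing"
proof (intro equalityI subsetI)
  interpret M: monoid "one_units_plus K e"
    by (rule monoid_one_units_plus)
  fix \<sigma> assume "\<sigma> \<in> tau_tuple K e ` carrier (units_of (one_units_plus K e))"
  then obtain x where x: "x \<in> Units (one_units_plus K e)" "\<sigma> = tau_tuple K e x"
    by (auto simp: units_of_carrier)
  then obtain y where y: "y \<in> carrier (one_units_plus K e)"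
      "x \<otimes>\<^bsub>one_units_plus K e\<^esub> y = \<one>\<^bsub>one_units_plus K e\<^esub>"
      "y \<otimes>\<^bsub>one_units_plus K e\<^esub> x = \<one>\<^bsub>one_units_plus K e\<^esub>"
    using M.Units_inv_closed M.Units_r_inv M.Units_l_inv by blast
  have xM: "x \<in> carrier (one_units_plus K e)"
    using x(1) by (rule M.Units_closed)
  have xy: "compose K (tau_tuple K e x) (tau_tuple K e y) = (\<lambda>a\<in>K. a)"
    "compose K (tau_tuple K e y) (tau_tuple K e x) = (\<lambda>a\<in>K. a)"
    using tau_tuple_mult(2)[OF xM y(1)] tau_tuple_mult(2)[OF y(1) xM] by (simp_all add: y tau_tuple_one)
  obtain u w where uw: "u \<in> carrier (Hom_plus K)" "x = at_gens e u"
      "w \<in> carrier (Hom_plus K)" "y = at_gens e w"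
    using xM y(1) unfolding one_units_plus_at_gens(1) by blast
  have eq: "tau_tuple K e x = tau K u" "tau_tuple K e y = tau K w"
    by (simp_all add: uw tau_tuple_at_gens)
  have "tau K u \<in> leading_fixing"
  proof (rule tau_leading_fixing[OF uw(1,3)])
    fix a assume a: "a \<in> K"
    show "tau K u (tau K w a) = a" "tau K w (tau K u a) = a"
      using fun_cong[OF xy(1), of a] fun_cong[OF xy(2), of a] a by (simp_all add: eq compose_eq)
  qed
  then show "\<sigma> \<in> leading_fixing"
    by (simp add: x(2) eq)
next
  fix \<sigma> assume \<sigma>: "\<sigma> \<in> leading_fixing"
  obtain u where u: "u \<in> carrier (Hom_plus K)" "tau K u = \<sigma>"
    using leading_fixing_Hom_plus[OF \<sigma>] .
  obtain w where w: "w \<in> carrier (Hom_plus K)" "tau K w = inv\<^bsub>v_Aut K\<^esub> \<sigma>"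
    using leading_fixing_Hom_plus[OF leading_fixing_inv[OF \<sigma>]] .
  have A: "\<sigma> \<in> carrier (v_Aut K)"
    using \<sigma> Fix.mem_carrier by (simp add: leading_fixing_def)
  have "u \<otimes>\<^bsub>Hom_plus K\<^esub> w = \<one>\<^bsub>Hom_plus K\<^esub>"
    by (rule tau_inj)
      (simp only: Hom_plus_mult(2)[OF u(1) w(1) K_monom] Hom_plus_one(2)[OF K_monom] u(2) w(2)
        v_Aut_inv_apply(2)[OF A K_monom])
  moreover have "w \<otimes>\<^bsub>Hom_plus K\<^esub> u = \<one>\<^bsub>Hom_plus K\<^esub>"
    by (rule tau_inj)
      (simp only: Hom_plus_mult(2)[OF w(1) u(1) K_monom] Hom_plus_one(2)[OF K_monom] u(2) w(2)
        v_Aut_inv_apply(1)[OF A K_monom])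
  ultimately have "at_gens e u \<in> Units (one_units_plus K e)"
    unfolding Units_def
    using u(1) w(1) by (auto simp: one_units_plus_at_gens intro!: bexI[of _ w])
  moreover have "tau_tuple K e (at_gens e u) = \<sigma>"
    by (simp add: tau_tuple_at_gens u)
  ultimately show "\<sigma> \<in> tau_tuple K e ` carrier (units_of (one_units_plus K e))"
    unfolding units_of_carrier by (metis imageI)
qed

subsection \<open>The internal factor\<close>

text \<open>The strongly additive part of the kernel of \<^const>\<open>Phi\<close> that fixes the constants.\<close>

definition internal :: "(('n zlex \<Rightarrow> 'k) \<Rightarrow> ('n zlex \<Rightarrow> 'k)) set" where
  "internal = {\<sigma> \<in> carrier (v_Aut_fix_plus K). \<forall>a\<in>K. a \<noteq> (\<lambda>g. 0) \<longrightarrow> val (\<sigma> a) = val a}"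

lemma group_one_units_plus: "group (units_of (one_units_plus K e))"
  by (rule monoid.units_group[OF monoid_one_units_plus])

lemma units_one_units_plus_closed:
  "u \<in> carrier (units_of (one_units_plus K e)) \<Longrightarrow> u \<in> carrier (one_units_plus K e)"
  by (simp add: units_of_carrier monoid.Units_closed[OF monoid_one_units_plus])

lemma tau_tuple_leading_fixing:
  "u \<in> carrier (units_of (one_units_plus K e)) \<Longrightarrow> tau_tuple K e u \<in> leading_fixing"
  using tau_tuple_image by blast

lemma leading_fixing_fix_plus: "\<sigma> \<in> leading_fixing \<Longrightarrow> \<sigma> \<in> carrier (v_Aut_fix_plus K)"
  by (simp add: leading_fixing_def)

lemma tau_tuple_hom: "tau_tuple K e \<in> hom (units_of (one_units_plus K e)) (v_Aut K)"
proof (rule homI)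
  fix u w
  assume u: "u \<in> carrier (units_of (one_units_plus K e))"
  show A: "tau_tuple K e u \<in> carrier (v_Aut K)"
    by (intro Fix.mem_carrier leading_fixing_fix_plus tau_tuple_leading_fixing u)
  assume w: "w \<in> carrier (units_of (one_units_plus K e))"
  have B: "tau_tuple K e w \<in> carrier (v_Aut K)"
    by (intro Fix.mem_carrier leading_fixing_fix_plus tau_tuple_leading_fixing w)
  show "tau_tuple K e (u \<otimes>\<^bsub>units_of (one_units_plus K e)\<^esub> w) = tau_tuple K e u \<otimes>\<^bsub>v_Aut K\<^esub> tau_tuple K e w"
    by (simp only: units_of_mult v_Aut_mult[OF A B]
        tau_tuple_mult(2)[OF units_one_units_plus_closed[OF u] units_one_units_plus_closed[OF w]])
qed

lemma rho_conj_leading_fixing: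
  assumes x: "x \<in> hom add_group field_units" and \<sigma>: "\<sigma> \<in> leading_fixing"
  shows "rho K x \<otimes>\<^bsub>v_Aut K\<^esub> \<sigma> \<otimes>\<^bsub>v_Aut K\<^esub> inv\<^bsub>v_Aut K\<^esub> (rho K x) \<in> leading_fixing"
proof -
  have F: "\<sigma> \<in> carrier (v_Aut_fix_plus K)"
    using \<sigma> by (rule leading_fixing_fix_plus)
  note A = Fix.mem_carrier[OF F] and R = rho_v_Aut[OF x]
  have closed: "rho K x \<otimes>\<^bsub>v_Aut K\<^esub> \<sigma> \<otimes>\<^bsub>v_Aut K\<^esub> inv\<^bsub>v_Aut K\<^esub> (rho K x) \<in> carrier (v_Aut_fix_plus K)"
    by (intro Fix.m_closed Fix.m_inv_closed rho_fix_plus x F)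
  have "(rho K x \<otimes>\<^bsub>v_Aut K\<^esub> \<sigma> \<otimes>\<^bsub>v_Aut K\<^esub> inv\<^bsub>v_Aut K\<^esub> (rho K x)) (monom 1 g) p
      = inverse (x g) * \<sigma> (monom 1 g) p * x p" for g p
  proof -
    have "(rho K x \<otimes>\<^bsub>v_Aut K\<^esub> \<sigma> \<otimes>\<^bsub>v_Aut K\<^esub> inv\<^bsub>v_Aut K\<^esub> (rho K x)) (monom 1 g)
        = rho K x (\<sigma> ((inv\<^bsub>v_Aut K\<^esub> (rho K x)) (monom 1 g)))"
      using A R by (simp only: v_Aut_apply A.m_closed A.inv_closed K_monom v_AutD(4)[OF A.inv_closed[OF R]])
    also have "(inv\<^bsub>v_Aut K\<^esub> (rho K x)) (monom 1 g) = monom (inverse (x g)) g"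
      by (simp add: rho_inv[OF x] rho_monom)
    finally have eq: "(rho K x \<otimes>\<^bsub>v_Aut K\<^esub> \<sigma> \<otimes>\<^bsub>v_Aut K\<^esub> inv\<^bsub>v_Aut K\<^esub> (rho K x)) (monom 1 g)
        = rho K x (\<sigma> (monom (inverse (x g)) g))" .
    show ?thesis
      unfolding eq rho_apply[OF v_AutD(4)[OF A K_monom]] fix_plus_monom[OF F, of "inverse (x g)"] ..
  qed
  then show ?thesis
    using closed \<sigma> x unfolding leading_fixing_def by (simp add: hom_field_units_iff)
qed

lemma rho_leading_fixing_imp_one:
  assumes "x \<in> carrier field_units_power" "rho_tuple K e x \<in> leading_fixing"
  shows "x = \<one>\<^bsub>field_units_power\<^esub>"
proof -
  have "from_gens field_units e x g = 1" for g
  proof -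
    have "rho_tuple K e x (monom 1 g) g = 1"
      using assms(2) by (simp add: leading_fixing_def)
    then show ?thesis
      unfolding rho_tuple_def rho_monom by (simp add: monom_def)
  qed
  then have "at_gens e (from_gens field_units e x) = (\<lambda>i. 1)"
    by (simp add: at_gens_def)
  then show ?thesis
    by (simp add: from_gens_field_units(2)[OF assms(1)])
qed

sublocale Int: internal_semidirect "v_Aut K" "units_of (one_units_plus K e)" "field_units_power :: ('n \<Rightarrow> 'k) monoid"
  "tau_tuple K e" "rho_tuple K e"
proof (intro internal_semidirect.intro internal_semidirect_axioms.intro)
  show "group (v_Aut K)"
    by (rule group_v_Aut)
  show "group (units_of (one_units_plus K e))"
    by (rule group_one_units_plus)
  show "group (field_units_power :: ('n \<Rightarrow> 'k) monoid)"
    by (rule group_field_units_power)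
  show "tau_tuple K e \<in> hom (units_of (one_units_plus K e)) (v_Aut K)"
    by (rule tau_tuple_hom)
  show "inj_on (tau_tuple K e) (carrier (units_of (one_units_plus K e)))"
    by (rule inj_on_subset[OF tau_tuple_inj]) (auto intro: units_one_units_plus_closed)
  show "rho_tuple K e \<in> hom field_units_power (v_Aut K)"
    by (rule rho_tuple_hom)
next
  fix x :: "'n \<Rightarrow> 'k" and n
  assume x: "x \<in> carrier field_units_power" and n: "n \<in> carrier (units_of (one_units_plus K e))"
  show "rho_tuple K e x \<otimes>\<^bsub>v_Aut K\<^esub> tau_tuple K e n \<otimes>\<^bsub>v_Aut K\<^esub> inv\<^bsub>v_Aut K\<^esub> rho_tuple K e x
      \<in> tau_tuple K e ` carrier (units_of (one_units_plus K e))"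
    unfolding tau_tuple_image rho_tuple_def
    by (intro rho_conj_leading_fixing from_gens_field_units(1) x tau_tuple_leading_fixing n)
  show "x = \<one>\<^bsub>field_units_power\<^esub>" if "tau_tuple K e n = rho_tuple K e x"
    using rho_leading_fixing_imp_one[OF x] tau_tuple_leading_fixing[OF n] that by simp
qed

lemma units_action_eq: "units_action K e = Int.\<theta>"
  by (simp add: units_action_def)

lemma int_factor_eq: "int_factor K e = semidirect (units_of (one_units_plus K e)) field_units_power Int.\<theta>"
  by (simp add: int_factor_def units_action_eq)

lemma int_factor_aut_eq: "int_factor_aut K e = Int.product_map"
  by (simp add: int_factor_aut_def Int.product_map_def)

text \<open>
  The factor \<open>\<rho>\<^sub>x\<close> is found by taking for \<open>x(g)\<close> the leading coefficient of the image of \<open>t\<^sup>g\<close>.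
\<close>

lemma int_factor_aut_image: "int_factor_aut K e ` carrier (int_factor K e) = internal"
  unfolding int_factor_eq int_factor_aut_eq
proof (rule Int.product_map_image)
  fix n x
  assume n: "n \<in> carrier (units_of (one_units_plus K e))"
    and x: "x \<in> carrier (field_units_power :: ('n \<Rightarrow> 'k) monoid)"
  note T = tau_tuple_leading_fixing[OF n] and X = from_gens_field_units(1)[OF x]
  have R: "rho_tuple K e x \<in> carrier (v_Aut_fix_plus K)"
    unfolding rho_tuple_def by (rule rho_fix_plus[OF X])
  note TA = Fix.mem_carrier[OF leading_fixing_fix_plus[OF T]] and RA = Fix.mem_carrier[OF R]
  have "val ((tau_tuple K e n \<otimes>\<^bsub>v_Aut K\<^esub> rho_tuple K e x) a) = val a" if a: "a \<in> K" "a \<noteq> (\<lambda>g. 0)" for a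
    unfolding v_Aut_apply[OF TA RA a(1)] leading_fixing_leading_term(1)[OF T v_AutD(4)[OF RA a(1)] v_Aut_nonzero[OF RA a]]
    unfolding rho_tuple_def by (rule rho_val[OF X a])
  then show "tau_tuple K e n \<otimes>\<^bsub>v_Aut K\<^esub> rho_tuple K e x \<in> internal"
    using Fix.m_closed[OF leading_fixing_fix_plus[OF T] R] by (simp add: internal_def)
next
  fix \<sigma> assume "\<sigma> \<in> internal"
  then have F: "\<sigma> \<in> carrier (v_Aut_fix_plus K)" and val: "\<And>a. a \<in> K \<Longrightarrow> a \<noteq> (\<lambda>g. 0) \<Longrightarrow> val (\<sigma> a) = val a"
    by (simp_all add: internal_def)
  note A = Fix.mem_carrier[OF F]
  \<comment> \<open>the leading coefficients of the images of the monomials form a homomorphism\<close>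
  define X where "X g = \<sigma> (monom 1 g) g" for g
  note lead = v_Aut_monom_leading[OF A, where \<tau> = "\<lambda>g. g", OF val]
  have X: "X \<in> hom add_group field_units"
    unfolding hom_field_units_iff
  proof (intro conjI allI)
    show "X g \<noteq> 0" for g
      unfolding X_def by (rule lead(1))
    show "X (g + h) = X g * X h" for g h
      unfolding X_def v_Aut_monom_add[OF A] by (rule hahn_mult_leading(1)[OF lead(2) lead(2)])
  qed
  define x where "x = at_gens e X"
  have x: "x \<in> carrier field_units_power"
    using X by (simp add: x_def at_gens_def hom_field_units_iff)
  have "from_gens field_units e x = X"
    unfolding x_def by (rule from_gens_at_gens[OF group_field_units generate_e X])
  then have R: "rho_tuple K e x = rho K X"
    by (simp add: rho_tuple_def)
  note RA = rho_v_Aut[OF X]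
  define \<sigma>' where "\<sigma>' = \<sigma> \<otimes>\<^bsub>v_Aut K\<^esub> inv\<^bsub>v_Aut K\<^esub> (rho K X)"
  have F': "\<sigma>' \<in> carrier (v_Aut_fix_plus K)"
    unfolding \<sigma>'_def by (intro Fix.m_closed Fix.m_inv_closed rho_fix_plus X F)
  have "\<sigma>' (monom 1 g) p = inverse (X g) * \<sigma> (monom 1 g) p" for g p
  proof -
    have "\<sigma>' (monom 1 g) = \<sigma> (rho K (\<lambda>g. inverse (X g)) (monom 1 g))"
      unfolding \<sigma>'_def rho_inv[OF X, symmetric] by (rule v_Aut_apply[OF A A.inv_closed[OF RA] K_monom])
    then show ?thesis
      by (simp add: rho_monom fix_plus_monom[OF F, of "inverse (X g)"])
  qed
  then have "\<sigma>' \<in> leading_fixing"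
    using F' X lead(2) by (simp add: leading_fixing_def hom_field_units_iff X_def[symmetric])
  then obtain n where n: "n \<in> carrier (units_of (one_units_plus K e))" "\<sigma>' = tau_tuple K e n"
    unfolding tau_tuple_image[symmetric] by blast
  have "\<sigma> = \<sigma>' \<otimes>\<^bsub>v_Aut K\<^esub> rho K X"
    unfolding \<sigma>'_def using A RA by (simp add: A.m_assoc)
  then show "\<exists>n\<in>carrier (units_of (one_units_plus K e)). \<exists>x\<in>carrier field_units_power.
      \<sigma> = tau_tuple K e n \<otimes>\<^bsub>v_Aut K\<^esub> rho_tuple K e x"
    using n x R by metis
qed

text \<open>
  Conjugation undoes the effect of \<open>\<eta>\<close> on the constants and on the valuations.
\<close>

lemma internal_normal:
  assumes \<eta>: "\<eta> \<in> carrier (v_Aut_stab_plus K)" and \<sigma>: "\<sigma> \<in> internal"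
  shows "\<eta> \<otimes>\<^bsub>v_Aut K\<^esub> \<sigma> \<otimes>\<^bsub>v_Aut K\<^esub> inv\<^bsub>v_Aut K\<^esub> \<eta> \<in> internal"
proof -
  have F: "\<sigma> \<in> carrier (v_Aut_fix_plus K)" and val: "\<And>a. a \<in> K \<Longrightarrow> a \<noteq> (\<lambda>g. 0) \<Longrightarrow> val (\<sigma> a) = val a"
    using \<sigma> by (simp_all add: internal_def)
  note A = Fix.mem_carrier[OF F] and H = Stab.mem_carrier[OF \<eta>]
  note H' = A.inv_closed[OF H]
  have app: "(\<eta> \<otimes>\<^bsub>v_Aut K\<^esub> \<sigma> \<otimes>\<^bsub>v_Aut K\<^esub> inv\<^bsub>v_Aut K\<^esub> \<eta>) a = \<eta> (\<sigma> ((inv\<^bsub>v_Aut K\<^esub> \<eta>) a))" if "a \<in> K" for a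
    using A H H' that by (simp only: v_Aut_apply A.m_closed v_AutD(4)[OF H'])
  have S: "\<eta> \<otimes>\<^bsub>v_Aut K\<^esub> \<sigma> \<otimes>\<^bsub>v_Aut K\<^esub> inv\<^bsub>v_Aut K\<^esub> \<eta> \<in> carrier (v_Aut_stab_plus K)"
    by (intro Stab.m_closed Stab.m_inv_closed \<eta> fix_plus_stab_plus F)
  have "(\<eta> \<otimes>\<^bsub>v_Aut K\<^esub> \<sigma> \<otimes>\<^bsub>v_Aut K\<^esub> inv\<^bsub>v_Aut K\<^esub> \<eta>) (monom c 0) = monom c 0" for c
  proof -
    have "(inv\<^bsub>v_Aut K\<^esub> \<eta>) (monom c 0) \<in> constants"
      using Stab.m_inv_closed[OF \<eta>] monom_in_constants by (auto simp: v_Aut_stab_plus_iff)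
    then obtain d where d: "(inv\<^bsub>v_Aut K\<^esub> \<eta>) (monom c 0) = monom d 0"
      unfolding constants_def by (rule rangeE)
    have "\<sigma> (monom d 0) = monom d 0"
      using F by (simp add: v_Aut_fix_plus_iff)
    then show ?thesis
      using v_Aut_inv_apply(2)[OF H K_monom[of c 0]] by (simp add: app d)
  qed
  moreover have "val ((\<eta> \<otimes>\<^bsub>v_Aut K\<^esub> \<sigma> \<otimes>\<^bsub>v_Aut K\<^esub> inv\<^bsub>v_Aut K\<^esub> \<eta>) a) = val a" if a: "a \<in> K" "a \<noteq> (\<lambda>g. 0)" for a
  proof -
    obtain \<tau> where \<tau>: "\<And>a. a \<in> K \<Longrightarrow> a \<noteq> (\<lambda>g. 0) \<Longrightarrow> val (\<eta> a) = \<tau> (val a)"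
      using v_Aut_val[OF H] by metis
    define b where "b = (inv\<^bsub>v_Aut K\<^esub> \<eta>) a"
    have b: "b \<in> K" "b \<noteq> (\<lambda>g. 0)" "\<eta> b = a"
      unfolding b_def by (rule v_AutD(4)[OF H' a(1)], rule v_Aut_nonzero[OF H' a], rule v_Aut_inv_apply(2)[OF H a(1)])
    have "val (\<eta> (\<sigma> b)) = \<tau> (val b)"
      by (simp add: \<tau> v_AutD(4)[OF A] v_Aut_nonzero[OF A] b val)
    also have "\<dots> = val a"
      using \<tau>[OF b(1,2)] by (simp add: b(3))
    finally show ?thesis
      by (simp add: app[OF a(1)] b_def)
  qed
  ultimately show ?thesis
    using S by (simp add: internal_def v_Aut_fix_plus_iff)
qed

end

section \<open>The external factor\<close>

lemma Aut_field_simps: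
  "\<rho> \<in> carrier Aut_field \<longleftrightarrow> bij \<rho> \<and> (\<forall>a b. \<rho> (a + b) = \<rho> a + \<rho> b) \<and> (\<forall>a b. \<rho> (a * b) = \<rho> a * \<rho> b)"
  "\<rho> \<otimes>\<^bsub>Aut_field\<^esub> \<rho>' = \<rho> \<circ> \<rho>'" "\<one>\<^bsub>Aut_field\<^esub> = id"
  by (simp_all add: Aut_field_def)

lemma group_Aut_field: "group (Aut_field :: ('k::field \<Rightarrow> 'k) monoid)"
proof (rule groupI)
  fix \<rho> :: "'k \<Rightarrow> 'k" assume \<rho>: "\<rho> \<in> carrier Aut_field"
  have inv: "inv_into UNIV \<rho> (\<rho> a) = a" "\<rho> (inv_into UNIV \<rho> a) = a" for a
    using \<rho> by (simp_all add: Aut_field_simps bij_is_inj bij_is_surj surj_f_inv_f)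
  have "inv_into UNIV \<rho> \<in> carrier Aut_field"
    unfolding Aut_field_simps
  proof (intro conjI allI)
    show "bij (inv_into UNIV \<rho>)"
      using \<rho> by (simp add: Aut_field_simps bij_imp_bij_inv)
    show "inv_into UNIV \<rho> (a + b) = inv_into UNIV \<rho> a + inv_into UNIV \<rho> b" for a b
      using \<rho> inv by (metis Aut_field_simps(1))
    show "inv_into UNIV \<rho> (a * b) = inv_into UNIV \<rho> a * inv_into UNIV \<rho> b" for a b
      using \<rho> inv by (metis Aut_field_simps(1))
  qed
  then show "\<exists>\<rho>'\<in>carrier Aut_field. \<rho>' \<otimes>\<^bsub>Aut_field\<^esub> \<rho> = \<one>\<^bsub>Aut_field\<^esub>"
    by (rule rev_bexI) (simp add: Aut_field_simps fun_eq_iff inv)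
qed (auto simp: Aut_field_simps bij_comp)

lemma Aut_field_zero: "\<rho> \<in> carrier Aut_field \<Longrightarrow> \<rho> 0 = 0"
  by (metis Aut_field_simps(1) add_cancel_right_right)

lemma id_Aut_field: "id \<in> carrier Aut_field"
  by (simp add: Aut_field_simps)

locale lifted_hahn_subfield = lex_hahn_subfield K e
  for K :: "('n::{finite,linorder} zlex \<Rightarrow> 'k::field) set" and e :: "'n \<Rightarrow> 'n zlex" +
  fixes \<Psi> :: "('k \<Rightarrow> 'k) \<times> ('n zlex \<Rightarrow> 'n zlex) \<Rightarrow> ('n zlex \<Rightarrow> 'k) \<Rightarrow> ('n zlex \<Rightarrow> 'k)"
  assumes first: "first_lifting K \<Psi>"
    and canonical: "canonical_first_lifting_property K \<Longrightarrow>
           \<forall>p\<in>carrier (Aut_field \<times>\<times> o_Aut). \<Psi> p = restrict (canonical_lift p) K"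
    and noncanonical: "\<not> canonical_first_lifting_property K \<Longrightarrow> ExtAut \<Psi> \<subseteq> carrier (v_Aut_stab_plus K)"
begin

lemma group_ext: "group (Aut_field \<times>\<times> o_Aut :: (('k \<Rightarrow> 'k) \<times> ('n zlex \<Rightarrow> 'n zlex)) monoid)"
  by (rule DirProd_group[OF group_Aut_field group_o_Aut])

sublocale Psi: group_hom "Aut_field \<times>\<times> o_Aut :: (('k \<Rightarrow> 'k) \<times> ('n zlex \<Rightarrow> 'n zlex)) monoid" "v_Aut K" \<Psi>
  using first group_ext group_v_Aut by (simp add: group_hom_def group_hom_axioms_def first_lifting_def)

lemma canonical_lift_monom:
  assumes "\<rho> \<in> carrier Aut_field" "\<tau> \<in> carrier o_Aut"
  shows "canonical_lift (\<rho>, \<tau>) (monom c g) = monom (\<rho> c) (\<tau> g)"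
proof
  fix h
  have "inv_into UNIV \<tau> h = g \<longleftrightarrow> h = \<tau> g"
    using o_Aut_inv_into(2,3)[OF assms(2)] by metis
  then show "canonical_lift (\<rho>, \<tau>) (monom c g) h = monom (\<rho> c) (\<tau> g) h"
    by (simp add: canonical_lift_def monom_def Aut_field_zero[OF assms(1)])
qed

text \<open>
  The canonical lifting sends monomials to monomials, so every coefficient of the sum in question has
  a single summand. For any other lifting the claim is a hypothesis.
\<close>

lemma Psi_stab_plus:
  assumes p: "p \<in> carrier (Aut_field \<times>\<times> o_Aut)"
  shows "\<Psi> p \<in> carrier (v_Aut_stab_plus K)"
proof (cases "canonical_first_lifting_property K")
  case False
  then show ?thesis
    using noncanonical p by (auto simp: ExtAut_def)
next
  case True
  note eq = bspec[OF canonical[OF True]]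
  have const: "\<Psi> q ` constants = constants" and summ: "K_summable_map K (\<Psi> q)"
    if q: "q \<in> carrier (Aut_field \<times>\<times> o_Aut)" for q
  proof -
    obtain \<rho> \<tau> where q_eq: "q = (\<rho>, \<tau>)" and \<rho>: "\<rho> \<in> carrier Aut_field" and \<tau>: "\<tau> \<in> carrier o_Aut"
      using q by auto
    have mon: "\<Psi> q (monom c g) = monom (\<rho> c) (\<tau> g)" for c g
      using eq[OF q] by (simp add: q_eq canonical_lift_monom[OF \<rho> \<tau>])
    have "\<Psi> q ` constants = (\<lambda>c. monom c 0) ` range \<rho>"
      by (simp add: constants_def image_image mon o_Aut_zero[OF \<tau>])
    also have "range \<rho> = UNIV"
      using \<rho> by (simp add: Aut_field_simps bij_is_surj)
    finally show const: "\<Psi> q ` constants = constants"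
      by (simp add: constants_def)
    obtain \<tau>' T where T: "controlled (\<Psi> q) \<tau>' T"
      using stabilizer_controlled[OF Psi.hom_closed[OF q]] const by (metis order_refl)
    have "(\<Sum>g. \<Psi> q (monom (a g) g) h) = \<Psi> q a h" if a: "a \<in> K" for a h
    proof -
      define g0 where "g0 = inv_into UNIV \<tau> h"
      have g0: "\<tau> g = h \<longleftrightarrow> g = g0" for g
        unfolding g0_def using o_Aut_inv_into(2,3)[OF \<tau>] by metis
      have "{g. \<Psi> q (monom (a g) g) h \<noteq> 0} \<subseteq> {g0}"
        using g0 unfolding mon by (auto simp: monom_def split: if_splits)
      then have "(\<Sum>g. \<Psi> q (monom (a g) g) h) = \<Psi> q (monom (a g0) g0) h"
        by (simp add: Sum_any.expand_superset[of "{g0}"])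
      also have "\<dots> = \<rho> (a g0)"
        using g0[of g0] unfolding mon by (simp add: monom_def)
      also have "\<dots> = \<Psi> q a h"
        using eq[OF q] a by (simp add: q_eq canonical_lift_def g0_def)
      finally show ?thesis .
    qed
    then show "K_summable_map K (\<Psi> q)"
      unfolding controlled_K_summable_iff[OF T] by (simp add: fun_eq_iff)
  qed
  show ?thesis
    unfolding v_Aut_stab_plus_iff
    using const[OF p] summ[OF p] summ[OF Psi.G.inv_closed[OF p]] Psi.hom_closed[OF p] Psi.hom_inv[OF p]
    by simp
qed

text \<open>
  The order automorphism of \<open>\<Psi>(\<rho>, \<tau>)\<close> is unique, since every exponent is the valuation of a monomial.
  Hence it is the one that \<^const>\<open>Phi\<close> selects.
\<close>

lemma Psi_val:
  assumes "\<rho> \<in> carrier Aut_field" "\<tau> \<in> carrier o_Aut" and a: "a \<in> K" "a \<noteq> (\<lambda>g. 0)"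
  shows "val (\<Psi> (\<rho>, \<tau>) a) = \<tau> (val a)"
proof -
  have p: "(\<rho>, \<tau>) \<in> carrier (Aut_field \<times>\<times> o_Aut)"
    using assms by simp
  define \<sigma> where "\<sigma> = \<Psi> (\<rho>, \<tau>)"
  have \<sigma>: "\<sigma> \<in> carrier (v_Aut K)"
    unfolding \<sigma>_def by (rule Psi.hom_closed[OF p])
  obtain \<tau>' where \<tau>': "\<tau>' \<in> carrier o_Aut" "\<And>a. a \<in> K \<Longrightarrow> a \<noteq> (\<lambda>g. 0) \<Longrightarrow> val (\<sigma> a) = \<tau>' (val a)"
    using v_Aut_val[OF \<sigma>] by metis
  have "(THE \<tau>. \<tau> \<in> carrier o_Aut \<and> (\<forall>a \<in> K - {\<zero>\<^bsub>hahn_series\<^esub>}. \<tau> (val a) = val (\<sigma> a))) = \<tau>'"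
  proof (rule the_equality)
    show "\<tau>' \<in> carrier o_Aut \<and> (\<forall>a \<in> K - {\<zero>\<^bsub>hahn_series\<^esub>}. \<tau>' (val a) = val (\<sigma> a))"
      using \<tau>' by simp
    fix \<tau>2 assume *: "\<tau>2 \<in> carrier o_Aut \<and> (\<forall>a \<in> K - {\<zero>\<^bsub>hahn_series\<^esub>}. \<tau>2 (val a) = val (\<sigma> a))"
    show "\<tau>2 = \<tau>'"
    proof
      fix g
      have "monom 1 g \<in> K - {\<zero>\<^bsub>hahn_series\<^esub>}"
        by simp
      then have "\<tau>2 (val (monom (1 :: 'k) g)) = val (\<sigma> (monom 1 g))"
        using * by blast
      also have "\<dots> = \<tau>' (val (monom (1 :: 'k) g))"
        by (rule \<tau>'(2)[OF K_monom monom_one_nonzero])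
      finally show "\<tau>2 g = \<tau>' g"
        by (simp add: val_monom)
    qed
  qed
  then have "\<tau>' = snd (Phi K \<sigma>)"
    by (simp add: Phi_def)
  also have "\<dots> = \<tau>"
    using first p by (simp add: first_lifting_def \<sigma>_def)
  finally show ?thesis
    using \<tau>'(2)[OF a] by (simp add: \<sigma>_def)
qed

lemma Psi_constant:
  assumes "\<rho> \<in> carrier Aut_field" "\<tau> \<in> carrier o_Aut"
  shows "\<Psi> (\<rho>, \<tau>) (monom c 0) = monom (\<rho> c) 0"
proof -
  have p: "(\<rho>, \<tau>) \<in> carrier (Aut_field \<times>\<times> o_Aut)"
    using assms by simp
  have "\<Psi> (\<rho>, \<tau>) ` constants = constants"
    using Psi_stab_plus[OF p] by (simp add: v_Aut_stab_plus_iff)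
  then have "\<Psi> (\<rho>, \<tau>) (monom c 0) \<in> constants"
    using monom_in_constants by blast
  then obtain d where d: "\<Psi> (\<rho>, \<tau>) (monom c 0) = monom d 0"
    unfolding constants_def by (rule rangeE)
  have "fst (Phi K (\<Psi> (\<rho>, \<tau>))) = \<rho>"
    using first p by (simp add: first_lifting_def)
  then have "(\<lambda>c. \<Psi> (\<rho>, \<tau>) (monom c 0) 0) = \<rho>"
    by (simp add: Phi_def)
  then have "\<Psi> (\<rho>, \<tau>) (monom c 0) 0 = \<rho> c"
    by (rule fun_cong)
  then have "monom d 0 (0 :: 'n zlex) = \<rho> c"
    by (simp only: d)
  then have "d = \<rho> c"
    by (simp add: monom_def)
  with d show ?thesis
    by simp
qed

definition lift :: "('k \<Rightarrow> 'k) \<times> 'n int_matrix \<Rightarrow> ('n zlex \<Rightarrow> 'k) \<Rightarrow> ('n zlex \<Rightarrow> 'k)" where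
  "lift = (\<lambda>(\<rho>, A). \<Psi> (\<rho>, UUT_act A))"

lemma lift_arg:
  assumes "q \<in> carrier (Aut_field \<times>\<times> UUT)"
  shows "(fst q, UUT_act (snd q)) \<in> carrier (Aut_field \<times>\<times> o_Aut)"
  using assms hom_in_carrier[OF UUT_act_hom] by auto

lemma lift_eq: "lift q = \<Psi> (fst q, UUT_act (snd q))"
  by (simp add: lift_def split_beta)

lemma lift_stab_plus: "q \<in> carrier (Aut_field \<times>\<times> UUT) \<Longrightarrow> lift q \<in> carrier (v_Aut_stab_plus K)"
  unfolding lift_eq by (intro Psi_stab_plus lift_arg)

lemma lift_hom: "lift \<in> hom (Aut_field \<times>\<times> UUT) (v_Aut K)"
proof (rule homI)
  fix q q' :: "('k \<Rightarrow> 'k) \<times> 'n int_matrix"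
  assume q: "q \<in> carrier (Aut_field \<times>\<times> UUT)"
  show "lift q \<in> carrier (v_Aut K)"
    by (rule Stab.mem_carrier[OF lift_stab_plus[OF q]])
  assume q': "q' \<in> carrier (Aut_field \<times>\<times> UUT)"
  have "UUT_act (snd q \<otimes>\<^bsub>UUT\<^esub> snd q') = UUT_act (snd q) \<otimes>\<^bsub>o_Aut\<^esub> UUT_act (snd q')"
    by (rule hom_mult[OF UUT_act_hom]) (use q q' in auto)
  then have "(fst (q \<otimes>\<^bsub>Aut_field \<times>\<times> UUT\<^esub> q'), UUT_act (snd (q \<otimes>\<^bsub>Aut_field \<times>\<times> UUT\<^esub> q')))
      = (fst q, UUT_act (snd q)) \<otimes>\<^bsub>Aut_field \<times>\<times> o_Aut\<^esub> (fst q', UUT_act (snd q'))"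
    by (simp only: mult_DirProd' fst_conv snd_conv)
  then show "lift (q \<otimes>\<^bsub>Aut_field \<times>\<times> UUT\<^esub> q') = lift q \<otimes>\<^bsub>v_Aut K\<^esub> lift q'"
    unfolding lift_eq using Psi.hom_mult[OF lift_arg[OF q] lift_arg[OF q']] by simp
qed

lemma lift_internal_imp_one:
  assumes q: "q \<in> carrier (Aut_field \<times>\<times> UUT)" and int: "lift q \<in> internal"
  shows "q = \<one>\<^bsub>Aut_field \<times>\<times> UUT\<^esub>"
proof -
  obtain \<rho> A where q_eq: "q = (\<rho>, A)" and \<rho>: "\<rho> \<in> carrier Aut_field" and A: "A \<in> carrier UUT"
    using q by auto
  have \<tau>: "UUT_act A \<in> carrier o_Aut"
    by (rule hom_in_carrier[OF UUT_act_hom A])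
  have l: "lift q = \<Psi> (\<rho>, UUT_act A)"
    by (simp add: lift_eq q_eq)
  have "monom (\<rho> c) 0 = (monom c 0 :: 'n zlex \<Rightarrow> 'k)" for c
    using int Psi_constant[OF \<rho> \<tau>, of c] by (simp add: internal_def v_Aut_fix_plus_iff l)
  then have "\<rho> = id"
    by (intro ext) (simp add: monom_eq_iff)
  have "UUT_act A g = g" for g
  proof -
    have "val (lift q (monom 1 g)) = val (monom (1 :: 'k) g)"
      using int by (simp add: internal_def)
    then show ?thesis
      using Psi_val[OF \<rho> \<tau> K_monom monom_one_nonzero, of g] by (simp add: l val_monom)
  qed
  then have "UUT_act A = id"
    by (simp add: fun_eq_iff)
  moreover have "UUT_act \<one>\<^bsub>UUT\<^esub> = (\<one>\<^bsub>o_Aut\<^esub> :: 'n zlex \<Rightarrow> 'n zlex)"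
    by (rule hom_one[OF UUT_act_hom group_UUT group_o_Aut])
  ultimately have "UUT_act A = UUT_act \<one>\<^bsub>UUT\<^esub>"
    by (simp only: o_Aut_simps)
  then have "A = \<one>\<^bsub>UUT\<^esub>"
    by (rule inj_onD[OF UUT_act_inj _ A monoid.one_closed[OF group.is_monoid[OF group_UUT]]])
  with \<open>\<rho> = id\<close> show ?thesis
    by (simp add: q_eq Aut_field_simps)
qed

lemma group_lift_domain: "group (Aut_field \<times>\<times> UUT :: (('k \<Rightarrow> 'k) \<times> 'n int_matrix) monoid)"
  by (rule DirProd_group[OF group_Aut_field group_UUT])

lemma fix_lift_arg:
  assumes "A \<in> carrier (UUT :: 'n int_matrix monoid)"
  shows "((id, A) :: ('k \<Rightarrow> 'k) \<times> 'n int_matrix) \<in> carrier (Aut_field \<times>\<times> UUT)"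
  using assms id_Aut_field by simp

lemma fix_lift_hom: "(\<lambda>A. lift (id, A)) \<in> hom UUT (v_Aut K)"
proof (rule homI)
  fix A B :: "'n int_matrix" assume A: "A \<in> carrier UUT"
  show "lift (id, A) \<in> carrier (v_Aut K)"
    by (rule hom_in_carrier[OF lift_hom fix_lift_arg[OF A]])
  assume B: "B \<in> carrier UUT"
  have "lift ((id, A) \<otimes>\<^bsub>Aut_field \<times>\<times> UUT\<^esub> (id, B)) = lift (id, A) \<otimes>\<^bsub>v_Aut K\<^esub> lift (id, B)"
    by (rule hom_mult[OF lift_hom fix_lift_arg[OF A] fix_lift_arg[OF B]])
  then show "lift (id, A \<otimes>\<^bsub>UUT\<^esub> B) = lift (id, A) \<otimes>\<^bsub>v_Aut K\<^esub> lift (id, B)"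
    by (simp add: Aut_field_simps)
qed

lemma group_int_factor: "group (int_factor K e)"
  unfolding int_factor_eq by (rule Int.group_semidirect)

lemma int_factor_aut_hom: "int_factor_aut K e \<in> hom (int_factor K e) (v_Aut K)"
  unfolding int_factor_eq int_factor_aut_eq by (rule Int.product_map_hom)

lemma int_factor_aut_inj: "inj_on (int_factor_aut K e) (carrier (int_factor K e))"
  unfolding int_factor_eq int_factor_aut_eq by (rule Int.product_map_inj)

lemma int_factor_aut_internal: "n \<in> carrier (int_factor K e) \<Longrightarrow> int_factor_aut K e n \<in> internal"
  using int_factor_aut_image by blast

sublocale Ext: internal_semidirect "v_Aut K" "int_factor K e" "Aut_field \<times>\<times> UUT" "int_factor_aut K e" lift
proof (intro internal_semidirect.intro internal_semidirect_axioms.intro)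
  fix q :: "('k \<Rightarrow> 'k) \<times> 'n int_matrix" and n
  assume q: "q \<in> carrier (Aut_field \<times>\<times> UUT)" and n: "n \<in> carrier (int_factor K e)"
  show "lift q \<otimes>\<^bsub>v_Aut K\<^esub> int_factor_aut K e n \<otimes>\<^bsub>v_Aut K\<^esub> inv\<^bsub>v_Aut K\<^esub> lift q
      \<in> int_factor_aut K e ` carrier (int_factor K e)"
    unfolding int_factor_aut_image by (rule internal_normal[OF lift_stab_plus[OF q] int_factor_aut_internal[OF n]])
  show "q = \<one>\<^bsub>Aut_field \<times>\<times> UUT\<^esub>" if "int_factor_aut K e n = lift q"
    using lift_internal_imp_one[OF q] int_factor_aut_internal[OF n] that by simp
qed (rule group_v_Aut group_int_factor group_lift_domain int_factor_aut_hom int_factor_aut_inj lift_hom)+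

sublocale Ext_fix: internal_semidirect "v_Aut K" "int_factor K e" UUT "int_factor_aut K e" "\<lambda>A. lift (id, A)"
proof (intro internal_semidirect.intro internal_semidirect_axioms.intro)
  fix A :: "'n int_matrix" and n assume A: "A \<in> carrier UUT" and n: "n \<in> carrier (int_factor K e)"
  show "lift (id, A) \<otimes>\<^bsub>v_Aut K\<^esub> int_factor_aut K e n \<otimes>\<^bsub>v_Aut K\<^esub> inv\<^bsub>v_Aut K\<^esub> lift (id, A)
      \<in> int_factor_aut K e ` carrier (int_factor K e)"
    by (rule Ext.normalized[OF fix_lift_arg[OF A] n])
  show "A = \<one>\<^bsub>UUT\<^esub>" if "int_factor_aut K e n = lift (id, A)"
    using Ext.trivial_intersection[OF fix_lift_arg[OF A] n that] by simp
qed (rule group_v_Aut group_int_factor group_UUT int_factor_aut_hom int_factor_aut_inj fix_lift_hom)+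

text \<open>
  Composing with the inverse of the lift of its action on \<open>k\<close> and \<open>G\<close> turns any automorphism
  preserving the constants into one that acts trivially on both.
\<close>

lemma stab_plus_decompose:
  assumes \<eta>: "\<eta> \<in> carrier (v_Aut_stab_plus K)"
  obtains n \<rho> A where "n \<in> carrier (int_factor K e)" "(\<rho>, A) \<in> carrier (Aut_field \<times>\<times> UUT)"
    "\<eta> = int_factor_aut K e n \<otimes>\<^bsub>v_Aut K\<^esub> lift (\<rho>, A)" "\<And>c. \<eta> (monom c 0) = monom (\<rho> c) 0"
proof -
  note H = Stab.mem_carrier[OF \<eta>]
  have const: "\<eta> ` constants = constants"
    using \<eta> by (simp add: v_Aut_stab_plus_iff)
  have "\<exists>d. \<eta> (monom c 0) = monom d 0" for c
    using const monom_in_constants[of c] unfolding constants_def by blast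
  then obtain \<rho> where \<rho>: "\<And>c. \<eta> (monom c 0) = monom (\<rho> c) 0"
    by metis
  have "\<rho> \<in> carrier Aut_field"
    unfolding Aut_field_simps
  proof (intro conjI allI bijI injI)
    fix c d
    show "c = d" if "\<rho> c = \<rho> d"
    proof -
      have "\<eta> (monom c 0) = \<eta> (monom d 0)"
        by (simp add: \<rho> that)
      then have "monom c 0 = (monom d 0 :: 'n zlex \<Rightarrow> 'k)"
        by (rule inj_onD[OF bij_betw_imp_inj_on[OF v_AutD(3)[OF H]]]) simp_all
      then show ?thesis
        by (simp add: monom_eq_iff)
    qed
    have add: "(\<lambda>g. monom c 0 g + monom d 0 g) = (monom (c + d) 0 :: 'n zlex \<Rightarrow> 'k)" for c d
      by (auto simp: monom_def)
    have "monom (\<rho> (c + d)) 0 = (monom (\<rho> c + \<rho> d) 0 :: 'n zlex \<Rightarrow> 'k)"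
      using v_AutD(5)[OF H K_monom[of c 0] K_monom[of d 0]] by (simp only: add \<rho>)
    then show "\<rho> (c + d) = \<rho> c + \<rho> d"
      by (simp only: monom_eq_iff)
    have "monom (\<rho> (c * d)) 0 = (monom (\<rho> c * \<rho> d) 0 :: 'n zlex \<Rightarrow> 'k)"
      using v_AutD(6)[OF H K_monom[of c 0] K_monom[of d 0]]
      by (simp only: monom_mult_monom \<rho> add_0_right)
    then show "\<rho> (c * d) = \<rho> c * \<rho> d"
      by (simp only: monom_eq_iff)
  next
    have "\<exists>c. d = \<rho> c" for d
    proof -
      have "monom d 0 \<in> \<eta> ` constants"
        by (simp add: const monom_in_constants)
      then obtain c where "\<eta> (monom c 0) = monom d 0"
        unfolding constants_def by (metis (no_types, lifting) imageE)
      then show ?thesis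
        by (metis \<rho> monom_eq_iff)
    qed
    then show "surj \<rho>"
      unfolding surj_def by blast
  qed
  obtain \<tau> where \<tau>: "\<tau> \<in> carrier o_Aut" "\<And>a. a \<in> K \<Longrightarrow> a \<noteq> (\<lambda>g. 0) \<Longrightarrow> val (\<eta> a) = \<tau> (val a)"
    using v_Aut_val[OF H] by metis
  obtain A where A: "A \<in> carrier UUT" "UUT_act A = \<tau>"
    using UUT_act_surj[OF \<tau>(1)] by blast
  have q: "(\<rho>, A) \<in> carrier (Aut_field \<times>\<times> UUT)"
    using \<open>\<rho> \<in> carrier Aut_field\<close> A by simp
  define L where "L = lift (\<rho>, A)"
  have L: "L = \<Psi> (\<rho>, \<tau>)"
    by (simp add: L_def lift_eq A)
  have LS: "L \<in> carrier (v_Aut_stab_plus K)"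
    unfolding L_def by (rule lift_stab_plus[OF q])
  note LA = Stab.mem_carrier[OF LS]
  note LA' = A.inv_closed[OF LA]
  define \<sigma> where "\<sigma> = \<eta> \<otimes>\<^bsub>v_Aut K\<^esub> inv\<^bsub>v_Aut K\<^esub> L"
  have S: "\<sigma> \<in> carrier (v_Aut_stab_plus K)"
    unfolding \<sigma>_def by (intro Stab.m_closed Stab.m_inv_closed \<eta> LS)
  have app: "\<sigma> a = \<eta> ((inv\<^bsub>v_Aut K\<^esub> L) a)" if "a \<in> K" for a
    unfolding \<sigma>_def by (rule v_Aut_apply[OF H LA' that])
  have "\<sigma> (monom c 0) = monom c 0" for c
  proof -
    have "(inv\<^bsub>v_Aut K\<^esub> L) (monom c 0) \<in> constants"
      using Stab.m_inv_closed[OF LS] monom_in_constants by (auto simp: v_Aut_stab_plus_iff)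
    then obtain d where d: "(inv\<^bsub>v_Aut K\<^esub> L) (monom c 0) = monom d 0"
      unfolding constants_def by (rule rangeE)
    have "monom c 0 = L (monom d 0)"
      using v_Aut_inv_apply(2)[OF LA K_monom[of c 0]] by (simp add: d)
    also have "\<dots> = monom (\<rho> d) 0"
      unfolding L by (rule Psi_constant[OF \<open>\<rho> \<in> carrier Aut_field\<close> \<tau>(1)])
    also have "\<dots> = \<sigma> (monom c 0)"
      by (simp add: app d \<rho>)
    finally show ?thesis by simp
  qed
  moreover have "val (\<sigma> a) = val a" if a: "a \<in> K" "a \<noteq> (\<lambda>g. 0)" for a
  proof -
    define b where "b = (inv\<^bsub>v_Aut K\<^esub> L) a"
    have b: "b \<in> K" "b \<noteq> (\<lambda>g. 0)" "L b = a"
      unfolding b_def by (rule v_AutD(4)[OF LA' a(1)], rule v_Aut_nonzero[OF LA' a], rule v_Aut_inv_apply(2)[OF LA a(1)])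
    have "val a = \<tau> (val b)"
      using Psi_val[OF \<open>\<rho> \<in> carrier Aut_field\<close> \<tau>(1) b(1,2)] by (simp add: L[symmetric] b(3))
    also have "\<dots> = val (\<sigma> a)"
      by (simp add: app[OF a(1)] b_def[symmetric] \<tau>(2)[OF b(1,2)])
    finally show ?thesis by simp
  qed
  ultimately have "\<sigma> \<in> internal"
    using S by (simp add: internal_def v_Aut_fix_plus_iff)
  then obtain n where n: "n \<in> carrier (int_factor K e)" "\<sigma> = int_factor_aut K e n"
    unfolding int_factor_aut_image[symmetric] by blast
  have "\<eta> = \<sigma> \<otimes>\<^bsub>v_Aut K\<^esub> L"
    unfolding \<sigma>_def using H LA by (simp add: A.m_assoc)
  then show thesis
    using that[OF n(1) q _ \<rho>] by (simp add: n(2) L_def)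
qed

lemma internal_stab_plus: "\<sigma> \<in> internal \<Longrightarrow> \<sigma> \<in> carrier (v_Aut_stab_plus K)"
  by (simp add: internal_def v_Aut_fix_plus_iff)

lemma Ext_image: "Ext.product_map ` carrier (semidirect (int_factor K e) (Aut_field \<times>\<times> UUT) Ext.\<theta>)
    = carrier (v_Aut_stab_plus K)"
proof (rule Ext.product_map_image)
  fix n q assume "n \<in> carrier (int_factor K e)" "q \<in> carrier (Aut_field \<times>\<times> UUT :: (('k \<Rightarrow> 'k) \<times> 'n int_matrix) monoid)"
  then show "int_factor_aut K e n \<otimes>\<^bsub>v_Aut K\<^esub> lift q \<in> carrier (v_Aut_stab_plus K)"
    by (intro Stab.m_closed internal_stab_plus int_factor_aut_internal lift_stab_plus)
next
  fix \<eta> assume "\<eta> \<in> carrier (v_Aut_stab_plus K)"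
  then show "\<exists>n\<in>carrier (int_factor K e). \<exists>q\<in>carrier (Aut_field \<times>\<times> UUT). \<eta> = int_factor_aut K e n \<otimes>\<^bsub>v_Aut K\<^esub> lift q"
    using stab_plus_decompose by metis
qed

lemma Ext_fix_image: "Ext_fix.product_map ` carrier (semidirect (int_factor K e) UUT Ext_fix.\<theta>)
    = carrier (v_Aut_fix_plus K)"
proof (rule Ext_fix.product_map_image)
  fix n A assume n: "n \<in> carrier (int_factor K e)" and A: "A \<in> carrier (UUT :: 'n int_matrix monoid)"
  have "lift (id, A) (monom c 0) = monom c 0" for c
    using Psi_constant[OF id_Aut_field hom_in_carrier[OF UUT_act_hom A], of c] by (simp add: lift_eq)
  then have "lift (id, A) \<in> carrier (v_Aut_fix_plus K)"
    using lift_stab_plus[OF fix_lift_arg[OF A]] by (simp add: v_Aut_fix_plus_iff)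
  moreover have "int_factor_aut K e n \<in> carrier (v_Aut_fix_plus K)"
    using int_factor_aut_internal[OF n] by (simp add: internal_def)
  ultimately show "int_factor_aut K e n \<otimes>\<^bsub>v_Aut K\<^esub> lift (id, A) \<in> carrier (v_Aut_fix_plus K)"
    by (intro Fix.m_closed)
next
  fix \<eta> assume \<eta>: "\<eta> \<in> carrier (v_Aut_fix_plus K)"
  obtain n \<rho> A where n: "n \<in> carrier (int_factor K e)" "(\<rho>, A) \<in> carrier (Aut_field \<times>\<times> UUT)"
      "\<eta> = int_factor_aut K e n \<otimes>\<^bsub>v_Aut K\<^esub> lift (\<rho>, A)" "\<And>c. \<eta> (monom c 0) = monom (\<rho> c) 0"
    using stab_plus_decompose[OF fix_plus_stab_plus[OF \<eta>]] by metis
  have "monom (\<rho> c) 0 = (monom c 0 :: 'n zlex \<Rightarrow> 'k)" for c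
    using \<eta> n(4)[of c] by (simp add: v_Aut_fix_plus_iff)
  then have "\<rho> = id"
    by (intro ext) (simp add: monom_eq_iff)
  with n show "\<exists>n\<in>carrier (int_factor K e). \<exists>A\<in>carrier UUT. \<eta> = int_factor_aut K e n \<otimes>\<^bsub>v_Aut K\<^esub> lift (id, A)"
    by auto
qed

lemma ext_action_eq: "ext_action K e \<Psi> = Ext.\<theta>"
  by (simp add: ext_action_def lift_def)

lemma ext_fix_action_eq: "ext_fix_action K e \<Psi> = Ext_fix.\<theta>"
  by (simp add: ext_fix_action_def lift_def)

lemma v_Aut_stab_plus_eq: "v_Aut_stab_plus K = v_Aut K\<lparr>carrier := carrier (v_Aut_stab_plus K)\<rparr>"
  by (simp add: v_Aut_stab_plus_def)

lemma v_Aut_fix_plus_eq: "v_Aut_fix_plus K = v_Aut K\<lparr>carrier := carrier (v_Aut_fix_plus K)\<rparr>"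
  by (simp add: v_Aut_fix_plus_def)

lemma semidirect_decompositions:
  shows "units_action K e \<in> hom field_units_power (AutoGroup (units_of (one_units_plus K e)))
    \<and> ext_action K e \<Psi> \<in> hom (Aut_field \<times>\<times> UUT) (AutoGroup (int_factor K e))
    \<and> v_Aut_stab_plus K \<cong> semidirect (int_factor K e) (Aut_field \<times>\<times> UUT) (ext_action K e \<Psi>)
    \<and> ext_fix_action K e \<Psi> \<in> hom UUT (AutoGroup (int_factor K e))
    \<and> v_Aut_fix_plus K \<cong> semidirect (int_factor K e) UUT (ext_fix_action K e \<Psi>)"
  unfolding units_action_eq ext_action_eq ext_fix_action_eq
  using Int.action_hom Ext.action_hom Ext.iso_semidirect[OF Ext_image]
    Ext_fix.action_hom Ext_fix.iso_semidirect[OF Ext_fix_image]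
  by (simp only: v_Aut_stab_plus_eq[symmetric] v_Aut_fix_plus_eq[symmetric])

end

theorem theorem5p1p4:
  fixes K :: "('n::{finite,linorder} zlex \<Rightarrow> 'k::field) set"
    and e :: "'n \<Rightarrow> 'n zlex"
    and \<Psi> :: "('k \<Rightarrow> 'k) \<times> ('n zlex \<Rightarrow> 'n zlex) \<Rightarrow> ('n zlex \<Rightarrow> 'k) \<Rightarrow> ('n zlex \<Rightarrow> 'k)"
  assumes "hahn_field K"
    and "generate add_group (range e) = UNIV"
    and "first_lifting K \<Psi>"
    and "canonical_first_lifting_property K \<Longrightarrow>
           \<forall>p\<in>carrier (Aut_field \<times>\<times> o_Aut). \<Psi> p = restrict (canonical_lift p) K"
    and "\<not> canonical_first_lifting_property K \<Longrightarrow> ExtAut \<Psi> \<subseteq> carrier (v_Aut_stab_plus K)"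
    and "canonical_second_lifting_property K"
  shows "units_action K e \<in> hom field_units_power (AutoGroup (units_of (one_units_plus K e)))
    \<and> ext_action K e \<Psi> \<in> hom (Aut_field \<times>\<times> UUT) (AutoGroup (int_factor K e))
    \<and> v_Aut_stab_plus K \<cong> semidirect (int_factor K e) (Aut_field \<times>\<times> UUT) (ext_action K e \<Psi>)
    \<and> ext_fix_action K e \<Psi> \<in> hom UUT (AutoGroup (int_factor K e))
    \<and> v_Aut_fix_plus K \<cong> semidirect (int_factor K e) UUT (ext_fix_action K e \<Psi>)"
proof -
  interpret lifted_hahn_subfield K e \<Psi>
    by unfold_locales (use assms in auto)
  show ?thesis
    by (rule semidirect_decompositions)
qed

end
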